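(* Let $\Omega,\Omega_1\subset\mathbb R^2$ be bounded domains with Lipschitz boundary, let $\mathcal S\subset \mathrm{SO}(3)$ be a finite subgroup, and let $I_1\in C(\overline\Omega,\mathrm{SO}(3)/\mathcal S)$ and $I_2\in C(\overline\Omega_1,\mathrm{SO}(3)/\mathcal S)$. Let $\alpha,\beta>0$ and let $\mathbf I_2$ be the $2\times2$ identity matrix. Then the variational problem $$\inf_{\varphi\in\mathrm{BV}^2(\Omega,\overline\Omega_1)}\ \int_\Omega \mathrm d_{\mathrm{SO}(3)/\mathcal S}\bigl(\mathrm R(\nabla\varphi(x))\,I_1(x),\,I_2(\varphi(x))\bigr)\,\mathrm dx+\alpha\,\mathrm{TV}(\nabla\varphi-\mathbf I_2)+\beta\int_\Omega f(\det\nabla\varphi)\,\mathrm dx$$ admits a minimizer.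
   Context: **Function spaces.** $\mathcal T^2(\mathbb R^2)$ is the space of real $2\times2$ matrices with the Frobenius norm. For a matrix field $u\in L^1(\Omega,\mathcal T^2(\mathbb R^2))$, $\mathrm{TV}(u)=|Du|(\Omega)$ is its total variation (with respect to the Frobenius norm on 3-tensors), where $Du$ is the distributional derivative, and $\mathrm{BV}(\Omega,\mathcal T^2(\mathbb R^2))$ is the space of such $u$ with $\mathrm{TV}(u)<\infty$. $W^{1,1}(\Omega,\overline\Omega_1)$ is the set of $\varphi\in W^{1,1}(\Omega,\mathbb R^2)$ with $\varphi(x)\in\overline\Omega_1$ for a.e. $x\in\Omega$, and $$\mathrm{BV}^2(\Omega,\overline\Omega_1)=\{\varphi\in W^{1,1}(\Omega,\overline\Omega_1):\nabla\varphi\in\mathrm{BV}(\Omega,\mathcal T^2(\mathbb R^2))\},$$ where $\nabla\varphi$ is the weak Jacobian matrix field. **Distance.** Elements of $\mathrm{SO}(3)/\mathcal S$ are classes $[R]=\{RS: S\in\mathcal S\}$; $\mathrm{SO}(3)$ acts by $Q[R]=[QR]$. The distance is $\mathrm d_{\mathrm{SO}(3)/\mathcal S}([R_1],[R_2])=\min_{S\in\mathcal S}\mathrm d_{\mathrm{SO}(3)}(R_1S,R_2)$ with $\mathrm d_{\mathrm{SO}(3)}(R_1,R_2)=\sqrt2\arccos\bigl(\tfrac12(\mathrm{trace}(R_1^{T}R_2)-1)\bigr)$. **Rotation part.** For a $2\times 2$ matrix $A$ with $\det A>0$, let $A=R_AV_A$ be its unique polar decomposition, $R_A=A(A^{T}A)^{-1/2}\in\mathrm{SO}(2)$,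 $V_A$ symmetric positive definite, and set $\mathrm R(A)=\begin{pmatrix}R_A&0\\0&1\end{pmatrix}\in\mathrm{SO}(3)$. **Function $f$.** $f(x)=x^{-1}+x$ for $x>0$ and $f(x)=+\infty$ otherwise. **Convention.** The objective is $+\infty$ whenever $\int_\Omega f(\det\nabla\varphi)\,\mathrm dx=+\infty$; when this integral is finite, $\det\nabla\varphi>0$ a.e. in $\Omega$ and the first integral is well defined. *)

theory Defs
  imports "HOL-Analysis.Analysis" "HOL-Algebra.Left_Coset"
begin

subsection \<open>The group SO(3) and its quotients\<close>

definition SO3 :: "(real^3^3) monoid" where
  "SO3 = \<lparr>carrier = {R. rotation_matrix R}, mult = (**), one = mat 1\<rparr>"

definition dist_SO3 :: "real^3^3 \<Rightarrow> real^3^3 \<Rightarrow> real" where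
  "dist_SO3 R1 R2 = sqrt 2 * arccos ((trace (transpose R1 ** R2) - 1) / 2)"

text \<open>
  The class \<open>[R] = {RS | S \<in> \<S>}\<close> is the library's left coset \<open>R <# \<S>\<close>, the set of
  all classes is \<open>lcosets \<S>\<close>, and \<open>Q\<close> acts on a class \<open>A\<close> by \<open>Q <# A\<close>.
  In the distance below the elements \<open>R\<^sub>1S\<close> are exactly the elements \<open>P\<close> of the class \<open>A = [R\<^sub>1]\<close>,
  and \<open>R\<^sub>2\<close> is some representative of the class \<open>B\<close>; the value does not depend on its choice,
  see \<open>dist_class_coset\<close>.
\<close>

definition dist_class :: "(real^3^3) set \<Rightarrow> (real^3^3) set \<Rightarrow> real" where
  "dist_class A B = Min ((\<lambda>P. dist_SO3 P (SOME R2. R2 \<in> B)) ` A)"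

lemma group_SO3: "Group.group SO3"
proof (rule groupI)
  fix R assume "R \<in> carrier SO3"
  then have "transpose R \<in> carrier SO3" "transpose R \<otimes>\<^bsub>SO3\<^esub> R = \<one>\<^bsub>SO3\<^esub>"
    by (simp_all add: SO3_def rotation_matrix_def orthogonal_matrix_def)
  then show "\<exists>Q\<in>carrier SO3. Q \<otimes>\<^bsub>SO3\<^esub> R = \<one>\<^bsub>SO3\<^esub>"
    by blast
qed (simp_all add: SO3_def rotation_matrix_def orthogonal_matrix_mul det_mul matrix_mul_assoc
                orthogonal_matrix_id)

lemma dist_SO3_mult_right:
  assumes "T \<in> carrier SO3"
  shows "dist_SO3 (P ** T) (R ** T) = dist_SO3 P R"
proof -
  have T: "T ** transpose T = mat 1"
    using assms by (simp add: SO3_def rotation_matrix_def orthogonal_matrix_def)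
  have "trace (transpose (P ** T) ** (R ** T)) = trace (transpose T ** (transpose P ** R ** T))"
    by (simp add: matrix_transpose_mul matrix_mul_assoc)
  also have "\<dots> = trace (transpose P ** R ** T ** transpose T)"
    by (rule trace_mul_sym)
  also have "\<dots> = trace (transpose P ** R ** (T ** transpose T))"
    by (simp only: matrix_mul_assoc)
  finally show ?thesis
    by (simp add: dist_SO3_def T)
qed

lemma dist_class_coset:
  assumes S: "subgroup S SO3" and R1: "R1 \<in> carrier SO3" and R2: "R2 \<in> carrier SO3"
  shows "dist_class (R1 <#\<^bsub>SO3\<^esub> S) (R2 <#\<^bsub>SO3\<^esub> S) = Min ((\<lambda>S. dist_SO3 (R1 ** S) R2) ` S)"
proof -
  interpret Group.group SO3 by (rule group_SO3)
  define Q where "Q = (SOME Q. Q \<in> R2 <#\<^bsub>SO3\<^esub> S)"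
  have mult: "X \<otimes>\<^bsub>SO3\<^esub> Y = X ** Y" for X Y
    by (simp add: SO3_def)
  have coset: "R <#\<^bsub>SO3\<^esub> S = (\<lambda>T. R ** T) ` S" for R
    unfolding l_coset_def mult by blast
  have "R2 \<in> R2 <#\<^bsub>SO3\<^esub> S"
    using R2 S by (rule lcos_self)
  then have "Q \<in> R2 <#\<^bsub>SO3\<^esub> S"
    unfolding Q_def by (rule someI[where P = "\<lambda>Q. Q \<in> R2 <#\<^bsub>SO3\<^esub> S"])
  then obtain T where T: "T \<in> S" and Q: "Q = R2 ** T"
    unfolding coset by (elim imageE)
  have TG: "T \<in> carrier SO3"
    using S T by (rule subgroup.mem_carrier)
  have ST: "(\<lambda>X. X ** T) ` S = S"
  proof
    show "S \<subseteq> (\<lambda>X. X ** T) ` S"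
    proof
      fix X assume X: "X \<in> S"
      have XG: "X \<in> carrier SO3"
        using S X by (rule subgroup.mem_carrier)
      have "X \<otimes>\<^bsub>SO3\<^esub> inv\<^bsub>SO3\<^esub> T \<in> S"
        by (rule subgroup.m_closed[OF S X subgroup.m_inv_closed[OF S T]])
      moreover have "(X \<otimes>\<^bsub>SO3\<^esub> inv\<^bsub>SO3\<^esub> T) ** T = X"
        unfolding mult[symmetric] using XG TG by (simp only: m_assoc inv_closed l_inv r_one)
      ultimately show "X \<in> (\<lambda>X. X ** T) ` S"
        by (metis image_eqI)
    qed
    show "(\<lambda>X. X ** T) ` S \<subseteq> S"
      unfolding mult[symmetric] using subgroup.m_closed[OF S _ T] by blast
  qed
  have eq: "dist_SO3 (R1 ** (X ** T)) (R2 ** T) = dist_SO3 (R1 ** X) R2" for X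
    unfolding matrix_mul_assoc by (rule dist_SO3_mult_right[OF TG])
  have "(\<lambda>P. dist_SO3 P Q) ` (R1 <#\<^bsub>SO3\<^esub> S) = (\<lambda>X. dist_SO3 (R1 ** X) (R2 ** T)) ` S"
    unfolding coset Q image_image ..
  also have "\<dots> = (\<lambda>X. dist_SO3 (R1 ** X) (R2 ** T)) ` (\<lambda>X. X ** T) ` S"
    unfolding ST ..
  also have "\<dots> = (\<lambda>X. dist_SO3 (R1 ** X) R2) ` S"
    unfolding image_image eq ..
  finally show ?thesis
    unfolding dist_class_def Q_def[symmetric] by (rule arg_cong)
qed

definition continuous_class_map ::
    "(real^2) set \<Rightarrow> (real^3^3) set \<Rightarrow> (real^2 \<Rightarrow> (real^3^3) set) \<Rightarrow> bool" where
  "continuous_class_map K S I \<longleftrightarrow>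
     (\<forall>x\<in>K. I x \<in> lcosets\<^bsub>SO3\<^esub> S) \<and>
     (\<forall>x\<in>K. ((\<lambda>y. dist_class (I y) (I x)) \<longlongrightarrow> 0) (at x within K))"


subsection \<open>The rotation part of a matrix\<close>

definition posdef_sym :: "real^2^2 \<Rightarrow> bool" where
  "posdef_sym V \<longleftrightarrow> transpose V = V \<and> (\<forall>x. x \<noteq> 0 \<longrightarrow> x \<bullet> (V *v x) > 0)"

lemma rotation_matrix_2_iff: "rotation_matrix (R::real^2^2) \<longleftrightarrow> (\<exists>c s. c^2+s^2=1 \<and> R = vector [vector [c, -s], vector [s, c]])"
proof
  assume "rotation_matrix R"
  then have o: "transpose R ** R = mat 1" and d: "det R = 1"
    by (simp_all add: rotation_matrix_def orthogonal_matrix)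
  have 1: "R$1$1 * R$1$1 + R$2$1 * R$2$1 = 1" "R$1$1*R$1$2 + R$2$1*R$2$2 = 0"
    "R$1$2 * R$1$2 + R$2$2 * R$2$2 = 1" "R$1$1*R$2$2 - R$1$2*R$2$1 = 1"
    using o d by (simp_all add: vec_eq_iff forall_2 matrix_matrix_mult_def transpose_def mat_def sum_2 det_2)
  have "(R$1$1 - R$2$2)^2 + (R$1$2 + R$2$1)^2 = 0"
    using 1 by (simp add: power2_eq_square algebra_simps)
  then have "R$2$2 = R$1$1" "R$1$2 = - R$2$1"
    by (simp_all add: sum_power2_eq_zero_iff)
  then show "\<exists>c s. c^2+s^2=1 \<and> R = vector [vector [c, -s], vector [s, c]]"
    using 1 by (intro exI[of _ "R$1$1"] exI[of _ "R$2$1"]) (simp add: vec_eq_iff forall_2 power2_eq_square)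
next
  assume "\<exists>c s. c^2+s^2=1 \<and> R = vector [vector [c, -s], vector [s, c]]"
  then obtain c s where "c^2+s^2=1" "R = vector [vector [c, -s], vector [s, c]]" by blast
  then show "rotation_matrix R"
    by (simp add: rotation_matrix_def orthogonal_matrix vec_eq_iff forall_2 matrix_matrix_mult_def transpose_def mat_def sum_2 det_2 power2_eq_square algebra_simps)
qed

lemma posdef_sym_iff: "posdef_sym V \<longleftrightarrow> V$1$2 = V$2$1 \<and> V$1$1 + V$2$2 > 0 \<and> det V > 0"
proof -
  have q: "x \<bullet> (V *v x) = V$1$1 * (x$1)^2 + (V$1$2 + V$2$1) * x$1 * x$2 + V$2$2 * (x$2)^2" for x
    by (simp add: inner_vec_def sum_2 matrix_vector_mult_def power2_eq_square algebra_simps)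
  have t: "transpose V = V \<longleftrightarrow> V$1$2 = V$2$1"
    by (auto simp: vec_eq_iff forall_2 transpose_def)
  show ?thesis
  proof
    assume p: "posdef_sym V"
    then have s: "V$1$2 = V$2$1" by (simp add: posdef_sym_def t)
    have pp: "x \<noteq> 0 \<Longrightarrow> V$1$1 * (x$1)^2 + (V$1$2 + V$2$1) * x$1 * x$2 + V$2$2 * (x$2)^2 > 0" for x :: "real^2"
      using p by (simp add: posdef_sym_def flip: q)
    have a: "V$1$1 > 0" using pp[of "vector [1,0]"] by (simp add: vec_eq_iff forall_2)
    have b: "V$2$2 > 0" using pp[of "vector [0,1]"] by (simp add: vec_eq_iff forall_2)
    have "V$1$1 * (V$1$1 * V$2$2 - V$1$2 * V$2$1) > 0"
      using pp[of "vector [- V$1$2, V$1$1]"] a s by (simp add: vec_eq_iff forall_2 power2_eq_square algebra_simps)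
    then show "V$1$2 = V$2$1 \<and> V$1$1 + V$2$2 > 0 \<and> det V > 0"
      using a b s by (simp add: det_2 zero_less_mult_iff)
  next
    assume A: "V$1$2 = V$2$1 \<and> V$1$1 + V$2$2 > 0 \<and> det V > 0"
    then have dd: "V$1$1 * V$2$2 - V$1$2 * V$1$2 > 0" by (auto simp: det_2)
    then have "V$1$1 * V$2$2 > 0" by (smt (verit) zero_le_square)
    then have a: "V$1$1 > 0" using A by (auto simp: zero_less_mult_iff)
    have "x \<bullet> (V *v x) > 0" if "x \<noteq> 0" for x
    proof -
      have "V$1$1 * (x \<bullet> (V *v x)) = (V$1$1 * x$1 + V$1$2 * x$2)^2 + (V$1$1 * V$2$2 - V$1$2 * V$1$2) * (x$2)^2"
        unfolding q using A by (simp add: power2_eq_square algebra_simps)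
      also have "\<dots> > 0"
      proof (cases "x$2 = 0")
        case True
        then have "x$1 \<noteq> 0" using that by (simp add: vec_eq_iff forall_2)
        then show ?thesis using True a by simp
      next
        case False then show ?thesis using dd by (simp add: add_nonneg_pos)
      qed
      finally show ?thesis using a by (simp add: zero_less_mult_iff)
    qed
    then show "posdef_sym V" using A by (simp add: posdef_sym_def t)
  qed
qed

lemma polar_decomposition_unique:
  assumes "det (A::real^2^2) > 0"
  shows "\<exists>!R. rotation_matrix R \<and> (\<exists>V. posdef_sym V \<and> A = R ** V)"
proof -
  let ?p = "A$1$1" let ?q = "A$1$2" let ?r = "A$2$1" let ?t = "A$2$2"
  have d: "?p * ?t - ?q * ?r > 0" using assms by (simp add: det_2)
  have V: "A = R ** (transpose R ** A)" if "rotation_matrix R" for R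
    using that by (simp add: matrix_mul_assoc rotation_matrix_def orthogonal_matrix_def)
  have V': "V = transpose R ** A" if "rotation_matrix R" "A = R ** V" for R V
    using that by (simp add: matrix_mul_assoc rotation_matrix_def orthogonal_matrix)
  have iff: "(\<exists>V. posdef_sym V \<and> A = R ** V) \<longleftrightarrow> posdef_sym (transpose R ** A)" if "rotation_matrix R" for R
    using V[OF that] V'[OF that] by metis
  define n where "n = sqrt ((?p + ?t)^2 + (?r - ?q)^2)"
  have e: "(?p + ?t)^2 + (?r - ?q)^2 = (?p - ?t)^2 + (?r + ?q)^2 + 4 * (?p * ?t - ?q * ?r)"
    by (simp add: power2_eq_square algebra_simps)
  have e0: "(?p + ?t)^2 + (?r - ?q)^2 > 0" unfolding e using d by (simp add: add_nonneg_pos)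
  then have n: "n > 0" and n2: "n^2 = (?p + ?t)^2 + (?r - ?q)^2" by (simp_all add: n_def)
  have cond: "posdef_sym (transpose R ** A) \<longleftrightarrow> c * (?r - ?q) = s * (?p + ?t) \<and> c * (?p + ?t) + s * (?r - ?q) > 0"
    if R: "R = vector [vector [c, -s], vector [s, c]]" and cs: "c^2+s^2=1" for R c s
  proof -
    have "det R = 1" using cs by (simp add: R det_2 power2_eq_square)
    then show ?thesis using assms
      by (simp add: posdef_sym_iff det_mul) (auto simp: R matrix_matrix_mult_def transpose_def sum_2 algebra_simps)
  qed
  have sol: "c * (?r - ?q) = s * (?p + ?t) \<and> c * (?p + ?t) + s * (?r - ?q) > 0
     \<longleftrightarrow> c = (?p + ?t) / n \<and> s = (?r - ?q) / n" (is "?L \<longleftrightarrow> ?R") if cs: "c^2+s^2=1" for c s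
  proof
    assume L: ?L
    let ?m = "c * (?p + ?t) + s * (?r - ?q)"
    have "?m^2 + (c * (?r - ?q) - s * (?p + ?t))^2 = (c^2+s^2) * n^2"
      unfolding n2 by (simp add: power2_eq_square algebra_simps)
    then have "?m^2 = n^2" using L cs by simp
    then have m: "?m = n" using L n by (simp add: power2_eq_iff_nonneg)
    have "c * n = (c^2+s^2) * (?p + ?t) + s * (c * (?r - ?q) - s * (?p + ?t))" unfolding m[symmetric] by (simp add: power2_eq_square algebra_simps)
    moreover have "s * n = (c^2+s^2) * (?r - ?q) - c * (c * (?r - ?q) - s * (?p + ?t))" unfolding m[symmetric] by (simp add: power2_eq_square algebra_simps)
    ultimately show ?R using L cs n by (simp add: field_simps)
  next
    assume ?R
    then have c: "c = (?p + ?t) / n" and s: "s = (?r - ?q) / n" by auto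
    have "c * (?p + ?t) + s * (?r - ?q) = n^2 / n"
      unfolding c s n2 by (simp add: power2_eq_square add_divide_distrib distrib_right)
    then show ?L using n by (simp add: c s)
  qed
  let ?c = "(?p + ?t) / n" let ?s = "(?r - ?q) / n"
  have one: "?c^2 + ?s^2 = 1"
    unfolding power_divide n2 add_divide_distrib[symmetric] by (rule divide_self) (use e0 in linarith)
  let ?Q = "vector [vector [?c, -?s], vector [?s, ?c]] :: real^2^2"
  show ?thesis
  proof (rule ex1I[of _ ?Q])
    have "rotation_matrix ?Q" unfolding rotation_matrix_2_iff using one by blast
    then show "rotation_matrix ?Q \<and> (\<exists>V. posdef_sym V \<and> A = ?Q ** V)"
      using cond[OF refl one] sol[OF one] iff by auto
  next
    fix R assume "rotation_matrix R \<and> (\<exists>V. posdef_sym V \<and> A = R ** V)"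
    then have r: "rotation_matrix R" and p: "posdef_sym (transpose R ** A)" using iff by auto
    then obtain c s where cs: "c^2+s^2=1" and R: "R = vector [vector [c, -s], vector [s, c]]" using rotation_matrix_2_iff by blast
    then show "R = ?Q" using cond[OF R cs] sol[OF cs] p by simp
  qed
qed
text \<open>Only meaningful for \<open>det A > 0\<close>, see \<open>polar_decomposition_unique\<close>.\<close>

definition polar_rotation :: "real^2^2 \<Rightarrow> real^2^2" where
  "polar_rotation A = (THE R. rotation_matrix R \<and> (\<exists>V. posdef_sym V \<and> A = R ** V))"

definition rotation_part :: "real^2^2 \<Rightarrow> real^3^3" where
  "rotation_part A =
     (let R = polar_rotation A in
      vector [vector [R$1$1, R$1$2, 0],
              vector [R$2$1, R$2$2, 0],
              vector [0,     0,     1]])"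


subsection \<open>Lipschitz domains\<close>

text \<open>
  A domain is nonempty, open and connected. Its boundary is Lipschitz if near each boundary
  point, after an orthogonal change of coordinates, the domain is the strict
  epigraph of a Lipschitz function.
\<close>

definition bounded_lipschitz_domain :: "(real^2) set \<Rightarrow> bool" where
  "bounded_lipschitz_domain \<Omega> \<longleftrightarrow>
     open \<Omega> \<and> connected \<Omega> \<and> \<Omega> \<noteq> {} \<and> bounded \<Omega> \<and>
     (\<forall>x\<in>frontier \<Omega>. \<exists>r>0. \<exists>Q :: real^2^2. \<exists>\<gamma> :: real \<Rightarrow> real. \<exists>L.
        orthogonal_matrix Q \<and> L-lipschitz_on UNIV \<gamma> \<and>
        (\<forall>y\<in>ball x r. y \<in> \<Omega> \<longleftrightarrow> \<gamma> ((Q *v y) $ 1) < (Q *v y) $ 2))"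


subsection \<open>Weak derivatives, total variation and function spaces\<close>

definition partial :: "'n \<Rightarrow> (real^'n \<Rightarrow> 'b::real_normed_vector) \<Rightarrow> real^'n \<Rightarrow> 'b" where
  "partial k p x = frechet_derivative p (at x) (axis k 1)"

fun C_k :: "nat \<Rightarrow> (real^'n \<Rightarrow> 'b::real_normed_vector) \<Rightarrow> bool" where
  "C_k 0 p \<longleftrightarrow> continuous_on UNIV p"
| "C_k (Suc m) p \<longleftrightarrow> (\<forall>x. p differentiable (at x)) \<and> (\<forall>k. C_k m (partial k p))"

text \<open>Elements of \<open>C\<^sub>c\<^sup>\<infinity>(\<Omega>)\<close>, extended by zero to the whole space.\<close>

definition test_fun :: "(real^'n) set \<Rightarrow> (real^'n \<Rightarrow> 'b::real_normed_vector) \<Rightarrow> bool" where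
  "test_fun \<Omega> p \<longleftrightarrow>
     (\<forall>m. C_k m p) \<and> compact (closure {x. p x \<noteq> 0}) \<and> closure {x. p x \<noteq> 0} \<subseteq> \<Omega>"

definition is_weak_jacobian ::
    "(real^2) set \<Rightarrow> (real^2 \<Rightarrow> real^2) \<Rightarrow> (real^2 \<Rightarrow> real^2^2) \<Rightarrow> bool" where
  "is_weak_jacobian \<Omega> \<phi> G \<longleftrightarrow>
     integrable (lebesgue_on \<Omega>) G \<and>
     (\<forall>\<psi> :: real^2 \<Rightarrow> real. test_fun \<Omega> \<psi> \<longrightarrow>
        (\<forall>i j. (\<integral>x. \<phi> x $ i * partial j \<psi> x \<partial>lebesgue_on \<Omega>)
             = - (\<integral>x. G x $ i $ j * \<psi> x \<partial>lebesgue_on \<Omega>)))"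

text \<open>Sobolev and BV functions are represented by functions, not by classes of functions that
  agree almost everywhere. The weak Jacobian is unique almost everywhere; \<open>weak_jacobian\<close> is
  some representative.\<close>

definition weak_jacobian :: "(real^2) set \<Rightarrow> (real^2 \<Rightarrow> real^2) \<Rightarrow> real^2 \<Rightarrow> real^2^2" where
  "weak_jacobian \<Omega> \<phi> = (SOME G. is_weak_jacobian \<Omega> \<phi> G)"

definition W11 :: "(real^2) set \<Rightarrow> (real^2) set \<Rightarrow> (real^2 \<Rightarrow> real^2) set" where
  "W11 \<Omega> K = {\<phi>. integrable (lebesgue_on \<Omega>) \<phi> \<and> (\<exists>G. is_weak_jacobian \<Omega> \<phi> G) \<and>
                 (AE x in lebesgue_on \<Omega>. \<phi> x \<in> K)}"

text \<open>
  For \<open>u \<in> L\<^sup>1(\<Omega>)\<close> the supremum below is \<open>|Du|(\<Omega>)\<close>, the dual norm of the distribution \<open>Du\<close>,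
  and it is infinite if \<open>Du\<close> is not a finite measure. The library norm on iterated vector types
  such as \<open>real^2^2\<close> and \<open>real^2^2^2\<close> is the Frobenius norm.
\<close>

definition TV :: "(real^2) set \<Rightarrow> (real^2 \<Rightarrow> real^2^2) \<Rightarrow> ennreal" where
  "TV \<Omega> u = (SUP p \<in> {p :: real^2 \<Rightarrow> real^2^2^2. test_fun \<Omega> p \<and> (\<forall>x. norm (p x) \<le> 1)}.
     ennreal (\<integral>x. (\<Sum>i\<in>UNIV. \<Sum>j\<in>UNIV. \<Sum>k\<in>UNIV. u x $ i $ j * partial k p x $ i $ j $ k)
                \<partial>lebesgue_on \<Omega>))"

definition BV :: "(real^2) set \<Rightarrow> (real^2 \<Rightarrow> real^2^2) set" where
  "BV \<Omega> = {u. integrable (lebesgue_on \<Omega>) u \<and> TV \<Omega> u < \<infinity>}"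

definition BV2 :: "(real^2) set \<Rightarrow> (real^2) set \<Rightarrow> (real^2 \<Rightarrow> real^2) set" where
  "BV2 \<Omega> K = {\<phi> \<in> W11 \<Omega> K. weak_jacobian \<Omega> \<phi> \<in> BV \<Omega>}"


subsection \<open>The objective\<close>

definition f_det :: "real \<Rightarrow> ennreal" where
  "f_det x = (if x > 0 then ennreal (inverse x + x) else \<infinity>)"

text \<open>Since all three terms are in \<open>[0, \<infinity>]\<close> and \<open>\<beta> > 0\<close>, the objective is infinite
  whenever the last integral is.\<close>

definition objective ::
    "(real^2) set \<Rightarrow> (real^2 \<Rightarrow> (real^3^3) set) \<Rightarrow> (real^2 \<Rightarrow> (real^3^3) set) \<Rightarrow>
     real \<Rightarrow> real \<Rightarrow> (real^2 \<Rightarrow> real^2) \<Rightarrow> ennreal" where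
  "objective \<Omega> I1 I2 \<alpha> \<beta> \<phi> =
     (\<integral>\<^sup>+x. ennreal (dist_class (rotation_part (weak_jacobian \<Omega> \<phi> x) <#\<^bsub>SO3\<^esub> I1 x) (I2 (\<phi> x)))
         \<partial>lebesgue_on \<Omega>)
     + ennreal \<alpha> * TV \<Omega> (\<lambda>x. weak_jacobian \<Omega> \<phi> x - mat 1)
     + ennreal \<beta> * (\<integral>\<^sup>+x. f_det (det (weak_jacobian \<Omega> \<phi> x)) \<partial>lebesgue_on \<Omega>)"

end

theory Submission
  imports Defs "HOL-Complex_Analysis.Great_Picard"
begin

text \<open>
  The proof is the direct method. Along a minimizing sequence \<open>\<phi> n\<close> the total variation of the
  Jacobians is bounded, and the maps themselves are bounded since they take values in a bounded set.
  All that is needed is a subsequence along which the maps and their Jacobians converge almost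
  everywhere and against test functions, with integrable limits (\<open>weak_jacobian_limit\<close>); then each of
  the three terms is lower semicontinuous. The total variation is a supremum of weakly continuous
  functionals (\<open>TV_lower_semicontinuous\<close>). Since \<open>f_det\<close> is continuous with values in \<open>[0, \<infinity>]\<close>, Fatou's
  lemma applies to the determinant term (\<open>f_det_term_limit\<close>), and as the limit of that term is finite,
  the determinant of the limit is positive almost everywhere. Where it is positive, the rotation part
  and the distance of classes are continuous (\<open>dist_class_rotated_continuous\<close>), so Fatou's lemma also
  applies to the distance term (\<open>dist_term_limit\<close>).

  The compactness is obtained from test functions alone. A bound \<open>C\<close> on the variation of \<open>w\<close> says that \<open>w\<close>
  paired with \<open>\<partial>\<^sub>k \<psi>\<close> is at most \<open>C\<close> if \<open>\<bar>\<psi>\<bar> \<le> 1\<close>. Inserting integrals of test functions over segments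
  bounds the integral of \<open>\<bar>w (x + h) - w x\<bar>\<close> by \<open>2 * C * norm h\<close> over every set from which the segments
  from \<open>x\<close> to \<open>x + h\<close> stay in \<open>\<Omega>\<close> (\<open>translation_estimate\<close>). This one estimate is used three times.

  First, \<open>w\<close> is close in the mean to its averages over small balls. If \<open>w\<close> is a weak derivative of a
  bounded function, then these averages are bounded, and so are the integrals of \<open>\<bar>w\<bar>\<close> over compact
  subsets of \<open>\<Omega>\<close> (\<open>interior_L1_bound\<close>). Second, near a Lipschitz boundary a translation along the vertical
  direction of the graph moves \<open>\<Omega>\<close> into its interior, which carries the bound up to the boundary
  (\<open>boundary_L1_bound\<close>); this makes the limit Jacobian integrable on \<open>\<Omega>\<close>. Third, averages against a fixed
  smooth kernel are compact by a diagonal argument, and their closeness to \<open>w\<close> transfers compactness to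
  functions of bounded variation (\<open>tv_bounded_compactness\<close>). The components of the maps \<open>\<phi> n\<close> fall under the
  same compactness result, as the norms of their derivatives bound their variation.
\<close>

section \<open>Smooth functions and bumps\<close>

definition smooth :: "(real^'n \<Rightarrow> 'b::real_normed_vector) \<Rightarrow> bool" where
  "smooth f \<longleftrightarrow> (\<forall>m. C_k m f)"

lemma smooth_differentiable: "smooth f \<Longrightarrow> f differentiable (at x)"
  unfolding smooth_def by (metis C_k.simps(2))

lemma smooth_partial: "smooth f \<Longrightarrow> smooth (partial k f)"
  unfolding smooth_def by (metis C_k.simps(2))

lemma smooth_continuous: "smooth f \<Longrightarrow> continuous_on UNIV f"
  unfolding smooth_def by (metis C_k.simps(1))

text \<open>A class of differentiable functions that is closed under partial derivatives consists of smooth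
  functions. All smoothness proofs below exhibit such a class.\<close>

lemma smooth_coinduct:
  fixes f :: "real^'n \<Rightarrow> 'b::real_normed_vector"
  assumes "P f"
    and step: "\<And>f. P f \<Longrightarrow> (\<forall>x. f differentiable (at x)) \<and> (\<forall>k. P (partial k f))"
  shows "smooth f"
proof -
  have "P g \<Longrightarrow> C_k m g" for m and g :: "real^'n \<Rightarrow> 'b"
  proof (induction m arbitrary: g)
    case 0
    then show ?case
      using step by (auto intro!: differentiable_imp_continuous_on simp: differentiable_on_eq_differentiable_at)
  next
    case (Suc m)
    then show ?case using step by simp
  qed
  with \<open>P f\<close> show ?thesis by (simp add: smooth_def)
qed

lemma partial_eqI: "(p has_derivative D) (at x) \<Longrightarrow> partial k p x = D (axis k 1)"
  unfolding partial_def by (metis frechet_derivative_at)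

lemma frechet_derivative_expansion:
  fixes p :: "real^'n \<Rightarrow> 'b::real_normed_vector"
  assumes "p differentiable (at x)"
  shows "frechet_derivative p (at x) h = (\<Sum>k\<in>UNIV. h $ k *\<^sub>R partial k p x)"
proof -
  have lin: "linear (frechet_derivative p (at x))"
    using assms by (rule linear_frechet_derivative)
  have "frechet_derivative p (at x) h
      = frechet_derivative p (at x) (\<Sum>k\<in>UNIV. h $ k *\<^sub>R axis k 1)"
    using basis_expansion[of h] by (simp add: scalar_mult_eq_scaleR)
  also have "\<dots> = (\<Sum>k\<in>UNIV. h $ k *\<^sub>R partial k p x)"
    using lin by (simp add: linear_sum linear_scale partial_def)
  finally show ?thesis .
qed

lemma smooth_has_derivative:
  fixes p :: "real^'n \<Rightarrow> 'b::real_normed_vector"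
  assumes "smooth p"
  shows "(p has_derivative (\<lambda>h. \<Sum>k\<in>UNIV. h $ k *\<^sub>R partial k p x)) (at x)"
proof -
  have d: "p differentiable (at x)" using assms by (rule smooth_differentiable)
  have "frechet_derivative p (at x) = (\<lambda>h. \<Sum>k\<in>UNIV. h $ k *\<^sub>R partial k p x)"
    using frechet_derivative_expansion[OF d] by blast
  with d show ?thesis by (metis frechet_derivative_works)
qed

lemma partial_linear_compose:
  assumes "bounded_linear T" "p differentiable (at x)"
  shows "(\<lambda>x. T (p x)) differentiable (at x)" "partial k (\<lambda>x. T (p x)) x = T (partial k p x)"
proof -
  have "((\<lambda>x. T (p x)) has_derivative (\<lambda>h. T (frechet_derivative p (at x) h))) (at x)"
    using assms frechet_derivative_works by (blast intro: bounded_linear.has_derivative)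
  then show "(\<lambda>x. T (p x)) differentiable (at x)" "partial k (\<lambda>x. T (p x)) x = T (partial k p x)"
    by (auto simp: differentiable_def partial_eqI partial_def[of k p])
qed

lemma smooth_linear_compose:
  assumes T: "bounded_linear T" and p: "smooth p"
  shows "smooth (\<lambda>x. T (p x))"
proof (rule smooth_coinduct[where P = "\<lambda>f. \<exists>q. smooth q \<and> f = (\<lambda>x. T (q x))"], goal_cases)
  case 1 show ?case using p by blast
next
  case (2 f)
  then obtain q where q: "smooth q" and f: "f = (\<lambda>x. T (q x))" by blast
  have "partial k f = (\<lambda>x. T (partial k q x))" for k
    unfolding f using partial_linear_compose(2)[OF T smooth_differentiable[OF q]] by blast
  then show ?case
    using partial_linear_compose(1)[OF T smooth_differentiable[OF q]] smooth_partial[OF q] f by blast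
qed

text \<open>Two integrals have this shape: a convolution (\<open>L\<close> the identity), and an integral over a segment
  (\<open>w = 1\<close> and \<open>L s = s *\<^sub>R h\<close>).\<close>

lemma has_derivative_integral_translates:
  fixes g :: "real^'n \<Rightarrow> real" and w :: "'c::euclidean_space \<Rightarrow> real"
  assumes g: "smooth g" and w: "continuous_on UNIV w" and L: "continuous_on UNIV L"
  shows "((\<lambda>x. integral (cbox a b) (\<lambda>y. w y * g (x - L y))) has_derivative
      (\<lambda>h. \<Sum>k\<in>UNIV. h $ k * integral (cbox a b) (\<lambda>y. w y * partial k g (x - L y)))) (at x)"
proof -
  let ?D = "\<lambda>x y. \<Sum>k\<in>UNIV. (w y * partial k g (x - L y)) *\<^sub>R blinfun_inner_left (axis k 1) :: (real^'n) \<Rightarrow>\<^sub>L real"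
  have cg: "continuous_on UNIV g" and cp: "continuous_on UNIV (partial k g)" for k
    using g smooth_continuous smooth_partial by blast+
  have i: "(\<lambda>y. w y * partial k g (x - L y)) integrable_on cbox a b" for k x
    by (intro integrable_continuous continuous_intros continuous_on_compose2[OF cp]
        continuous_on_subset[OF w] continuous_on_subset[OF L]) auto
  have "((\<lambda>x. integral (cbox a b) (\<lambda>y. w y * g (x - L y))) has_derivative
      integral (cbox a b) (?D x)) (at x within UNIV)"
  proof (rule leibniz_rule)
    fix x t
    have "((\<lambda>x. g (x - L t)) has_derivative (\<lambda>h. \<Sum>k\<in>UNIV. h $ k *\<^sub>R partial k g (x - L t))) (at x)"
    proof -
      have "((\<lambda>x. x - L t) has_derivative (\<lambda>h. h)) (at x)"
        by (auto intro!: derivative_eq_intros)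
      from has_derivative_compose[OF this smooth_has_derivative[OF g]] show ?thesis .
    qed
    then have "((\<lambda>x. w t * g (x - L t)) has_derivative (\<lambda>h. w t * (\<Sum>k\<in>UNIV. h $ k *\<^sub>R partial k g (x - L t)))) (at x)"
      by (rule has_derivative_mult_right)
    moreover have "blinfun_apply (?D x t) = (\<lambda>h. w t * (\<Sum>k\<in>UNIV. h $ k *\<^sub>R partial k g (x - L t)))"
      by (auto simp: fun_eq_iff blinfun.sum_left blinfun.scaleR_left inner_axis sum_distrib_left ac_simps
          intro!: sum.cong)
    ultimately show "((\<lambda>x. w t * g (x - L t)) has_derivative blinfun_apply (?D x t)) (at x within UNIV)"
      by simp
  next
    fix x show "(\<lambda>y. w y * g (x - L y)) integrable_on cbox a b"
      by (intro integrable_continuous continuous_intros continuous_on_compose2[OF cg]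
          continuous_on_subset[OF w] continuous_on_subset[OF L]) auto
  next
    show "continuous_on (UNIV \<times> cbox a b) (\<lambda>(x, t). ?D x t)"
      unfolding case_prod_beta
      by (intro continuous_intros continuous_on_compose2[OF cp] continuous_on_compose2[OF w]
          continuous_on_compose2[OF L]) auto
  qed auto
  moreover have "blinfun_apply (integral (cbox a b) (?D x))
      = (\<lambda>h. \<Sum>k\<in>UNIV. h $ k * integral (cbox a b) (\<lambda>y. w y * partial k g (x - L y)))"
  proof -
    have "(\<lambda>t. (w t * partial k g (x - L t)) *\<^sub>R (blinfun_inner_left (axis k 1) :: (real^'n) \<Rightarrow>\<^sub>L real)) integrable_on cbox a b" for k
      by (rule integrable_on_scaleR_left[OF i])
    then have "integral (cbox a b) (?D x) = (\<Sum>k\<in>UNIV. integral (cbox a b) (\<lambda>y. (w y * partial k g (x - L y)) *\<^sub>R blinfun_inner_left (axis k 1)))"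
      by (intro integral_sum) auto
    also have "\<dots> = (\<Sum>k\<in>UNIV. integral (cbox a b) (\<lambda>y. w y * partial k g (x - L y)) *\<^sub>R blinfun_inner_left (axis k 1))"
      by (simp add: integral_unique[OF has_integral_scaleR_left[OF integrable_integral[OF i]]])
    finally show ?thesis
      by (simp add: fun_eq_iff blinfun.sum_left blinfun.scaleR_left inner_axis ac_simps)
  qed
  ultimately show ?thesis by simp
qed

lemma smooth_integral_translates:
  fixes g :: "real^'n \<Rightarrow> real" and w :: "'c::euclidean_space \<Rightarrow> real"
  assumes g: "smooth g" and w: "continuous_on UNIV w" and L: "continuous_on UNIV L"
  shows "smooth (\<lambda>x. integral (cbox a b) (\<lambda>y. w y * g (x - L y)))" (is "smooth (?F g)")
proof (rule smooth_coinduct[where P = "\<lambda>f. \<exists>g. smooth g \<and> f = ?F g"], goal_cases)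
  case 1 show ?case using g by blast
next
  case (2 f)
  then obtain h where h: "smooth h" and f: "f = ?F h" by blast
  note d = has_derivative_integral_translates[OF h w L, of a b]
  have "partial k f = ?F (partial k h)" for k
    unfolding f using partial_eqI[OF d] by (auto simp: fun_eq_iff axis_def if_distrib[of "\<lambda>x. x * _"] cong: if_cong)
  then show ?case
    using d h smooth_partial f differentiable_def by blast
qed

lemma poly_times_exp_minus_tendsto_0:
  fixes q :: "real poly"
  shows "((\<lambda>s. poly q s * exp (- s)) \<longlongrightarrow> 0) at_top"
proof -
  have "((\<lambda>s. \<Sum>i\<le>degree q. coeff q i * (s ^ i / exp s)) \<longlongrightarrow> (\<Sum>i\<le>degree q. coeff q i * 0)) at_top"
    by (intro tendsto_intros tendsto_power_div_exp_0)
  then show ?thesis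
    by (simp add: poly_altdef sum_distrib_right exp_minus divide_inverse mult.assoc)
qed

text \<open>The functions \<open>q (1 / t) * exp (- 1 / t)\<close>, continued by \<open>0\<close> to \<open>t \<le> 0\<close>: with polynomial factors the
  family is closed under differentiation.\<close>

definition flat_exp :: "real poly \<Rightarrow> real \<Rightarrow> real" where
  "flat_exp q t = (if t > 0 then poly q (inverse t) * exp (- inverse t) else 0)"

text \<open>Only \<open>t = 0\<close> needs an argument: the difference quotient from the right is again a polynomial in
  \<open>1 / t\<close> times \<open>exp (- 1 / t)\<close>, and the exponential wins.\<close>

lemma flat_exp_DERIV:
  "(flat_exp q has_real_derivative flat_exp ([:0,0,1:] * (q - pderiv q)) t) (at t)"
proof -
  consider "t > 0" | "t < 0" | "t = 0" by linarith
  then show ?thesis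
  proof cases
    case 1
    have "((\<lambda>t. poly q (inverse t) * exp (- inverse t)) has_real_derivative
        flat_exp ([:0,0,1:] * (q - pderiv q)) t) (at t)"
      using 1 by (auto intro!: derivative_eq_intros DERIV_chain2[OF poly_DERIV]
          simp: flat_exp_def power2_eq_square field_simps)
    then show ?thesis
      by (rule has_field_derivative_transform_within_open[where S = "{0<..}"])
        (use 1 in \<open>auto simp: flat_exp_def\<close>)
  next
    case 2
    have "((\<lambda>t. 0) has_real_derivative flat_exp ([:0,0,1:] * (q - pderiv q)) t) (at t)"
      using 2 by (auto simp: flat_exp_def)
    then show ?thesis
      by (rule has_field_derivative_transform_within_open[where S = "{..<0}"])
        (use 2 in \<open>auto simp: flat_exp_def\<close>)
  next
    case 3
    have "((\<lambda>t. poly ([:0,1:] * q) (inverse t) * exp (- inverse t)) \<longlongrightarrow> 0) (at_right 0)"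
      by (rule filterlim_compose[OF poly_times_exp_minus_tendsto_0 filterlim_inverse_at_top_right])
    then have "((\<lambda>t. flat_exp q t / t) \<longlongrightarrow> 0) (at_right 0)"
      by (rule Lim_transform_eventually)
        (auto simp: eventually_at_right_field flat_exp_def field_simps intro!: exI[of _ 1])
    moreover have "((\<lambda>t. flat_exp q t / t) \<longlongrightarrow> 0) (at_left 0)"
      by (rule tendsto_eventually) (auto simp: eventually_at_left_field flat_exp_def intro!: exI[of _ "-1"])
    ultimately have "((\<lambda>t. flat_exp q t / t) \<longlongrightarrow> 0) (at 0)"
      by (simp add: filterlim_split_at)
    then show ?thesis
      by (simp add: 3 has_field_derivative_iff flat_exp_def)
  qed
qed

text \<open>The constants are included so that derivatives, which carry numerical factors, stay in the class.\<close>

inductive bump_algebra :: "(real^'n \<Rightarrow> real) \<Rightarrow> bool" where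
  const: "bump_algebra (\<lambda>x. c)"
| flat: "bump_algebra (\<lambda>x. flat_exp q (c + s * x $ i))"
| add: "bump_algebra f \<Longrightarrow> bump_algebra g \<Longrightarrow> bump_algebra (\<lambda>x. f x + g x)"
| mult: "bump_algebra f \<Longrightarrow> bump_algebra g \<Longrightarrow> bump_algebra (\<lambda>x. f x * g x)"

lemma bump_algebra_partial:
  assumes "bump_algebra f"
  shows "(\<forall>x. f differentiable (at x)) \<and> (\<forall>k. bump_algebra (partial k f))"
  using assms
proof induction
  case (const c)
  have "partial k (\<lambda>x. c) = (\<lambda>x. 0)" for k :: 'a
    by (auto intro!: partial_eqI derivative_eq_intros)
  then show ?case using bump_algebra.const[of 0] by simp
next
  case (flat q c s i)
  let ?q = "[:0,0,1:] * (q - pderiv q)"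
  have d: "((\<lambda>x. flat_exp q (c + s * x $ i)) has_derivative (\<lambda>h. flat_exp ?q (c + s * x $ i) * (s * h $ i))) (at x)" for x :: "real^'a"
  proof -
    have "((\<lambda>x::real^'a. c + s * x $ i) has_derivative (\<lambda>h. s * h $ i)) (at x)"
      using has_derivative_add[OF has_derivative_const
          has_derivative_mult_right[OF bounded_linear_imp_has_derivative[OF bounded_linear_vec_nth]]]
      by simp
    then show ?thesis
      using has_derivative_compose[OF _ flat_exp_DERIV[unfolded has_field_derivative_def]] by blast
  qed
  have "partial k (\<lambda>x. flat_exp q (c + s * x $ i))
      = (\<lambda>x. flat_exp ?q (c + s * x $ i) * (s * axis k 1 $ i))" for k
    using partial_eqI[OF d] by blast
  moreover have "bump_algebra (\<lambda>x. flat_exp ?q (c + s * x $ i) * (s * axis k 1 $ i))" for k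
    by (rule bump_algebra.mult[OF bump_algebra.flat bump_algebra.const])
  ultimately show ?case using d unfolding differentiable_def by auto
next
  case (add f g)
  have d: "((\<lambda>x. f x + g x) has_derivative (\<lambda>h. frechet_derivative f (at x) h + frechet_derivative g (at x) h)) (at x)" for x
    using add frechet_derivative_works by (blast intro: has_derivative_add)
  have "partial k (\<lambda>x. f x + g x) = (\<lambda>x. partial k f x + partial k g x)" for k
    using partial_eqI[OF d] by (auto simp: partial_def)
  moreover have "bump_algebra (\<lambda>x. partial k f x + partial k g x)" for k
    by (rule bump_algebra.add) (use add in auto)
  ultimately show ?case using d unfolding differentiable_def by auto
next
  case (mult f g)
  have d: "((\<lambda>x. f x * g x) has_derivative (\<lambda>h. f x * frechet_derivative g (at x) h + frechet_derivative f (at x) h * g x)) (at x)" for x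
    using mult frechet_derivative_works by (blast intro: has_derivative_mult)
  have "partial k (\<lambda>x. f x * g x) = (\<lambda>x. f x * partial k g x + partial k f x * g x)" for k
    using partial_eqI[OF d] by (auto simp: partial_def)
  moreover have "bump_algebra (\<lambda>x. f x * partial k g x + partial k f x * g x)" for k
    by (rule bump_algebra.add[OF bump_algebra.mult bump_algebra.mult]) (use mult in auto)
  ultimately show ?case using d unfolding differentiable_def by auto
qed

lemma bump_algebra_smooth: "bump_algebra f \<Longrightarrow> smooth f"
  by (rule smooth_coinduct[where P = bump_algebra]) (auto simp: bump_algebra_partial)

text \<open>The product of the four flat functions of \<open>r \<plusminus> x $ 1\<close> and \<open>r \<plusminus> x $ 2\<close> vanishes off the square of
  half-width \<open>r = \<epsilon> / 2\<close>, which lies in the ball of radius \<open>\<epsilon>\<close>.\<close>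

lemma bump_exists:
  fixes \<epsilon> :: real
  assumes "\<epsilon> > 0"
  obtains \<eta> :: "real^2 \<Rightarrow> real" where "smooth \<eta>" "\<And>x. 0 \<le> \<eta> x" "\<And>x. norm x \<ge> \<epsilon> \<Longrightarrow> \<eta> x = 0"
    "integrable lborel \<eta>" "(LBINT x. \<eta> x) = 1"
proof -
  define r where "r = \<epsilon> / 2"
  have r: "r > 0" using assms by (simp add: r_def)
  let ?f = "\<lambda>s (i::2) x :: real^2. flat_exp 1 (r + s * x $ i)"
  define \<rho> where "\<rho> = (\<lambda>x. (?f 1 1 x * ?f (-1) 1 x) * (?f 1 2 x * ?f (-1) 2 x))"
  have F: "bump_algebra (?f s i)" for s i by (rule bump_algebra.flat)
  have A: "bump_algebra \<rho>" unfolding \<rho>_def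
    by (rule bump_algebra.mult[OF bump_algebra.mult[OF F F] bump_algebra.mult[OF F F]])
  have e: "flat_exp 1 t \<ge> 0" "flat_exp 1 t \<noteq> 0 \<longleftrightarrow> t > 0" for t
    by (auto simp: flat_exp_def)
  have nn: "\<rho> x \<ge> 0" for x unfolding \<rho>_def by (intro mult_nonneg_nonneg e)
  have z: "\<rho> x = 0" if "norm x \<ge> \<epsilon>" for x
  proof (rule ccontr)
    assume "\<rho> x \<noteq> 0"
    then have "r + 1 * x $ 1 > 0" "r + - 1 * x $ 1 > 0" "r + 1 * x $ 2 > 0" "r + - 1 * x $ 2 > 0"
      unfolding \<rho>_def mult_eq_0_iff de_Morgan_disj e by blast+
    then have "\<bar>x $ 1\<bar> < r" "\<bar>x $ 2\<bar> < r" by linarith+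
    moreover have "norm x \<le> \<bar>x $ 1\<bar> + \<bar>x $ 2\<bar>"
      using norm_le_l1_cart[of x] by (simp add: sum_2)
    ultimately show False using that by (simp add: r_def)
  qed
  have c: "continuous_on UNIV \<rho>" using A bump_algebra_smooth smooth_continuous by blast
  have "integrable lborel (\<lambda>x. indicator (cball 0 \<epsilon>) x *\<^sub>R \<rho> x)"
    by (rule borel_integrable_compact) (auto intro: continuous_on_subset[OF c])
  also have "(\<lambda>x. indicator (cball 0 \<epsilon>) x *\<^sub>R \<rho> x) = \<rho>"
    using z by (auto simp: fun_eq_iff indicator_def)
  finally have int: "integrable lborel \<rho>" .
  have "(LBINT x. \<rho> x) > 0"
  proof -
    have "\<rho> 0 > 0" using r by (simp add: \<rho>_def flat_exp_def)
    then have "\<not> (AE x in lborel. \<rho> x = 0)"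
    proof -
      have o: "open {x. \<rho> x \<noteq> 0}"
        using c by (intro open_Collect_neq) auto
      have "\<not> negligible {x. \<rho> x \<noteq> 0}"
        using open_not_negligible[OF o] \<open>\<rho> 0 > 0\<close> by force
      then have "{x. \<rho> x \<noteq> 0} \<notin> null_sets lborel"
        by (metis negligible_iff_null_sets null_sets_completionI)
      then show ?thesis
        by (subst AE_iff_null) (use o in \<open>auto simp: borel_measurable_continuous_onI[OF c]\<close>)
    qed
    then have "(LBINT x. \<rho> x) \<noteq> 0"
      using integral_nonneg_eq_0_iff_AE[OF int] nn by auto
    moreover have "(LBINT x. \<rho> x) \<ge> 0" using nn by simp
    ultimately show ?thesis by simp
  qed
  then obtain I where I: "I = (LBINT x. \<rho> x)" "I > 0" by blast
  show ?thesis
  proof (rule that[of "\<lambda>x. inverse I * \<rho> x"])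
    show "smooth (\<lambda>x. inverse I * \<rho> x)"
      by (intro bump_algebra_smooth bump_algebra.mult[OF bump_algebra.const A])
    show "integrable lborel (\<lambda>x. inverse I * \<rho> x)" using int by simp
    show "(LBINT x. inverse I * \<rho> x) = 1" using I by simp
  qed (use I nn z in auto)
qed

section \<open>Test functions and duality\<close>

lemma distr_lborel_affine_unit:
  assumes "c = 1 \<or> c = -1"
  shows "distr lborel borel (\<lambda>x. t + c *\<^sub>R x) = (lborel :: 'a::euclidean_space measure)"
proof -
  have "(lborel :: 'a measure) = density (distr lborel borel (\<lambda>x. t + c *\<^sub>R x)) (\<lambda>_. ennreal (\<bar>c\<bar> ^ DIM('a)))"
    using assms by (intro lborel_affine) auto
  also have "(\<lambda>_. ennreal (\<bar>c\<bar> ^ DIM('a))) = (\<lambda>_. 1)" using assms by auto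
  finally show ?thesis by (simp add: density_1)
qed

lemma
  fixes f :: "'a::euclidean_space \<Rightarrow> real"
  assumes f[measurable]: "f \<in> borel_measurable borel"
  shows integral_lborel_translate: "(LBINT x. f (x + t)) = (LBINT x. f x)"
    and integral_lborel_reflect: "(LBINT x. f (t - x)) = (LBINT x. f x)"
    and integrable_lborel_translate: "integrable lborel (\<lambda>x. f (x + t)) = integrable lborel f"
    and integrable_lborel_reflect: "integrable lborel (\<lambda>x. f (t - x)) = integrable lborel f"
proof -
  have 1: "distr lborel borel (\<lambda>x. t + 1 *\<^sub>R x) = (lborel :: 'a measure)"
    and 2: "distr lborel borel (\<lambda>x. t + (-1) *\<^sub>R x) = (lborel :: 'a measure)"
    by (rule distr_lborel_affine_unit, simp)+
  have m: "(\<lambda>x. t + c *\<^sub>R x) \<in> lborel \<rightarrow>\<^sub>M borel" for c by simp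
  have "(LBINT x. f x) = (\<integral>x. f x \<partial>distr lborel borel (\<lambda>x. t + 1 *\<^sub>R x))" by (simp only: 1)
  then show "(LBINT x. f (x + t)) = (LBINT x. f x)"
    using integral_distr[OF m[of 1] f] by (simp add: add.commute)
  have "(LBINT x. f x) = (\<integral>x. f x \<partial>distr lborel borel (\<lambda>x. t + (-1) *\<^sub>R x))" by (simp only: 2)
  then show "(LBINT x. f (t - x)) = (LBINT x. f x)"
    using integral_distr[OF m[of "-1"] f] by simp
  have "integrable lborel f = integrable (distr lborel borel (\<lambda>x. t + 1 *\<^sub>R x)) f" by (simp only: 1)
  then show "integrable lborel (\<lambda>x. f (x + t)) = integrable lborel f"
    using integrable_distr_eq[OF m[of 1] f] by (simp add: add.commute)
  have "integrable lborel f = integrable (distr lborel borel (\<lambda>x. t + (-1) *\<^sub>R x)) f" by (simp only: 2)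
  then show "integrable lborel (\<lambda>x. f (t - x)) = integrable lborel f"
    using integrable_distr_eq[OF m[of "-1"] f] by simp
qed

lemma continuous_compact_support:
  fixes f :: "'a::euclidean_space \<Rightarrow> real"
  assumes c: "continuous_on UNIV f" and z: "\<And>x. x \<notin> cbox a b \<Longrightarrow> f x = 0"
  shows "integrable lborel f" "integral (cbox a b) f = (LBINT x. f x)"
proof -
  have "integrable lborel (\<lambda>x. indicator (cbox a b) x *\<^sub>R f x)"
    by (rule borel_integrable_compact) (auto intro: continuous_on_subset[OF c])
  also have "(\<lambda>x. indicator (cbox a b) x *\<^sub>R f x) = f"
    using z by (auto simp: fun_eq_iff indicator_def)
  finally show i: "integrable lborel f" .
  have "integral (cbox a b) f = integral UNIV (\<lambda>x. if x \<in> cbox a b then f x else 0)"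
    by (rule integral_restrict_UNIV[symmetric])
  also have "(\<lambda>x. if x \<in> cbox a b then f x else 0) = f"
    using z by (auto simp: fun_eq_iff)
  finally show "integral (cbox a b) f = (LBINT x. f x)"
    using integral_lborel[OF i] by simp
qed

lemma test_fun_smooth: "test_fun U p \<Longrightarrow> smooth p"
  by (simp add: test_fun_def smooth_def)

lemma test_fun_support: "test_fun U p \<Longrightarrow> \<exists>K. compact K \<and> K \<subseteq> U \<and> (\<forall>x. x \<notin> K \<longrightarrow> p x = 0)"
  unfolding test_fun_def using closure_subset[of "{x. p x \<noteq> 0}"]
  by (intro exI[of _ "closure {x. p x \<noteq> 0}"]) auto

lemma test_funI:
  assumes "smooth p" "compact K" "K \<subseteq> U" "\<And>x. x \<notin> K \<Longrightarrow> p x = 0"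
  shows "test_fun U p"
proof -
  have "{x. p x \<noteq> 0} \<subseteq> K" using assms(4) by blast
  then have "closure {x. p x \<noteq> 0} \<subseteq> K"
    using assms(2) by (simp add: closure_minimal compact_imp_closed)
  moreover from this have "compact (closure {x. p x \<noteq> 0})"
    using assms(2) bounded_subset unfolding compact_eq_bounded_closed by blast
  ultimately show ?thesis
    using assms(1,3) unfolding test_fun_def smooth_def by simp
qed

lemma test_fun_eq_0: "test_fun U p \<Longrightarrow> x \<notin> U \<Longrightarrow> p x = 0"
  using test_fun_support by blast

lemma test_fun_0: "test_fun U (\<lambda>x. 0::real)"
proof (rule test_funI[of _ "{}"])
  show "smooth (\<lambda>x::real^'a. 0::real)" by (rule bump_algebra_smooth[OF bump_algebra.const])
qed auto

lemma test_fun_partial: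
  assumes "test_fun U p" shows "test_fun U (partial k p)"
proof -
  obtain K where K: "compact K" "K \<subseteq> U" "\<And>x. x \<notin> K \<Longrightarrow> p x = 0"
    using test_fun_support[OF assms] by blast
  show ?thesis
  proof (rule test_funI[OF smooth_partial[OF test_fun_smooth[OF assms]] K(1,2)])
    fix x assume x: "x \<notin> K"
    have "((\<lambda>x. 0) has_derivative (\<lambda>h. 0)) (at x)" by simp
    then have "(p has_derivative (\<lambda>h. 0)) (at x)"
      by (rule has_derivative_transform_within_open[where s = "- K"])
        (use x K compact_imp_closed in \<open>auto simp: open_Compl\<close>)
    then show "partial k p x = 0" by (rule partial_eqI)
  qed
qed

lemma test_fun_linear_compose:
  assumes T: "bounded_linear T" and p: "test_fun U p"
  shows "test_fun U (\<lambda>x. T (p x))"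
proof -
  obtain K where K: "compact K" "K \<subseteq> U" "\<And>x. x \<notin> K \<Longrightarrow> p x = 0"
    using test_fun_support[OF p] by blast
  show ?thesis
    by (rule test_funI[OF smooth_linear_compose[OF T test_fun_smooth[OF p]] K(1,2)])
      (simp add: K(3) linear_0[OF bounded_linear.linear[OF T]])
qed

lemma test_fun_partial_linear_compose:
  assumes T: "bounded_linear T" and p: "test_fun U p"
  shows "partial k (\<lambda>x. T (p x)) = (\<lambda>x. T (partial k p x))"
  using partial_linear_compose(2)[OF T smooth_differentiable[OF test_fun_smooth[OF p]]] by blast

lemma test_fun_continuous: "test_fun U p \<Longrightarrow> continuous_on UNIV p"
  by (rule smooth_continuous[OF test_fun_smooth])

lemma test_fun_borel: "test_fun U p \<Longrightarrow> p \<in> borel_measurable borel"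
  by (rule borel_measurable_continuous_onI[OF test_fun_continuous])

lemma test_fun_bounded:
  assumes "test_fun U p"
  shows "\<exists>B>0. \<forall>x. norm (p x) \<le> B"
proof -
  obtain K where K: "compact K" "\<And>x. x \<notin> K \<Longrightarrow> p x = 0"
    using test_fun_support[OF assms] by blast
  have "compact (p ` K)"
    by (rule compact_continuous_image[OF continuous_on_subset[OF test_fun_continuous[OF assms]] K(1)]) simp
  then obtain B where "B > 0" "\<And>x. x \<in> K \<Longrightarrow> norm (p x) \<le> B"
    using compact_imp_bounded bounded_pos[of "p ` K"] by auto
  then show ?thesis using K(2) by (metis norm_zero less_imp_le)
qed

lemma test_fun_cbox:
  fixes p :: "real^'n \<Rightarrow> real"
  assumes "test_fun U p"
  shows "\<exists>R>0. \<forall>x. norm x > R \<longrightarrow> p x = 0"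
proof -
  obtain K where K: "compact K" "\<And>x. x \<notin> K \<Longrightarrow> p x = 0"
    using test_fun_support[OF assms] by blast
  obtain R where "R > 0" "\<And>x. x \<in> K \<Longrightarrow> norm x \<le> R"
    using compact_imp_bounded[OF K(1)] bounded_pos by blast
  then show ?thesis using K(2) by (metis not_le)
qed

lemma cball_in_cbox: "\<exists>a b. cball (0::'a::euclidean_space) R \<subseteq> cbox a b"
  using bounded_subset_cbox_symmetric[OF bounded_cball[of "0::'a" R]] by blast

lemma test_fun_integrable:
  fixes p :: "real^'n \<Rightarrow> real"
  assumes "test_fun U p" shows "integrable lborel p"
proof -
  obtain R where R: "\<And>x. norm x > R \<Longrightarrow> p x = 0" using test_fun_cbox[OF assms] by blast
  obtain a b where ab: "cball (0::real^'n) R \<subseteq> cbox a b" using cball_in_cbox by blast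
  show ?thesis
    by (rule continuous_compact_support(1)[OF test_fun_continuous[OF assms], of a b])
      (use R ab in \<open>force simp: not_le[symmetric]\<close>)
qed

lemma integrable_mult_test_fun:
  fixes p w :: "real^'n \<Rightarrow> real"
  assumes "test_fun U p" "integrable lborel w" shows "integrable lborel (\<lambda>x. w x * p x)"
proof -
  obtain B where B: "B > 0" "\<And>x. norm (p x) \<le> B" using test_fun_bounded[OF assms(1)] by blast
  have [measurable]: "p \<in> borel_measurable borel" "w \<in> borel_measurable borel"
    using test_fun_borel[OF assms(1)] assms(2) by auto
  show ?thesis
  proof (rule Bochner_Integration.integrable_bound[OF integrable_mult_right[OF assms(2), of B]])
    show "AE x in lborel. norm (w x * p x) \<le> norm (B * w x)"
      using B by (auto simp: abs_mult mult.commute[of B] intro!: mult_left_mono)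
  qed simp
qed

text \<open>The integral of \<open>\<psi> (x - y)\<close> over a large box does not depend on \<open>x\<close> near the origin, so
  its derivative, which is the integral of the derivative, vanishes.\<close>

lemma integral_partial_test_fun:
  fixes \<psi> :: "real^'n \<Rightarrow> real"
  assumes \<psi>: "test_fun U \<psi>"
  shows "(LBINT x. partial k \<psi> x) = 0"
proof -
  obtain R where R: "R > 0" "\<And>x. norm x > R \<Longrightarrow> \<psi> x = 0" using test_fun_cbox[OF \<psi>] by blast
  obtain R' where R': "R' > 0" "\<And>x. norm x > R' \<Longrightarrow> partial k \<psi> x = 0"
    using test_fun_cbox[OF test_fun_partial[OF \<psi>]] by blast
  obtain a b where ab: "cball (0::real^'n) (max (R + 1) R') \<subseteq> cbox a b" using cball_in_cbox by blast
  have big: "norm y > max (R + 1) R'" if "y \<notin> cbox a b" for y using that ab by force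
  note c = test_fun_continuous[OF \<psi>] test_fun_continuous[OF test_fun_partial[OF \<psi>]]
  let ?F = "\<lambda>x. integral (cbox a b) (\<lambda>y. 1 * \<psi> (x - y))"
  have "(?F has_derivative (\<lambda>h. \<Sum>k\<in>UNIV. h $ k * integral (cbox a b) (\<lambda>y. 1 * partial k \<psi> (0 - y)))) (at 0)"
    by (rule has_derivative_integral_translates[OF test_fun_smooth[OF \<psi>]]) auto
  moreover have "?F x = (LBINT x. \<psi> x)" if "x \<in> ball 0 1" for x
  proof -
    have "?F x = (LBINT y. \<psi> (x - y))"
      unfolding mult_1
    proof (rule continuous_compact_support(2))
      show "continuous_on UNIV (\<lambda>y. \<psi> (x - y))"
        by (intro continuous_on_compose2[OF c(1)] continuous_intros) auto
      fix y assume "y \<notin> cbox a b"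
      moreover have "norm (x - y) \<ge> norm y - norm x" by norm
      ultimately show "\<psi> (x - y) = 0" using big[of y] that by (intro R(2)) auto
    qed
    also have "\<dots> = (LBINT x. \<psi> x)"
      by (rule integral_lborel_reflect[OF test_fun_borel[OF \<psi>]])
    finally show ?thesis .
  qed
  then have "(?F has_derivative (\<lambda>h. 0)) (at 0)"
    by (intro has_derivative_transform_within_open[where s = "ball 0 1",
          OF has_derivative_const[of "LBINT x. \<psi> x"]]) auto
  ultimately have "(\<lambda>h::real^'n. \<Sum>k\<in>UNIV. h $ k * integral (cbox a b) (\<lambda>y. 1 * partial k \<psi> (0 - y))) = (\<lambda>h. 0)"
    by (rule has_derivative_unique)
  from fun_cong[OF this, of "axis k 1"]
  have "0 = integral (cbox a b) (\<lambda>y. partial k \<psi> (0 - y))"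
    by (simp add: axis_def if_distrib[of "\<lambda>x. x * _"] cong: if_cong)
  also have "\<dots> = (LBINT y. partial k \<psi> (0 - y))"
  proof (rule continuous_compact_support(2))
    show "continuous_on UNIV (\<lambda>y. partial k \<psi> (0 - y))"
      by (intro continuous_on_compose2[OF c(2)] continuous_intros) auto
    fix y assume "y \<notin> cbox a b"
    then show "partial k \<psi> (0 - y) = 0" using big[of y] by (intro R'(2)) auto
  qed
  also have "\<dots> = (LBINT y. partial k \<psi> y)"
    by (rule integral_lborel_reflect[OF test_fun_borel[OF test_fun_partial[OF \<psi>]]])
  finally show ?thesis by simp
qed

lemma compact_support_uniformly_continuous:
  fixes g :: "'a::euclidean_space \<Rightarrow> real"
  assumes g: "continuous_on UNIV g" and K: "compact K" and z: "\<And>x. x \<notin> K \<Longrightarrow> g x = 0" and e: "e > 0"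
  obtains d where "d > 0" "\<And>x y. norm (x - y) < d \<Longrightarrow> \<bar>g y - g x\<bar> \<le> e"
proof -
  obtain R where R: "R > 0" "\<And>x. x \<in> K \<Longrightarrow> norm x \<le> R"
    using compact_imp_bounded[OF K] bounded_pos by blast
  have "uniformly_continuous_on (cball 0 (R + 1)) g"
    by (rule compact_uniformly_continuous[OF continuous_on_subset[OF g]]) auto
  then obtain d2 where d2: "d2 > 0"
    "\<And>x y. x \<in> cball 0 (R+1) \<Longrightarrow> y \<in> cball 0 (R+1) \<Longrightarrow> dist y x < d2 \<Longrightarrow> dist (g y) (g x) < e"
    unfolding uniformly_continuous_on_def using e by metis
  show ?thesis
  proof (rule that[of "min d2 1"])
    show "\<bar>g y - g x\<bar> \<le> e" if d: "norm (x - y) < min d2 1" for x y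
    proof (cases "x \<in> K \<or> y \<in> K")
      case True
      moreover have "norm x \<le> norm y + norm (x - y)" "norm y \<le> norm x + norm (x - y)" by norm+
      ultimately have "x \<in> cball 0 (R+1)" "y \<in> cball 0 (R+1)" using R d by fastforce+
      moreover have "dist y x < d2" using d by (simp add: dist_norm norm_minus_commute)
      ultimately show ?thesis using d2(2) by (fastforce simp: dist_norm)
    next
      case False then show ?thesis using z e by auto
    qed
  qed (use d2 in auto)
qed

text \<open>Convolve \<open>g\<close> with a bump whose width is smaller than the distance from \<open>K\<close> to the complement of \<open>U\<close>
  and small for the modulus of continuity of \<open>g\<close>. Averages keep the bound \<open>1\<close>.\<close>

lemma mollification:
  fixes g :: "real^2 \<Rightarrow> real"
  assumes g: "continuous_on UNIV g" and U: "open U" and K: "compact K" "K \<subseteq> U"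
    and z: "\<And>x. x \<notin> K \<Longrightarrow> g x = 0" and b: "\<And>x. \<bar>g x\<bar> \<le> 1" and e: "e > 0"
  obtains \<psi> where "test_fun U \<psi>" "\<And>x. \<bar>\<psi> x\<bar> \<le> 1" "\<And>x. \<bar>\<psi> x - g x\<bar> \<le> e"
proof -
  obtain d1 where d1: "d1 > 0" "(\<Union>x\<in>K. ball x d1) \<subseteq> U"
    using compact_subset_open_imp_ball_epsilon_subset[OF K(1) U K(2)] by blast
  obtain R where R: "R > 0" "\<And>x. x \<in> K \<Longrightarrow> norm x \<le> R"
    using compact_imp_bounded[OF K(1)] bounded_pos by blast
  obtain d2 where d2: "d2 > 0" "\<And>x y. norm (x - y) < d2 \<Longrightarrow> \<bar>g y - g x\<bar> \<le> e"
    using compact_support_uniformly_continuous[OF g K(1) z e] by blast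
  define d where "d = min (d1 / 2) d2"
  have d: "d > 0" "d < d1" "d \<le> d2" using d1 d2 by (auto simp: d_def)
  have u: "\<bar>g y - g x\<bar> \<le> e" if "norm (x - y) < d" for x y
    using d2(2) d that by force
  obtain \<eta> :: "real^2 \<Rightarrow> real" where \<eta>: "smooth \<eta>" "\<And>x. 0 \<le> \<eta> x" "\<And>x. norm x \<ge> d \<Longrightarrow> \<eta> x = 0"
    "integrable lborel \<eta>" "(LBINT x. \<eta> x) = 1"
    using bump_exists[OF d(1)] by metis
  have c\<eta>: "continuous_on UNIV \<eta>" by (rule smooth_continuous[OF \<eta>(1)])
  have [measurable]: "\<eta> \<in> borel_measurable borel" "g \<in> borel_measurable borel"
    using c\<eta> g by (auto intro: borel_measurable_continuous_onI)
  have i\<eta>: "integrable lborel (\<lambda>y. \<eta> (x - y))" "(LBINT y. \<eta> (x - y)) = 1" for x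
    using \<eta> by (simp_all add: integrable_lborel_reflect integral_lborel_reflect)
  obtain a b where ab: "cball (0::real^2) R \<subseteq> cbox a b" using cball_in_cbox by blast
  have gz: "g y = 0" if "y \<notin> cbox a b" for y using that ab R z by force
  define \<psi> where "\<psi> = (\<lambda>x. integral (cbox a b) (\<lambda>y. g y * \<eta> (x - y)))"
  have cg: "continuous_on UNIV (\<lambda>y. g y * \<eta> (x - y))" for x
    by (intro continuous_intros g continuous_on_compose2[OF c\<eta>]) auto
  have \<psi>: "\<psi> x = (LBINT y. g y * \<eta> (x - y))" and i: "integrable lborel (\<lambda>y. g y * \<eta> (x - y))" for x
    unfolding \<psi>_def using continuous_compact_support[OF cg, of a b] gz by simp_all
  show ?thesis
  proof
    show "test_fun U \<psi>"
    proof (rule test_funI)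
      show "smooth \<psi>" unfolding \<psi>_def
        by (rule smooth_integral_translates[OF \<eta>(1) g]) auto
      show "compact {x + y |x y. x \<in> K \<and> y \<in> cball 0 d}"
        using K by (intro compact_sums) auto
      show "{x + y |x y. x \<in> K \<and> y \<in> cball 0 d} \<subseteq> U"
      proof safe
        fix x y :: "real^2" assume "x \<in> K" "y \<in> cball 0 d"
        then have "x + y \<in> ball x d1" using d by (simp add: dist_norm)
        then show "x + y \<in> U" using d1(2) \<open>x \<in> K\<close> by blast
      qed
      fix x assume x: "x \<notin> {x + y |x y. x \<in> K \<and> y \<in> cball 0 d}"
      have "g y * \<eta> (x - y) = 0" for y
      proof (cases "y \<in> K")
        case True
        then have "x - y \<notin> cball 0 d" using x by force
        then show ?thesis using \<eta>(3) by simp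
      qed (simp add: z)
      then have "(\<lambda>y. g y * \<eta> (x - y)) = (\<lambda>y. 0)" by (rule ext)
      then show "\<psi> x = 0" unfolding \<psi> by simp
    qed
    fix x
    show "\<bar>\<psi> x\<bar> \<le> 1"
    proof -
      have "\<bar>\<psi> x\<bar> \<le> (LBINT y. \<bar>g y * \<eta> (x - y)\<bar>)" unfolding \<psi> by (rule integral_abs_bound)
      also have "\<dots> \<le> (LBINT y. \<eta> (x - y))"
      proof (intro integral_mono)
        show "integrable lborel (\<lambda>y. \<bar>g y * \<eta> (x - y)\<bar>)" by (rule integrable_abs[OF i])
        show "\<bar>g y * \<eta> (x - y)\<bar> \<le> \<eta> (x - y)" for y
          using b[of y] \<eta>(2)[of "x - y"] by (simp add: abs_mult mult_left_le_one_le)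
      qed (rule i\<eta>)
      finally show ?thesis using i\<eta> by simp
    qed
    show "\<bar>\<psi> x - g x\<bar> \<le> e"
    proof -
      have "\<psi> x - g x = (LBINT y. g y * \<eta> (x - y) - g x * \<eta> (x - y))"
        using i i\<eta> by (simp add: \<psi>)
      also have "\<bar>\<dots>\<bar> \<le> (LBINT y. \<bar>g y * \<eta> (x - y) - g x * \<eta> (x - y)\<bar>)" by (rule integral_abs_bound)
      also have "\<dots> \<le> (LBINT y. e * \<eta> (x - y))"
      proof (intro integral_mono)
        fix y
        have "\<bar>g y * \<eta> (x - y) - g x * \<eta> (x - y)\<bar> = \<bar>g y - g x\<bar> * \<eta> (x - y)"
          using \<eta>(2)[of "x - y"] by (simp add: abs_mult flip: left_diff_distrib)
        also have "\<dots> \<le> e * \<eta> (x - y)"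
          using u[of x y] \<eta>(2,3)[of "x - y"] by (cases "norm (x - y) < d") (auto intro: mult_right_mono)
        finally show "\<bar>g y * \<eta> (x - y) - g x * \<eta> (x - y)\<bar> \<le> e * \<eta> (x - y)" .
      qed (use i i\<eta> in auto)
      finally show ?thesis using i\<eta> by simp
    qed
  qed
qed

text \<open>The norm is the pairing of \<open>w\<close> with its sign. The sign is an almost everywhere limit of continuous
  functions; clamped to \<open>[-1, 1]\<close>, cut off near the boundary of \<open>U\<close> and mollified these become test
  functions, and dominated convergence applies. With \<open>B = 0\<close> this is the fundamental lemma of the
  calculus of variations.\<close>

lemma L1_norm_le_by_test_functions:
  fixes w :: "real^2 \<Rightarrow> real"
  assumes U: "open U" "bounded U" and w: "integrable lborel w"
    and dual: "\<And>\<psi>. test_fun U \<psi> \<Longrightarrow> (\<And>x. \<bar>\<psi> x\<bar> \<le> 1) \<Longrightarrow> (LBINT x. w x * \<psi> x) \<le> B"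
  shows "(LBINT x. indicator U x * \<bar>w x\<bar>) \<le> B"
proof -
  have [measurable]: "w \<in> borel_measurable borel" using w by auto
  have *: "(LBINT x. w x * g x) \<le> B"
    if g: "continuous_on UNIV g" and K: "compact K" "K \<subseteq> U" and z: "\<And>x. x \<notin> K \<Longrightarrow> g x = 0" and b: "\<And>x. \<bar>g x\<bar> \<le> 1" for g K
  proof (rule field_le_epsilon)
    fix e :: real assume e: "e > 0"
    define I where "I = (LBINT x. \<bar>w x\<bar>)"
    have I: "I \<ge> 0" by (simp add: I_def)
    then have "e / (I + 1) > 0" using e by (intro divide_pos_pos) linarith+
    then obtain \<psi> where \<psi>: "test_fun U \<psi>" "\<And>x. \<bar>\<psi> x\<bar> \<le> 1" "\<And>x. \<bar>\<psi> x - g x\<bar> \<le> e / (I + 1)"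
      using mollification[OF g U(1) K z b] by metis
    have [measurable]: "g \<in> borel_measurable borel" using g by (rule borel_measurable_continuous_onI)
    have i: "integrable lborel (\<lambda>x. w x * g x)"
      by (rule Bochner_Integration.integrable_bound[OF w]) (use b in \<open>auto simp: abs_mult intro!: mult_right_le_one_le\<close>)
    note i' = integrable_mult_test_fun[OF \<psi>(1) w]
    have "(LBINT x. w x * g x) - (LBINT x. w x * \<psi> x) = (LBINT x. w x * g x - w x * \<psi> x)"
      using i i' by simp
    also have "\<dots> \<le> (LBINT x. e / (I + 1) * \<bar>w x\<bar>)"
    proof (rule integral_mono)
      fix x
      have "w x * g x - w x * \<psi> x \<le> \<bar>w x\<bar> * \<bar>\<psi> x - g x\<bar>"
        by (simp add: abs_mult[symmetric] right_diff_distrib)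
      also have "\<dots> \<le> \<bar>w x\<bar> * (e / (I + 1))" using \<psi>(3) by (intro mult_left_mono) auto
      finally show "w x * g x - w x * \<psi> x \<le> e / (I + 1) * \<bar>w x\<bar>" by (simp add: mult.commute)
    qed (use i i' w in auto)
    also have "\<dots> = e / (I + 1) * I" by (simp add: I_def)
    also have "\<dots> \<le> e" using e I by (simp add: divide_le_eq distrib_left)
    finally show "(LBINT x. w x * g x) \<le> B + e" using dual[OF \<psi>(1,2)] by simp
  qed
  have "(\<lambda>x. sgn (w x)) measurable_on UNIV"
    by (rule lebesgue_measurable_imp_measurable_on) (auto intro: measurable_completion)
  then obtain N g where N: "negligible N" and g: "\<And>n. continuous_on UNIV (g n)"
    and lim: "\<And>x. x \<notin> N \<Longrightarrow> (\<lambda>n. g n x) \<longlonglongrightarrow> sgn (w x)"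
    unfolding measurable_on_def by auto
  have ne: "- U \<noteq> {}" using U(2) by (metis Compl_UNIV_eq double_complement not_bounded_UNIV)
  \<comment> \<open>\<open>cut n\<close> is supported at distance \<open>1 / Suc n\<close> from the complement of \<open>U\<close>, and \<open>cut n x\<close> is eventually \<open>1\<close> on \<open>U\<close>.\<close>
  define cut where "cut = (\<lambda>n x. max 0 (min 1 (real (Suc n) * infdist x (- U) - 1)))"
  define h where "h = (\<lambda>n x. cut n x * max (-1) (min 1 (g n x)))"
  have cut: "0 \<le> cut n x" "cut n x \<le> 1" for n x by (auto simp: cut_def)
  have "\<bar>max (-1) (min 1 (g n x))\<bar> \<le> 1" for n x by auto
  then have h1: "\<bar>h n x\<bar> \<le> 1" for n x
    unfolding h_def abs_mult using cut[of n x] by (intro mult_le_one) auto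
  have ch: "continuous_on UNIV (h n)" for n
    unfolding h_def cut_def by (intro continuous_intros g)
  have [measurable]: "h n \<in> borel_measurable borel" for n
    using ch by (rule borel_measurable_continuous_onI)
  have [measurable]: "U \<in> sets borel" using U(1) by simp
  have hB: "(LBINT x. w x * h n x) \<le> B" for n
  proof (rule *[OF ch])
    let ?K = "{x. infdist x (- U) \<ge> 1 / real (Suc n)}"
    show sub: "?K \<subseteq> U"
    proof
      fix x assume "x \<in> ?K"
      moreover have "1 / real (Suc n) > 0" by simp
      ultimately have "infdist x (- U) \<noteq> 0" by (auto simp del: of_nat_Suc)
      then show "x \<in> U" by (metis ComplI infdist_zero)
    qed
    have "closed ?K" by (intro closed_Collect_le continuous_intros)
    then show "compact ?K" using sub U(2) bounded_subset compact_eq_bounded_closed by blast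
    fix x assume "x \<notin> ?K"
    then have "real (Suc n) * infdist x (- U) < 1" by (simp add: field_simps del: of_nat_Suc)
    then show "h n x = 0" by (simp add: h_def cut_def del: of_nat_Suc)
  qed (rule h1)
  have lim_h: "(\<lambda>n. w x * h n x) \<longlonglongrightarrow> indicator U x * \<bar>w x\<bar>" if x: "x \<notin> N" for x
  proof (cases "x \<in> U")
    case True
    have "infdist x (- U) > 0"
      using True U(1) ne by (metis ComplD closed_Compl in_closed_iff_infdist_zero infdist_nonneg less_eq_real_def)
    then have "filterlim (\<lambda>n. real (Suc n) * infdist x (- U) - 1) at_top sequentially"
      by real_asymp
    then have "eventually (\<lambda>n. real (Suc n) * infdist x (- U) - 1 \<ge> 1) sequentially"
      unfolding filterlim_at_top by blast
    then have ev: "eventually (\<lambda>n. cut n x = 1) sequentially"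
      by eventually_elim (simp add: cut_def)
    have "(\<lambda>n. cut n x) \<longlonglongrightarrow> 1" using ev by (rule tendsto_eventually)
    moreover have "(\<lambda>n. max (-1) (min 1 (g n x))) \<longlonglongrightarrow> max (-1) (min 1 (sgn (w x)))"
      by (intro tendsto_intros lim x)
    moreover have "max (-1) (min 1 (sgn (w x))) = sgn (w x)" by (auto simp: sgn_real_def)
    ultimately have "(\<lambda>n. w x * h n x) \<longlonglongrightarrow> w x * (1 * sgn (w x))"
      unfolding h_def by (intro tendsto_intros) auto
    then show ?thesis using True by (simp add: abs_sgn)
  next
    case False
    then have "infdist x (- U) = 0" by simp
    then show ?thesis using False by (simp add: h_def cut_def)
  qed
  have AE: "AE x in lborel. (\<lambda>n. w x * h n x) \<longlonglongrightarrow> indicator U x * \<bar>w x\<bar>"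
  proof -
    have "AE x in lebesgue. x \<notin> N" using N by (simp add: AE_not_in negligible_iff_null_sets)
    then have "AE x in lborel. x \<notin> N" by (simp add: AE_completion_iff)
    then show ?thesis by eventually_elim (rule lim_h)
  qed
  have "(\<lambda>n. LBINT x. w x * h n x) \<longlonglongrightarrow> (LBINT x. indicator U x * \<bar>w x\<bar>)"
    by (rule integral_dominated_convergence[where w = "\<lambda>x. \<bar>w x\<bar>"])
      (use w AE h1 in \<open>auto simp: abs_mult intro!: mult_right_le_one_le\<close>)
  then show ?thesis
    using hB by (meson LIMSEQ_le_const2)
qed

section \<open>Translation estimates for functions of bounded variation\<close>

text \<open>The real-valued form of a bound on the total variation in \<open>\<Omega>\<close>. The function is Borel measurable and
  lives on the whole plane, extended by zero, so that translations and Tonelli's theorem for Lebesgue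
  measure apply to it. A one-sided bound suffices because \<open>- \<psi>\<close> is a test function, too.\<close>

definition tv_bounded :: "(real^2) set \<Rightarrow> real \<Rightarrow> (real^2 \<Rightarrow> real) \<Rightarrow> bool" where
  "tv_bounded \<Omega> C w \<longleftrightarrow> integrable lborel w \<and> (\<forall>x. x \<notin> \<Omega> \<longrightarrow> w x = 0) \<and>
     (\<forall>k \<psi>. test_fun \<Omega> \<psi> \<longrightarrow> (\<forall>x. \<bar>\<psi> x\<bar> \<le> 1) \<longrightarrow> (LBINT x. w x * partial k \<psi> x) \<le> C)"

lemma tv_bounded_abs:
  assumes w: "tv_bounded \<Omega> C w" and \<psi>: "test_fun \<Omega> \<psi>" "\<And>x. \<bar>\<psi> x\<bar> \<le> 1"
  shows "\<bar>LBINT x. w x * partial k \<psi> x\<bar> \<le> C"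
proof -
  have lin: "bounded_linear (\<lambda>t::real. - t)"
    by (intro bounded_linear_minus bounded_linear_ident)
  have "(LBINT x. w x * partial k \<psi> x) \<le> C"
    using assms by (auto simp: tv_bounded_def)
  moreover have "(LBINT x. w x * partial k (\<lambda>x. - \<psi> x) x) \<le> C"
    using w \<psi> test_fun_linear_compose[OF lin \<psi>(1)] by (auto simp: tv_bounded_def)
  then have "- (LBINT x. w x * partial k \<psi> x) \<le> C"
    by (simp add: test_fun_partial_linear_compose[OF lin \<psi>(1)])
  ultimately show ?thesis by linarith
qed

lemma tv_bounded_nonneg: "tv_bounded \<Omega> C w \<Longrightarrow> 0 \<le> C"
  using tv_bounded_abs[of \<Omega> C w "\<lambda>x. 0"] test_fun_0[of \<Omega>] by (metis abs_ge_zero abs_zero order_trans zero_le_one)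

text \<open>The function \<open>\<Psi> x = \<integral>s. g (x - s *\<^sub>R h)\<close>, with \<open>s\<close> in \<open>[0, 1]\<close>, has the derivative \<open>g x - g (x - h)\<close> in
  the direction \<open>h\<close> by the fundamental theorem of calculus, and its support is swept out by segments
  that start in \<open>V\<close>.\<close>

lemma partial_integral_segment:
  fixes g :: "real^2 \<Rightarrow> real"
  assumes g: "test_fun V g" "\<And>x. \<bar>g x\<bar> \<le> 1" and seg: "\<And>x s. x \<in> V \<Longrightarrow> 0 \<le> s \<Longrightarrow> s \<le> 1 \<Longrightarrow> x + s *\<^sub>R h \<in> \<Omega>"
  obtains \<Psi> :: "real^2 \<Rightarrow> real" where "test_fun \<Omega> \<Psi>" "\<And>x. \<bar>\<Psi> x\<bar> \<le> 1"
    "\<And>x. (\<Sum>k\<in>UNIV. h $ k * partial k \<Psi> x) = g x - g (x - h)"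
proof
  let ?\<Psi> = "\<lambda>x. integral (cbox 0 1) (\<lambda>s::real. 1 * g (x - s *\<^sub>R h))"
  note sg = test_fun_smooth[OF g(1)]
  have cg: "continuous_on A (\<lambda>s::real. g (x - s *\<^sub>R h))" for x A
    by (rule continuous_on_compose2[OF test_fun_continuous[OF g(1)]]) (auto intro!: continuous_intros)
  obtain K where K: "compact K" "K \<subseteq> V" "\<And>x. x \<notin> K \<Longrightarrow> g x = 0"
    using test_fun_support[OF g(1)] by blast
  show "test_fun \<Omega> ?\<Psi>"
  proof (rule test_funI)
    show "smooth ?\<Psi>"
      by (rule smooth_integral_translates[OF sg]) (auto intro!: continuous_intros)
    let ?K = "(\<lambda>(x, s). x + s *\<^sub>R h) ` (K \<times> {0..1})"
    show "compact ?K"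
      by (intro compact_continuous_image compact_Times K compact_Icc)
        (auto intro!: continuous_intros simp: case_prod_beta)
    show "?K \<subseteq> \<Omega>" using seg K(2) by auto
    fix x assume x: "x \<notin> ?K"
    have "g (x - s *\<^sub>R h) = 0" if "s \<in> cbox 0 1" for s
    proof (rule K(3), rule)
      assume "x - s *\<^sub>R h \<in> K"
      then have "(\<lambda>(x, s). x + s *\<^sub>R h) (x - s *\<^sub>R h, s) \<in> ?K" using that by (intro imageI) auto
      then show False using x by simp
    qed
    then have "integral (cbox 0 1) (\<lambda>s. 1 * g (x - s *\<^sub>R h)) = integral (cbox 0 1) (\<lambda>s::real. 0::real)"
      by (intro Henstock_Kurzweil_Integration.integral_cong) auto
    then show "?\<Psi> x = 0" by simp
  qed
  show "\<bar>?\<Psi> x\<bar> \<le> 1" for x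
    using integral_bound[of 0 1 "\<lambda>s. g (x - s *\<^sub>R h)" 1] cg g(2) by (simp add: cbox_interval)
  fix x
  have P: "partial k ?\<Psi> x = integral (cbox 0 1) (\<lambda>s. 1 * partial k g (x - s *\<^sub>R h))" for k
  proof -
    have "(?\<Psi> has_derivative (\<lambda>h'. \<Sum>k\<in>UNIV. h' $ k * integral (cbox 0 1) (\<lambda>s. 1 * partial k g (x - s *\<^sub>R h)))) (at x)"
      by (rule has_derivative_integral_translates[OF sg]) (auto intro!: continuous_intros)
    from partial_eqI[OF this] show ?thesis
      by (simp add: axis_def if_distrib[of "\<lambda>x. x * _"] cong: if_cong)
  qed
  have cp: "continuous_on A (\<lambda>s::real. partial k g (x - s *\<^sub>R h))" for A k
    by (rule continuous_on_compose2[OF smooth_continuous[OF smooth_partial[OF sg]]]) (auto intro!: continuous_intros)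
  have ip: "(\<lambda>s. h $ k * partial k g (x - s *\<^sub>R h)) integrable_on cbox 0 1" for k
    by (intro integrable_continuous continuous_intros cp)
  have "((\<lambda>s. \<Sum>k\<in>UNIV. h $ k * partial k g (x - s *\<^sub>R h)) has_integral (- g (x - 1 *\<^sub>R h)) - (- g (x - 0 *\<^sub>R h))) {0..1}"
  proof (rule fundamental_theorem_of_calculus)
    fix s :: real
    have 1: "((\<lambda>s. x - s *\<^sub>R h) has_derivative (\<lambda>t. - (t *\<^sub>R h))) (at s within {0..1})"
      by (auto intro!: derivative_eq_intros)
    have "((\<lambda>s. - g (x - s *\<^sub>R h)) has_derivative
        (\<lambda>t. - (\<Sum>k\<in>UNIV. (- (t *\<^sub>R h)) $ k *\<^sub>R partial k g (x - s *\<^sub>R h)))) (at s within {0..1})"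
      by (rule has_derivative_minus[OF has_derivative_compose[OF 1 smooth_has_derivative[OF sg]]])
    then show "((\<lambda>s. - g (x - s *\<^sub>R h)) has_vector_derivative (\<Sum>k\<in>UNIV. h $ k * partial k g (x - s *\<^sub>R h))) (at s within {0..1})"
      by (simp add: has_vector_derivative_def sum_negf sum_distrib_left mult.assoc)
  qed simp
  then have "integral (cbox 0 1) (\<lambda>s. \<Sum>k\<in>UNIV. h $ k * partial k g (x - s *\<^sub>R h)) = g x - g (x - h)"
    by (simp add: cbox_interval integral_unique)
  then show "(\<Sum>k\<in>UNIV. h $ k * partial k ?\<Psi> x) = g x - g (x - h)"
    unfolding P using ip by (simp add: integral_sum)
qed

text \<open>By duality: after moving the translation to the test function \<open>g\<close>, the pairing becomes that of \<open>w\<close>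
  with the derivative of \<open>\<Psi>\<close> in the direction \<open>h\<close>. Each of the two coordinates of \<open>h\<close> contributes at most
  \<open>C * norm h\<close>.\<close>

lemma translation_estimate:
  assumes w: "tv_bounded \<Omega> C w" and V: "open V" "bounded V"
    and seg: "\<And>x s. x \<in> V \<Longrightarrow> 0 \<le> s \<Longrightarrow> s \<le> 1 \<Longrightarrow> x + s *\<^sub>R h \<in> \<Omega>"
  shows "(LBINT x. indicator V x * \<bar>w (x + h) - w x\<bar>) \<le> 2 * C * norm h"
proof (rule L1_norm_le_by_test_functions[OF V])
  have wi: "integrable lborel w" using w by (simp add: tv_bounded_def)
  then have [measurable]: "w \<in> borel_measurable borel" by auto
  have whi: "integrable lborel (\<lambda>x. w (x + h))" using wi by (simp add: integrable_lborel_translate)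
  show "integrable lborel (\<lambda>x. w (x + h) - w x)" using wi whi by simp
  fix g assume g: "test_fun V g" "\<And>x. \<bar>g x\<bar> \<le> (1::real)"
  have [measurable]: "g \<in> borel_measurable borel" by (rule test_fun_borel[OF g(1)])
  obtain \<Psi> where \<Psi>: "test_fun \<Omega> \<Psi>" "\<And>x. \<bar>\<Psi> x\<bar> \<le> 1"
    "\<And>x. (\<Sum>k\<in>UNIV. h $ k * partial k \<Psi> x) = g x - g (x - h)"
    using partial_integral_segment[OF g seg] by blast
  note i1 = integrable_mult_test_fun[OF g(1) wi] and i2 = integrable_mult_test_fun[OF g(1) whi]
  have i3: "integrable lborel (\<lambda>x. w x * g (x - h))"
    using i2 integrable_lborel_translate[of "\<lambda>x. w x * g (x - h)" h] by simp
  have ip: "integrable lborel (\<lambda>x. w x * partial k \<Psi> x)" for k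
    by (rule integrable_mult_test_fun[OF test_fun_partial[OF \<Psi>(1)] wi])
  have "(LBINT x. (w (x + h) - w x) * g x) = (LBINT x. w (x + h) * g x) - (LBINT x. w x * g x)"
    using i1 i2 by (simp add: left_diff_distrib)
  also have "(LBINT x. w (x + h) * g x) = (LBINT x. w x * g (x - h))"
    using integral_lborel_translate[of "\<lambda>x. w x * g (x - h)" h] by simp
  also have "\<dots> - (LBINT x. w x * g x) = - (LBINT x. w x * (g x - g (x - h)))"
    using i1 i3 by (simp add: right_diff_distrib)
  also have "(LBINT x. w x * (g x - g (x - h))) = (LBINT x. (\<Sum>k\<in>UNIV. h $ k * (w x * partial k \<Psi> x)))"
    unfolding \<Psi>(3)[symmetric] by (simp add: sum_distrib_left ac_simps)
  also have "\<dots> = (\<Sum>k\<in>UNIV. h $ k * (LBINT x. w x * partial k \<Psi> x))"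
    using ip by simp
  also have "- \<dots> \<le> (\<Sum>k\<in>UNIV. \<bar>h $ k * (LBINT x. w x * partial k \<Psi> x)\<bar>)"
    using sum_abs[of "\<lambda>k. h $ k * (LBINT x. w x * partial k \<Psi> x)" UNIV] by linarith
  also have "\<dots> \<le> (\<Sum>k\<in>(UNIV::2 set). norm h * C)"
  proof (rule sum_mono)
    fix k
    show "\<bar>h $ k * (LBINT x. w x * partial k \<Psi> x)\<bar> \<le> norm h * C"
      unfolding abs_mult using tv_bounded_abs[OF w \<Psi>(1,2)] component_le_norm_cart[of h k]
      by (intro mult_mono) auto
  qed
  finally show "(LBINT x. (w (x + h) - w x) * g x) \<le> 2 * C * norm h" by (simp add: ac_simps)
qed

lemma integrable_bounded_mult:
  fixes w k :: "'a::euclidean_space \<Rightarrow> real"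
  assumes w: "integrable lborel w" and k: "k \<in> borel_measurable borel" "\<And>x. \<bar>k x\<bar> \<le> K"
  shows "integrable lborel (\<lambda>x. w x * k x)"
proof (rule Bochner_Integration.integrable_bound[OF integrable_mult_right[OF w, of K]])
  have [measurable]: "w \<in> borel_measurable borel" using w by auto
  note k(1)[measurable]
  show "(\<lambda>x. w x * k x) \<in> borel_measurable lborel" by measurable
  have "\<bar>w x\<bar> * \<bar>k x\<bar> \<le> \<bar>w x\<bar> * \<bar>K\<bar>" for x
    using k(2)[of x] by (intro mult_left_mono) auto
  then show "AE x in lborel. norm (w x * k x) \<le> norm (K * w x)"
    by (auto simp: abs_mult mult.commute)
qed

text \<open>The deviation of \<open>w\<close> from its average against \<open>k\<close> is an average of the differences \<open>w (x + z) - w x\<close>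
  over \<open>norm z < \<epsilon>\<close>, so that the translation estimate can be integrated over \<open>z\<close>.\<close>

lemma kernel_approximation:
  assumes w: "tv_bounded \<Omega> C w"
    and k: "k \<in> borel_measurable borel" "\<And>x. 0 \<le> k x" "\<And>x. k x \<le> K" "integrable lborel k"
      "(LBINT x. k x) = 1" "\<And>z. norm z \<ge> \<epsilon> \<Longrightarrow> k z = 0"
    and V: "open V" "bounded V" "\<And>x. x \<in> V \<Longrightarrow> ball x \<epsilon> \<subseteq> \<Omega>"
  shows "(\<integral>\<^sup>+x. indicator V x * ennreal \<bar>w x - (LBINT y. w y * k (y - x))\<bar> \<partial>lborel) \<le> ennreal (2 * C * \<epsilon>)"
proof -
  have wi: "integrable lborel w" using w by (simp add: tv_bounded_def)
  then have [measurable]: "w \<in> borel_measurable borel" by auto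
  have [measurable]: "V \<in> sets borel" using V(1) by simp
  note k(1)[measurable]
  have C: "0 \<le> C" by (rule tv_bounded_nonneg[OF w])
  have kK: "\<bar>k x\<bar> \<le> K" for x using k(2,3)[of x] by simp
  have pw: "ennreal \<bar>w x - (LBINT y. w y * k (y - x))\<bar> \<le> (\<integral>\<^sup>+z. ennreal (\<bar>w (x + z) - w x\<bar> * k z) \<partial>lborel)" for x
  proof -
    have wxi: "integrable lborel (\<lambda>z. w (z + x))" using wi by (simp add: integrable_lborel_translate)
    have i1: "integrable lborel (\<lambda>z. w (z + x) * k z)"
      by (rule integrable_bounded_mult[OF wxi k(1) kK])
    have "(LBINT y. w y * k (y - x)) = (LBINT z. w (z + x) * k z)"
      using integral_lborel_translate[of "\<lambda>y. w y * k (y - x)" x] by simp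
    then have "\<bar>w x - (LBINT y. w y * k (y - x))\<bar> = \<bar>LBINT z. w (z + x) * k z - w x * k z\<bar>"
      using i1 k(4,5) by simp
    also have "ennreal \<dots> \<le> (\<integral>\<^sup>+z. ennreal (norm (w (z + x) * k z - w x * k z)) \<partial>lborel)"
      using integral_norm_bound_ennreal[of lborel "\<lambda>z. w (z + x) * k z - w x * k z"] i1 k(4) by simp
    also have "\<dots> = (\<integral>\<^sup>+z. ennreal (\<bar>w (x + z) - w x\<bar> * k z) \<partial>lborel)"
      using k(2) by (intro nn_integral_cong) (simp add: abs_mult add.commute flip: left_diff_distrib)
    finally show ?thesis .
  qed
  have "(\<integral>\<^sup>+x. indicator V x * ennreal \<bar>w x - (LBINT y. w y * k (y - x))\<bar> \<partial>lborel)
      \<le> (\<integral>\<^sup>+x. indicator V x * (\<integral>\<^sup>+z. ennreal (\<bar>w (x + z) - w x\<bar> * k z) \<partial>lborel) \<partial>lborel)"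
    using pw by (intro nn_integral_mono mult_left_mono) auto
  also have "\<dots> = (\<integral>\<^sup>+x. (\<integral>\<^sup>+z. indicator V x * ennreal (\<bar>w (x + z) - w x\<bar> * k z) \<partial>lborel) \<partial>lborel)"
    by (simp add: nn_integral_cmult)
  also have "\<dots> = (\<integral>\<^sup>+z. (\<integral>\<^sup>+x. indicator V x * ennreal (\<bar>w (x + z) - w x\<bar> * k z) \<partial>lborel) \<partial>lborel)"
    by (rule lborel_pair.Fubini'[symmetric]) measurable
  also have "\<dots> \<le> (\<integral>\<^sup>+z. ennreal (2 * C * \<epsilon>) * ennreal (k z) \<partial>lborel)"
  proof (rule nn_integral_mono)
    fix z :: "real^2"
    show "(\<integral>\<^sup>+x. indicator V x * ennreal (\<bar>w (x + z) - w x\<bar> * k z) \<partial>lborel) \<le> ennreal (2 * C * \<epsilon>) * ennreal (k z)"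
    proof (cases "norm z < \<epsilon>")
      case True
      have wz: "integrable lborel (\<lambda>x. w (x + z))" using wi by (simp add: integrable_lborel_translate)
      have i: "integrable lborel (\<lambda>x. indicator V x * \<bar>w (x + z) - w x\<bar>)"
        using integrable_real_mult_indicator[of V lborel "\<lambda>x. \<bar>w (x + z) - w x\<bar>"] wz wi by (simp add: mult.commute)
      have "(\<integral>\<^sup>+x. indicator V x * ennreal (\<bar>w (x + z) - w x\<bar> * k z) \<partial>lborel)
          = (\<integral>\<^sup>+x. ennreal (indicator V x * \<bar>w (x + z) - w x\<bar>) * ennreal (k z) \<partial>lborel)"
        using k(2) by (intro nn_integral_cong) (auto simp: indicator_def ennreal_mult)
      also have "\<dots> = (\<integral>\<^sup>+x. ennreal (indicator V x * \<bar>w (x + z) - w x\<bar>) \<partial>lborel) * ennreal (k z)"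
        by (rule nn_integral_multc) measurable
      also have "(\<integral>\<^sup>+x. ennreal (indicator V x * \<bar>w (x + z) - w x\<bar>) \<partial>lborel)
          = ennreal (LBINT x. indicator V x * \<bar>w (x + z) - w x\<bar>)"
        using i by (intro nn_integral_eq_integral) auto
      also have "\<dots> \<le> ennreal (2 * C * \<epsilon>)"
      proof (rule ennreal_leI)
        have "(LBINT x. indicator V x * \<bar>w (x + z) - w x\<bar>) \<le> 2 * C * norm z"
        proof (rule translation_estimate[OF w V(1,2)])
          fix x and s :: real assume "x \<in> V" "0 \<le> s" "s \<le> 1"
          moreover have "norm (s *\<^sub>R z) \<le> norm z"
            using \<open>0 \<le> s\<close> \<open>s \<le> 1\<close> by (simp add: mult_left_le_one_le)
          ultimately have "x + s *\<^sub>R z \<in> ball x \<epsilon>" using True by (simp add: dist_norm)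
          then show "x + s *\<^sub>R z \<in> \<Omega>" using V(3) \<open>x \<in> V\<close> by blast
        qed
        also have "\<dots> \<le> 2 * C * \<epsilon>" using True C by (intro mult_left_mono) auto
        finally show "(LBINT x. indicator V x * \<bar>w (x + z) - w x\<bar>) \<le> 2 * C * \<epsilon>" .
      qed
      finally show ?thesis by (simp add: mult_right_mono)
    next
      case False
      then show ?thesis using k(6)[of z] by simp
    qed
  qed
  also have "\<dots> = ennreal (2 * C * \<epsilon>) * (\<integral>\<^sup>+z. ennreal (k z) \<partial>lborel)"
    by (rule nn_integral_cmult) measurable
  also have "(\<integral>\<^sup>+z. ennreal (k z) \<partial>lborel) = 1"
    using nn_integral_eq_integral[OF k(4)] k(2,5) by simp
  finally show ?thesis by simp
qed

section \<open>Integral bounds up to a Lipschitz boundary\<close>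

lemma test_fun_translate:
  fixes p :: "real^'n \<Rightarrow> 'b::real_normed_vector"
  assumes p: "smooth p" and z: "\<And>z. norm z \<ge> \<epsilon> \<Longrightarrow> p z = 0" and U: "cball x \<epsilon> \<subseteq> U"
  shows "test_fun U (\<lambda>y. p (y - x))" "partial k (\<lambda>y. p (y - x)) = (\<lambda>y. partial k p (y - x))"
proof -
  have d: "((\<lambda>y. q (y - x)) has_derivative (\<lambda>h. \<Sum>k\<in>UNIV. h $ k *\<^sub>R partial k q (y - x))) (at y)"
    if "smooth q" for y and q :: "real^'n \<Rightarrow> 'b"
  proof -
    have "((\<lambda>y. y - x) has_derivative (\<lambda>h. h)) (at y)" by (auto intro!: derivative_eq_intros)
    from has_derivative_compose[OF this smooth_has_derivative[OF that]] show ?thesis .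
  qed
  have P: "partial k (\<lambda>y. q (y - x)) = (\<lambda>y. partial k q (y - x))" if "smooth q" for k and q :: "real^'n \<Rightarrow> 'b"
    using partial_eqI[OF d[OF that]]
    by (auto simp: fun_eq_iff axis_def if_distrib[of "\<lambda>x. x *\<^sub>R _"] cong: if_cong)
  show "partial k (\<lambda>y. p (y - x)) = (\<lambda>y. partial k p (y - x))" by (rule P[OF p])
  have "smooth (\<lambda>y. p (y - x))"
  proof (rule smooth_coinduct[where P = "\<lambda>f. \<exists>q. smooth q \<and> f = (\<lambda>y. q (y - x))"], goal_cases)
    case 1 show ?case using p by blast
  next
    case (2 f)
    then obtain q where q: "smooth q" and f: "f = (\<lambda>y. q (y - x))" by blast
    show ?case unfolding f P[OF q] using d[OF q] smooth_partial[OF q] differentiable_def by blast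
  qed
  then show "test_fun U (\<lambda>y. p (y - x))"
  proof (rule test_funI[OF _ compact_cball U])
    fix y assume "y \<notin> cball x \<epsilon>"
    then show "p (y - x) = 0" by (intro z) (simp add: dist_norm norm_minus_commute)
  qed
qed

text \<open>The last condition holds if \<open>w\<close> is the weak partial derivative of a function bounded by \<open>M\<close>, but is
  stated for \<open>w\<close> alone.\<close>

definition gradient_component :: "(real^2) set \<Rightarrow> real \<Rightarrow> real \<Rightarrow> (real^2 \<Rightarrow> real) \<Rightarrow> bool" where
  "gradient_component \<Omega> C M w \<longleftrightarrow> tv_bounded \<Omega> C w \<and>
     (\<exists>j. \<forall>\<psi>. test_fun \<Omega> \<psi> \<longrightarrow> \<bar>LBINT x. w x * \<psi> x\<bar> \<le> M * (LBINT x. \<bar>partial j \<psi> x\<bar>))"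

text \<open>Near \<open>x0\<close>, \<open>w\<close> is close in the mean to its average against a bump \<open>k\<close>, and this average is the
  pairing of \<open>w\<close> with a test function, hence bounded by \<open>M\<close> times the norm of a derivative of \<open>k\<close>.\<close>

lemma interior_L1_bound:
  assumes \<Omega>: "open \<Omega>" "x0 \<in> \<Omega>" and M: "M \<ge> 0"
  shows "\<exists>\<rho>>0. \<exists>B. \<forall>w. gradient_component \<Omega> C M w \<longrightarrow>
    (LBINT x. indicator (ball x0 \<rho>) x * \<bar>w x\<bar>) \<le> B"
proof -
  obtain r where r: "r > 0" "ball x0 r \<subseteq> \<Omega>" using \<Omega> open_contains_ball by blast
  \<comment> \<open>With radius \<open>r / 3\<close>, the closed \<open>\<epsilon>\<close>-ball around a point of \<open>ball x0 \<epsilon>\<close> stays inside \<open>ball x0 r\<close>.\<close>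
  define \<epsilon> where "\<epsilon> = r / 3"
  have \<epsilon>: "\<epsilon> > 0" using r by (simp add: \<epsilon>_def)
  obtain k :: "real^2 \<Rightarrow> real" where k: "smooth k" "\<And>x. 0 \<le> k x" "\<And>x. norm x \<ge> \<epsilon> \<Longrightarrow> k x = 0"
    "integrable lborel k" "(LBINT x. k x) = 1"
    using bump_exists[OF \<epsilon>] by metis
  have tk: "test_fun UNIV k"
    using test_fun_translate(1)[OF k(1,3), where x = 0 and U = UNIV] by simp
  have km: "k \<in> borel_measurable borel" by (rule test_fun_borel[OF tk])
  obtain K where K: "\<And>x. k x \<le> K" using test_fun_bounded[OF tk] by (metis abs_le_D1 real_norm_def)
  define D where "D = (\<Sum>j\<in>UNIV. LBINT x. \<bar>partial j k x\<bar>)"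
  let ?V = "ball x0 \<epsilon>"
  have sub: "cball x \<epsilon> \<subseteq> \<Omega>" if "x \<in> ?V" for x
  proof
    fix y assume "y \<in> cball x \<epsilon>"
    then have "dist x0 y < 3 * \<epsilon>" using that \<epsilon> dist_triangle[of x0 y x] by auto
    then show "y \<in> \<Omega>" using r by (auto simp: \<epsilon>_def)
  qed
  show ?thesis
  proof (rule exI[of _ \<epsilon>], intro conjI \<epsilon>,
      rule exI[of _ "2 * C * \<epsilon> + M * D * measure lborel ?V"], intro allI impI)
    fix w assume "gradient_component \<Omega> C M w"
    then obtain j where w: "tv_bounded \<Omega> C w"
      and j: "\<And>\<psi>. test_fun \<Omega> \<psi> \<Longrightarrow> \<bar>LBINT x. w x * \<psi> x\<bar> \<le> M * (LBINT x. \<bar>partial j \<psi> x\<bar>)"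
      by (auto simp: gradient_component_def)
    have C: "0 \<le> C" by (rule tv_bounded_nonneg[OF w])
    have wi: "integrable lborel w" using w by (simp add: tv_bounded_def)
    then have [measurable]: "w \<in> borel_measurable borel" by auto
    note km[measurable]
    have D: "0 \<le> D" "(LBINT y. \<bar>partial j k y\<bar>) \<le> D" unfolding D_def
      by (auto intro!: sum_nonneg member_le_sum)
    let ?m = "\<lambda>x. LBINT y. w y * k (y - x)"
    have m: "\<bar>?m x\<bar> \<le> M * D" if "x \<in> ?V" for x
    proof -
      note t = test_fun_translate[OF k(1,3) sub[OF that]]
      have [measurable]: "partial j k \<in> borel_measurable borel"
        by (rule test_fun_borel[OF test_fun_partial[OF tk]])
      have "\<bar>?m x\<bar> \<le> M * (LBINT y. \<bar>partial j k (y - x)\<bar>)"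
        using j[OF t(1)] by (simp add: t(2))
      also have "(LBINT y. \<bar>partial j k (y - x)\<bar>) = (LBINT y. \<bar>partial j k y\<bar>)"
        using integral_lborel_translate[of "\<lambda>y. \<bar>partial j k y\<bar>" "- x"] by simp
      also have "M * \<dots> \<le> M * D" using M D by (intro mult_left_mono)
      finally show ?thesis .
    qed
    have [measurable]: "?V \<in> sets borel" by simp
    have fin: "emeasure lborel ?V < \<infinity>" by (rule emeasure_bounded_finite) simp
    have i: "integrable lborel (\<lambda>x. indicator ?V x * \<bar>w x\<bar>)"
      using integrable_real_mult_indicator[of ?V lborel "\<lambda>x. \<bar>w x\<bar>"] wi by (simp add: mult.commute)
    have "ennreal (LBINT x. indicator ?V x * \<bar>w x\<bar>) = (\<integral>\<^sup>+x. ennreal (indicator ?V x * \<bar>w x\<bar>) \<partial>lborel)"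
      using i by (intro nn_integral_eq_integral[symmetric]) auto
    also have "\<dots> \<le> (\<integral>\<^sup>+x. indicator ?V x * ennreal \<bar>w x - ?m x\<bar> + ennreal (M * D) * indicator ?V x \<partial>lborel)"
    proof (rule nn_integral_mono)
      fix x
      show "ennreal (indicator ?V x * \<bar>w x\<bar>) \<le> indicator ?V x * ennreal \<bar>w x - ?m x\<bar> + ennreal (M * D) * indicator ?V x"
      proof (cases "x \<in> ?V")
        case True
        have "\<bar>w x\<bar> \<le> \<bar>w x - ?m x\<bar> + M * D" using m[OF True] by linarith
        then show ?thesis using True M D(1) by (simp flip: ennreal_plus)
      qed simp
    qed
    also have "\<dots> = (\<integral>\<^sup>+x. indicator ?V x * ennreal \<bar>w x - ?m x\<bar> \<partial>lborel) + (\<integral>\<^sup>+x. ennreal (M * D) * indicator ?V x \<partial>lborel)"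
      by (rule nn_integral_add) measurable
    also have "(\<integral>\<^sup>+x. ennreal (M * D) * indicator ?V x \<partial>lborel) = ennreal (M * D * measure lborel ?V)"
      using fin M D(1) by (simp add: nn_integral_cmult_indicator emeasure_eq_ennreal_measure ennreal_mult)
    also have "(\<integral>\<^sup>+x. indicator ?V x * ennreal \<bar>w x - ?m x\<bar> \<partial>lborel) \<le> ennreal (2 * C * \<epsilon>)"
    proof (rule kernel_approximation[OF w km k(2) K k(4,5,3)])
      show "ball x \<epsilon> \<subseteq> \<Omega>" if "x \<in> ?V" for x using sub[OF that] ball_subset_cball by blast
    qed auto
    finally have "ennreal (LBINT x. indicator ?V x * \<bar>w x\<bar>) \<le> ennreal (2 * C * \<epsilon> + M * D * measure lborel ?V)"
      using C \<epsilon> M D(1) by (simp add: add_right_mono)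
    moreover have "0 \<le> 2 * C * \<epsilon> + M * D * measure lborel ?V"
      using C \<epsilon> M D(1) by (intro add_nonneg_nonneg mult_nonneg_nonneg) auto
    ultimately show "(LBINT x. indicator ?V x * \<bar>w x\<bar>) \<le> 2 * C * \<epsilon> + M * D * measure lborel ?V"
      using ennreal_le_iff by blast
  qed
qed

text \<open>This is where the regularity of the boundary enters. In the chart, \<open>\<Omega>\<close> lies above a graph, and the
  vertical translation by \<open>t *\<^sub>R v\<close> moves the part of \<open>\<Omega>\<close> near \<open>x0\<close>, along segments inside \<open>\<Omega>\<close>, into a ball
  where the interior bound holds. The translation estimate controls the difference.\<close>

lemma boundary_L1_bound:
  assumes \<Omega>: "bounded_lipschitz_domain \<Omega>" "x0 \<in> frontier \<Omega>" and M: "M \<ge> 0"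
  shows "\<exists>\<rho>>0. \<exists>B. \<forall>w. gradient_component \<Omega> C M w \<longrightarrow>
    (LBINT x. indicator (ball x0 \<rho> \<inter> \<Omega>) x * \<bar>w x\<bar>) \<le> B"
proof -
  have op: "open \<Omega>" and bd: "bounded \<Omega>" using \<Omega> by (auto simp: bounded_lipschitz_domain_def)
  obtain r Q \<gamma> L where r: "r > 0" and Q: "orthogonal_matrix (Q::real^2^2)" and lip: "L-lipschitz_on UNIV (\<gamma>::real \<Rightarrow> real)"
    and chart: "\<And>y. y \<in> ball x0 r \<Longrightarrow> y \<in> \<Omega> \<longleftrightarrow> \<gamma> ((Q *v y) $ 1) < (Q *v y) $ 2"
    using \<Omega> unfolding bounded_lipschitz_domain_def by metis
  \<comment> \<open>The vertical direction of the chart in the original coordinates.\<close>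
  define v where "v = transpose Q *v axis 2 1"
  have Qv: "Q *v v = axis 2 1"
    using Q unfolding v_def matrix_vector_mul_assoc orthogonal_matrix_def
    by (simp only: matrix_vector_mul_lid)
  have Qs: "(Q *v (y + s *\<^sub>R v)) $ 1 = (Q *v y) $ 1" "(Q *v (y + s *\<^sub>R v)) $ 2 = (Q *v y) $ 2 + s" for y s
    by (simp_all add: matrix_vector_right_distrib matrix_vector_mult_scaleR Qv axis_def)
  define t where "t = r / (2 * (norm v + 1))"
  have t: "t > 0" "norm (t *\<^sub>R v) < r / 2"
    using r by (auto simp: t_def field_simps add_nonneg_pos add_pos_nonneg)
  have \<gamma>c: "continuous_on UNIV \<gamma>" using lip by (rule lipschitz_on_continuous_on)
  \<comment> \<open>The boundary point is not below the graph, since it is a limit of points above it.\<close>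
  have x0: "\<gamma> ((Q *v x0) $ 1) \<le> (Q *v x0) $ 2"
  proof (rule ccontr)
    assume "\<not> ?thesis"
    then have neg: "(Q *v x0) $ 2 < \<gamma> ((Q *v x0) $ 1)" by simp
    have cQ: "continuous_on UNIV (\<lambda>y. (Q *v y) $ i)" for i
      by (intro continuous_intros linear_continuous_on matrix_vector_mul_bounded_linear)
    have "open {y. (Q *v y) $ 2 < \<gamma> ((Q *v y) $ 1)}"
      by (intro open_Collect_less cQ continuous_on_compose2[OF \<gamma>c cQ]) auto
    then have "open ({y. (Q *v y) $ 2 < \<gamma> ((Q *v y) $ 1)} \<inter> ball x0 r)" by blast
    moreover have "x0 \<in> {y. (Q *v y) $ 2 < \<gamma> ((Q *v y) $ 1)} \<inter> ball x0 r" using neg r by simp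
    moreover have "x0 \<in> closure \<Omega>" using \<Omega>(2) by (simp add: frontier_def)
    ultimately obtain y where "y \<in> \<Omega>" "y \<in> ball x0 r" "(Q *v y) $ 2 < \<gamma> ((Q *v y) $ 1)"
      unfolding closure_iff_nhds_not_empty by blast
    then show False using chart[of y] by simp
  qed
  have "x0 + t *\<^sub>R v \<in> ball x0 r" using t r by (simp add: dist_norm)
  then have y0: "x0 + t *\<^sub>R v \<in> \<Omega>" using chart x0 t by (simp add: Qs)
  obtain \<rho>0 B where \<rho>0: "\<rho>0 > 0" and B: "\<And>w. gradient_component \<Omega> C M w \<Longrightarrow>
    (LBINT x. indicator (ball (x0 + t *\<^sub>R v) \<rho>0) x * \<bar>w x\<bar>) \<le> B"
    using interior_L1_bound[OF op y0 M, of C] by metis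
  define \<rho> where "\<rho> = min \<rho>0 (r / 2)"
  have \<rho>: "\<rho> > 0" "\<rho> \<le> \<rho>0" "\<rho> \<le> r / 2" using \<rho>0 r by (auto simp: \<rho>_def)
  let ?V = "ball x0 \<rho> \<inter> \<Omega>" and ?h = "t *\<^sub>R v"
  show ?thesis
  proof (rule exI[of _ \<rho>], intro conjI \<rho>,
      rule exI[of _ "B + 2 * C * norm ?h"], intro allI impI)
    fix w assume gw: "gradient_component \<Omega> C M w"
    then have w: "tv_bounded \<Omega> C w" by (simp add: gradient_component_def)
    have wi: "integrable lborel w" using w by (simp add: tv_bounded_def)
    then have [measurable]: "w \<in> borel_measurable borel" by auto
    have [measurable]: "\<Omega> \<in> sets borel" using op by simp
    have [measurable]: "ball (x0 + ?h) \<rho>0 \<in> sets borel" by simp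
    have ind: "integrable lborel (\<lambda>x. indicator A x * \<bar>u x\<bar>)" if "integrable lborel u" "A \<in> sets borel" for u :: "real^2 \<Rightarrow> real" and A
      using integrable_real_mult_indicator[of A lborel "\<lambda>x. \<bar>u x\<bar>"] that by (simp add: mult.commute)
    have wh: "integrable lborel (\<lambda>x. w (x + ?h))" using wi by (simp add: integrable_lborel_translate)
    have i1: "integrable lborel (\<lambda>x. indicator (ball (x0 + ?h) \<rho>0) (x + ?h) * \<bar>w (x + ?h)\<bar>)"
      using ind[OF wi, of "ball (x0 + ?h) \<rho>0"]
        integrable_lborel_translate[of "\<lambda>x. indicator (ball (x0 + ?h) \<rho>0) x * \<bar>w x\<bar>" ?h] by simp
    have i2: "integrable lborel (\<lambda>x. indicator ?V x * \<bar>w (x + ?h) - w x\<bar>)"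
      using wh wi by (intro ind) auto
    have "(LBINT x. indicator ?V x * \<bar>w x\<bar>) \<le>
      (LBINT x. indicator (ball (x0 + ?h) \<rho>0) (x + ?h) * \<bar>w (x + ?h)\<bar> + indicator ?V x * \<bar>w (x + ?h) - w x\<bar>)"
    proof (rule integral_mono)
      fix x
      show "indicator ?V x * \<bar>w x\<bar> \<le> indicator (ball (x0 + ?h) \<rho>0) (x + ?h) * \<bar>w (x + ?h)\<bar> + indicator ?V x * \<bar>w (x + ?h) - w x\<bar>"
      proof (cases "x \<in> ?V")
        case True
        then have "x + ?h \<in> ball (x0 + ?h) \<rho>0" using \<rho> by (auto simp: dist_norm)
        then show ?thesis using True by simp
      qed simp
    qed (use ind[OF wi] i1 i2 in auto)
    also have "\<dots> = (LBINT x. indicator (ball (x0 + ?h) \<rho>0) (x + ?h) * \<bar>w (x + ?h)\<bar>)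
        + (LBINT x. indicator ?V x * \<bar>w (x + ?h) - w x\<bar>)"
      by (rule Bochner_Integration.integral_add[OF i1 i2])
    also have "(LBINT x. indicator (ball (x0 + ?h) \<rho>0) (x + ?h) * \<bar>w (x + ?h)\<bar>)
        = (LBINT x. indicator (ball (x0 + ?h) \<rho>0) x * \<bar>w x\<bar>)"
      by (rule integral_lborel_translate) measurable
    also have "\<dots> \<le> B" by (rule B[OF gw])
    also have "(LBINT x. indicator ?V x * \<bar>w (x + ?h) - w x\<bar>) \<le> 2 * C * norm ?h"
    proof (rule translation_estimate[OF w])
      show "open ?V" "bounded ?V" using op bd by auto
      fix x and s :: real assume x: "x \<in> ?V" and s: "0 \<le> s" "s \<le> 1"
      have "norm (s *\<^sub>R ?h) \<le> norm ?h"
        unfolding norm_scaleR[of s] using s by (simp add: mult_left_le_one_le del: scaleR_scaleR norm_scaleR)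
      then have "x + s *\<^sub>R ?h \<in> ball x0 r"
        using x t \<rho> norm_triangle_ineq4[of "x0 - x" "s *\<^sub>R ?h"] by (simp add: dist_norm algebra_simps)
      moreover have "x \<in> ball x0 r" using x \<rho> r by auto
      moreover have "s * t \<ge> 0" using s t by simp
      ultimately show "x + s *\<^sub>R ?h \<in> \<Omega>"
        using x chart[of x] chart[of "x + s *\<^sub>R ?h"] Qs[of x "s * t"] by auto
    qed
    finally show "(LBINT x. indicator ?V x * \<bar>w x\<bar>) \<le> B + 2 * C * norm ?h" by simp
  qed
qed

lemma lipschitz_domain_L1_bound:
  assumes \<Omega>: "bounded_lipschitz_domain \<Omega>" and M: "M \<ge> 0"
  shows "\<exists>B. \<forall>w. gradient_component \<Omega> C M w \<longrightarrow> (LBINT x. \<bar>w x\<bar>) \<le> B"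
proof -
  have op: "open \<Omega>" and bd: "bounded \<Omega>" using \<Omega> by (auto simp: bounded_lipschitz_domain_def)
  have [measurable]: "\<Omega> \<in> sets borel" using op by simp
  have ind: "integrable lborel (\<lambda>x. indicator A x * \<bar>w x\<bar>)" if "gradient_component \<Omega> C M w" "A \<in> sets borel" for w A
    using that integrable_real_mult_indicator[of A lborel "\<lambda>x. \<bar>w x\<bar>"]
    by (simp add: mult.commute gradient_component_def tv_bounded_def)
  have "\<exists>\<rho>>0. \<exists>B. \<forall>w. gradient_component \<Omega> C M w \<longrightarrow> (LBINT x. indicator (ball x0 \<rho> \<inter> \<Omega>) x * \<bar>w x\<bar>) \<le> B"
    if "x0 \<in> closure \<Omega>" for x0
  proof (cases "x0 \<in> \<Omega>")
    case True
    obtain \<rho> B where \<rho>: "\<rho> > 0" and B: "\<And>w. gradient_component \<Omega> C M w \<Longrightarrow>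
        (LBINT x. indicator (ball x0 \<rho>) x * \<bar>w x\<bar>) \<le> B"
      using interior_L1_bound[OF op True M, of C] by metis
    have "(LBINT x. indicator (ball x0 \<rho> \<inter> \<Omega>) x * \<bar>w x\<bar>) \<le> B" if w: "gradient_component \<Omega> C M w" for w
    proof -
      have "(LBINT x. indicator (ball x0 \<rho> \<inter> \<Omega>) x * \<bar>w x\<bar>) \<le> (LBINT x. indicator (ball x0 \<rho>) x * \<bar>w x\<bar>)"
        by (intro integral_mono ind[OF w]) (auto simp: indicator_def)
      then show ?thesis using B[OF w] by linarith
    qed
    then show ?thesis using \<rho> by blast
  next
    case False
    then have "x0 \<in> frontier \<Omega>" using that op by (simp add: frontier_def interior_open)
    then show ?thesis using boundary_L1_bound[OF \<Omega> _ M] by blast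
  qed
  then obtain \<rho> B where \<rho>: "\<And>x. x \<in> closure \<Omega> \<Longrightarrow> \<rho> x > 0"
    and B: "\<And>x0 w. x0 \<in> closure \<Omega> \<Longrightarrow> gradient_component \<Omega> C M w \<Longrightarrow>
       (LBINT x. indicator (ball x0 (\<rho> x0) \<inter> \<Omega>) x * \<bar>w x\<bar>) \<le> B x0"
    by metis
  have "compact (closure \<Omega>)" using bd by simp
  then obtain T where T: "T \<subseteq> closure \<Omega>" "finite T" "closure \<Omega> \<subseteq> (\<Union>x\<in>T. ball x (\<rho> x))"
    by (rule compactE_image[of "closure \<Omega>" "closure \<Omega>" "\<lambda>x. ball x (\<rho> x)"]) (use \<rho> in force)+
  show ?thesis
  proof (intro exI[of _ "sum B T"] allI impI)
    fix w assume gw: "gradient_component \<Omega> C M w"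
    then have w: "integrable lborel w" "\<And>x. x \<notin> \<Omega> \<Longrightarrow> w x = 0"
      by (auto simp: gradient_component_def tv_bounded_def)
    let ?i = "\<lambda>x0. indicator (ball x0 (\<rho> x0) \<inter> \<Omega>) :: real^2 \<Rightarrow> real"
    have "(LBINT x. \<bar>w x\<bar>) \<le> (LBINT x. (\<Sum>x0\<in>T. ?i x0 x * \<bar>w x\<bar>))"
    proof (rule integral_mono)
      fix x
      show "\<bar>w x\<bar> \<le> (\<Sum>x0\<in>T. ?i x0 x * \<bar>w x\<bar>)"
      proof (cases "x \<in> \<Omega>")
        case True
        then obtain x0 where x0: "x0 \<in> T" "x \<in> ball x0 (\<rho> x0)" using T(3) closure_subset by blast
        then have "\<bar>w x\<bar> = ?i x0 x * \<bar>w x\<bar>" using True by simp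
        also have "\<dots> \<le> (\<Sum>x0\<in>T. ?i x0 x * \<bar>w x\<bar>)"
          using x0(1) T(2) by (intro member_le_sum) auto
        finally show ?thesis .
      qed (simp add: w(2))
    qed (use w ind[OF gw] in auto)
    also have "\<dots> = (\<Sum>x0\<in>T. LBINT x. ?i x0 x * \<bar>w x\<bar>)"
      using ind[OF gw] by (intro Bochner_Integration.integral_sum) auto
    also have "\<dots> \<le> sum B T" using B[OF _ gw] T(1) by (intro sum_mono) auto
    finally show "(LBINT x. \<bar>w x\<bar>) \<le> sum B T" .
  qed
qed

section \<open>Compactness of bounded sequences in BV\<close>

lemma Fatou_L1:
  fixes f :: "nat \<Rightarrow> 'a \<Rightarrow> real"
  assumes f: "\<And>n. integrable M (f n)" "\<And>n. (\<integral>x. \<bar>f n x\<bar> \<partial>M) \<le> B"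
    and g: "g \<in> borel_measurable M" and lim: "AE x in M. (\<lambda>n. f n x) \<longlonglongrightarrow> g x"
  shows "integrable M g" "(\<integral>x. \<bar>g x\<bar> \<partial>M) \<le> B"
proof -
  have [measurable]: "f n \<in> borel_measurable M" for n using f(1) by auto
  note g[measurable]
  have B: "0 \<le> B" by (rule order_trans[OF Bochner_Integration.integral_nonneg f(2)[of 0]]) simp
  have "(\<integral>\<^sup>+x. ennreal \<bar>g x\<bar> \<partial>M) = (\<integral>\<^sup>+x. liminf (\<lambda>n. ennreal \<bar>f n x\<bar>) \<partial>M)"
  proof (rule nn_integral_cong_AE, use lim in eventually_elim)
    fix x assume "(\<lambda>n. f n x) \<longlonglongrightarrow> g x"
    then have "(\<lambda>n. ennreal \<bar>f n x\<bar>) \<longlonglongrightarrow> ennreal \<bar>g x\<bar>"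
      by (intro tendsto_ennrealI tendsto_rabs)
    then show "ennreal \<bar>g x\<bar> = liminf (\<lambda>n. ennreal \<bar>f n x\<bar>)"
      by (metis lim_imp_Liminf trivial_limit_sequentially)
  qed
  also have "\<dots> \<le> liminf (\<lambda>n. \<integral>\<^sup>+x. ennreal \<bar>f n x\<bar> \<partial>M)"
    by (rule nn_integral_liminf) simp
  also have "\<dots> \<le> liminf (\<lambda>n. ennreal B)"
  proof (rule Liminf_mono, rule always_eventually, rule allI)
    fix n
    have "(\<integral>\<^sup>+x. ennreal \<bar>f n x\<bar> \<partial>M) = ennreal (\<integral>x. \<bar>f n x\<bar> \<partial>M)"
      using f(1) by (intro nn_integral_eq_integral) auto
    then show "(\<integral>\<^sup>+x. ennreal \<bar>f n x\<bar> \<partial>M) \<le> ennreal B" using f(2) by (simp add: ennreal_leI)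
  qed
  finally have *: "(\<integral>\<^sup>+x. ennreal \<bar>g x\<bar> \<partial>M) \<le> ennreal B" by (simp add: Liminf_const)
  then show i: "integrable M g"
    by (intro integrableI_bounded) (auto simp: le_less_trans[OF _ ennreal_less_top])
  have "ennreal (\<integral>x. \<bar>g x\<bar> \<partial>M) = (\<integral>\<^sup>+x. ennreal \<bar>g x\<bar> \<partial>M)"
    using i by (intro nn_integral_eq_integral[symmetric]) auto
  also note *
  finally show "(\<integral>x. \<bar>g x\<bar> \<partial>M) \<le> B" using ennreal_le_iff[OF B] by blast
qed

text \<open>Fatou's lemma in the index \<open>j\<close> turns the bounds for \<open>s i - s j\<close> into bounds for \<open>s i - v\<close>.\<close>

lemma L1_Cauchy_AE_limit:
  fixes s :: "nat \<Rightarrow> 'a \<Rightarrow> real"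
  assumes s: "\<And>n. integrable M (s n)" and v: "v \<in> borel_measurable M"
    and lim: "AE x in M. (\<lambda>n. s n x) \<longlonglongrightarrow> v x"
    and cauchy: "\<And>e. e > 0 \<Longrightarrow> \<exists>N. \<forall>i\<ge>N. \<forall>j\<ge>N. (\<integral>x. \<bar>s i x - s j x\<bar> \<partial>M) < e"
  shows "integrable M v" "(\<lambda>n. \<integral>x. \<bar>s n x - v x\<bar> \<partial>M) \<longlonglongrightarrow> 0"
proof -
  have *: "integrable M (\<lambda>x. s i x - v x)" "(\<integral>x. \<bar>s i x - v x\<bar> \<partial>M) \<le> e"
    if "e > 0" and N: "\<forall>i\<ge>N. \<forall>j\<ge>N. (\<integral>x. \<bar>s i x - s j x\<bar> \<partial>M) < e" and "i \<ge> N" for e N i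
  proof -
    have "AE x in M. (\<lambda>j. s i x - s (j + N) x) \<longlonglongrightarrow> s i x - v x"
      using lim
    proof eventually_elim
      case (elim x)
      from LIMSEQ_ignore_initial_segment[OF elim, of N] show ?case by (intro tendsto_intros)
    qed
    moreover have "(\<integral>x. \<bar>s i x - s (j + N) x\<bar> \<partial>M) \<le> e" for j
      using N \<open>i \<ge> N\<close> by (intro less_imp_le) auto
    moreover have "(\<lambda>x. s i x - v x) \<in> borel_measurable M" using s v by (intro borel_measurable_diff) auto
    moreover have "integrable M (\<lambda>x. s i x - s (j + N) x)" for j using s by simp
    ultimately show "integrable M (\<lambda>x. s i x - v x)" "(\<integral>x. \<bar>s i x - v x\<bar> \<partial>M) \<le> e"
      using Fatou_L1[of M "\<lambda>j x. s i x - s (j + N) x" e "\<lambda>x. s i x - v x"] by blast+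
  qed
  obtain N where N: "\<forall>i\<ge>N. \<forall>j\<ge>N. (\<integral>x. \<bar>s i x - s j x\<bar> \<partial>M) < 1" using cauchy[of 1] by auto
  from Bochner_Integration.integrable_diff[OF s[of N] *(1)[OF _ N, of N]] show "integrable M v" by simp
  show "(\<lambda>n. \<integral>x. \<bar>s n x - v x\<bar> \<partial>M) \<longlonglongrightarrow> 0"
  proof (rule LIMSEQ_I)
    fix e :: real assume e: "e > 0"
    then obtain N where N: "\<forall>i\<ge>N. \<forall>j\<ge>N. (\<integral>x. \<bar>s i x - s j x\<bar> \<partial>M) < e / 2"
      using cauchy[of "e / 2"] by auto
    then have "norm ((\<integral>x. \<bar>s n x - v x\<bar> \<partial>M) - 0) < e" if "n \<ge> N" for n
      using *(2)[OF _ N that] e by simp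
    then show "\<exists>N. \<forall>n\<ge>N. norm ((\<integral>x. \<bar>s n x - v x\<bar> \<partial>M) - 0) < e" by blast
  qed
qed

lemma abs_integral_mult_le:
  fixes w g :: "'a::euclidean_space \<Rightarrow> real"
  assumes w: "integrable lborel w" and g: "g \<in> borel_measurable borel" "\<And>x. \<bar>g x\<bar> \<le> c"
  shows "\<bar>LBINT x. w x * g x\<bar> \<le> c * (LBINT x. \<bar>w x\<bar>)"
proof -
  have "\<bar>LBINT x. w x * g x\<bar> \<le> (LBINT x. \<bar>w x * g x\<bar>)" by (rule integral_abs_bound)
  also have "\<dots> \<le> (LBINT x. c * \<bar>w x\<bar>)"
  proof (rule integral_mono)
    show "integrable lborel (\<lambda>x. \<bar>w x * g x\<bar>)"
      by (rule integrable_abs[OF integrable_bounded_mult[OF w g]])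
    show "integrable lborel (\<lambda>x. c * \<bar>w x\<bar>)" using w by simp
    show "\<bar>w x * g x\<bar> \<le> c * \<bar>w x\<bar>" for x
      unfolding abs_mult mult.commute[of c] by (rule mult_left_mono[OF g(2)]) simp
  qed
  also have "\<dots> = c * (LBINT x. \<bar>w x\<bar>)" by simp
  finally show ?thesis .
qed

text \<open>For a fixed kernel the averages are bounded and equicontinuous in \<open>x\<close>, uniformly in \<open>n\<close>. A diagonal
  sequence converges for all kernels at the points of a countable dense set, hence everywhere.\<close>

lemma bump_averages_convergent_subsequence:
  fixes w :: "nat \<Rightarrow> real^2 \<Rightarrow> real" and k :: "nat \<Rightarrow> real^2 \<Rightarrow> real"
  assumes w: "\<And>n. integrable lborel (w n)" "\<And>n. (LBINT x. \<bar>w n x\<bar>) \<le> B"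
    and k: "\<And>m. test_fun UNIV (k m)"
  obtains r where "strict_mono (r::nat\<Rightarrow>nat)" "\<And>m x. convergent (\<lambda>n. LBINT y. w (r n) y * k m (y - x))"
proof -
  have B: "0 \<le> B" by (rule order_trans[OF Bochner_Integration.integral_nonneg w(2)[of 0]]) simp
  have [measurable]: "k m \<in> borel_measurable borel" for m by (rule test_fun_borel[OF k])
  have "\<exists>K>0. \<forall>x. \<bar>k m x\<bar> \<le> K" for m using test_fun_bounded[OF k, of m] by simp
  then obtain K where K: "\<And>m. K m > 0" "\<And>m x. \<bar>k m x\<bar> \<le> K m" by metis
  let ?a = "\<lambda>n m x. LBINT y. w n y * k m (y - x)"
  have i: "integrable lborel (\<lambda>y. w n y * k m (y - x))" for n m x
    by (rule integrable_bounded_mult[OF w(1), where K = "K m"]) (use K in auto)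
  have bound: "\<bar>LBINT y. w n y * g y\<bar> \<le> c * B" if "c \<ge> 0" "\<And>y. \<bar>g y\<bar> \<le> c" "g \<in> borel_measurable borel" for n c g
  proof -
    have "\<bar>LBINT y. w n y * g y\<bar> \<le> c * (LBINT y. \<bar>w n y\<bar>)"
      by (rule abs_integral_mult_le[OF w(1) that(3,2)])
    also have "\<dots> \<le> c * B" using w(2) that(1) by (rule mult_left_mono)
    finally show ?thesis .
  qed
  obtain D :: "(real^2) set" where D: "countable D" "\<And>X. open X \<Longrightarrow> X \<noteq> {} \<Longrightarrow> \<exists>d\<in>D. d \<in> X"
    using countable_dense_setE by blast
  have bd: "norm (?a n (fst p) (snd p) / K (fst p)) \<le> B" for n p
  proof -
    have "\<bar>?a n (fst p) (snd p)\<bar> \<le> K (fst p) * B"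
      by (rule bound) (use K[of "fst p"] in auto)
    then show ?thesis using K(1)[of "fst p"] by (simp add: abs_divide pos_divide_le_eq mult.commute)
  qed
  obtain r where r: "strict_mono r" and
    conv: "\<And>p. p \<in> UNIV \<times> D \<Longrightarrow> \<exists>l. (\<lambda>n. ?a (r n) (fst p) (snd p) / K (fst p)) \<longlonglongrightarrow> l"
  proof (rule function_convergent_subsequence[of "UNIV \<times> D" "\<lambda>n p. ?a n (fst p) (snd p) / K (fst p)" B])
    show "countable (UNIV \<times> D :: (nat \<times> (real^2)) set)" using D(1) by (intro countable_SIGMA) auto
  qed (use bd in blast)+
  have convD: "Cauchy (\<lambda>n. ?a (r n) m q)" if q: "q \<in> D" for m q
  proof -
    obtain l where "(\<lambda>n. ?a (r n) m q / K m) \<longlonglongrightarrow> l" using conv[of "(m, q)"] q by auto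
    from tendsto_mult_right[OF this, of "K m"] have "(\<lambda>n. ?a (r n) m q) \<longlonglongrightarrow> l * K m"
      using K(1)[of m] by simp
    then show ?thesis by (rule LIMSEQ_imp_Cauchy)
  qed
  show ?thesis
  proof (rule that[OF r])
    fix m x
    have "Cauchy (\<lambda>n. ?a (r n) m x)"
    proof (rule CauchyI)
      fix e :: real assume e: "e > 0"
      define e' where "e' = e / (3 * (B + 1))"
      have e': "e' > 0" "e' * B < e / 3" using e B by (auto simp: e'_def field_simps)
      obtain Z where "compact Z" "\<And>x. x \<notin> Z \<Longrightarrow> k m x = 0" using test_fun_support[OF k] by blast
      then obtain d where d: "d > 0" "\<And>x y. norm (x - y) < d \<Longrightarrow> \<bar>k m y - k m x\<bar> \<le> e'"
        using compact_support_uniformly_continuous[OF test_fun_continuous[OF k] _ _ e'(1)] by metis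
      obtain q where q: "q \<in> D" "q \<in> ball x d" using D(2)[of "ball x d"] d(1) by auto
      have close: "\<bar>?a n m x - ?a n m q\<bar> < e / 3" for n
      proof -
        have "?a n m x - ?a n m q = (LBINT y. w n y * (k m (y - x) - k m (y - q)))"
          using i by (simp add: right_diff_distrib)
        also have "\<bar>\<dots>\<bar> \<le> e' * B"
        proof (rule bound)
          show "\<bar>k m (y - x) - k m (y - q)\<bar> \<le> e'" for y
            by (rule d(2)) (use q(2) in \<open>simp add: dist_norm\<close>)
        qed (use e' in auto)
        finally show ?thesis using e' by linarith
      qed
      obtain N where N: "\<And>i j. i \<ge> N \<Longrightarrow> j \<ge> N \<Longrightarrow> norm (?a (r i) m q - ?a (r j) m q) < e / 3"
        using CauchyD[OF convD[OF q(1), of m], of "e / 3"] e by auto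
      have "norm (?a (r i) m x - ?a (r j) m x) < e" if "i \<ge> N" "j \<ge> N" for i j
        using N[OF that] close[of "r i"] close[of "r j"] unfolding real_norm_def by linarith
      then show "\<exists>N. \<forall>i\<ge>N. \<forall>j\<ge>N. norm (?a (r i) m x - ?a (r j) m x) < e" by blast
    qed
    then show "convergent (\<lambda>n. ?a (r n) m x)" by (rule Cauchy_convergent)
  qed
qed

text \<open>The sequence is close, uniformly in \<open>n\<close>, to its averages against a narrow bump, and these converge
  along a subsequence. They are close only away from the boundary; weighting by the distance \<open>d\<close>
  to the complement of \<open>\<Omega>\<close>, capped at \<open>1\<close>, makes the boundary layer negligible, because the norms are bounded. So
  the weighted sequence is Cauchy in the mean, which is enough for convergence almost everywhere (as
  \<open>d > 0\<close> on \<open>\<Omega>\<close>) and against test functions (which are bounded by a multiple of \<open>d\<close>).\<close>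

lemma tv_bounded_compactness:
  fixes w :: "nat \<Rightarrow> real^2 \<Rightarrow> real"
  assumes \<Omega>: "open \<Omega>" "bounded \<Omega>"
    and w: "\<And>n. tv_bounded \<Omega> C (w n)" "\<And>n. (LBINT x. \<bar>w n x\<bar>) \<le> B"
  shows "\<exists>r u. strict_mono (r::nat\<Rightarrow>nat) \<and> integrable lborel u \<and> (\<forall>x. x \<notin> \<Omega> \<longrightarrow> u x = 0) \<and>
    (AE x in lborel. (\<lambda>n. w (r n) x) \<longlonglongrightarrow> u x) \<and>
    (\<forall>\<psi>. test_fun \<Omega> \<psi> \<longrightarrow> (\<lambda>n. LBINT x. w (r n) x * \<psi> x) \<longlonglongrightarrow> (LBINT x. u x * \<psi> x))"
proof -
  have wi: "integrable lborel (w n)" and w0: "x \<notin> \<Omega> \<Longrightarrow> w n x = 0" for n x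
    using w(1) by (auto simp: tv_bounded_def)
  have [measurable]: "w n \<in> borel_measurable borel" for n using wi[of n] by auto
  have [measurable]: "\<Omega> \<in> sets borel" using \<Omega>(1) by simp
  have B: "0 \<le> B" by (rule order_trans[OF Bochner_Integration.integral_nonneg w(2)[of 0]]) simp
  have C: "0 \<le> C" by (rule tv_bounded_nonneg[OF w(1)])
  define \<epsilon> where "\<epsilon> = (\<lambda>m. 1 / real (Suc m))"
  have \<epsilon>: "\<epsilon> m > 0" for m by (simp add: \<epsilon>_def)
  have "\<exists>k :: real^2 \<Rightarrow> real. test_fun UNIV k \<and> (\<forall>x. 0 \<le> k x) \<and> (\<forall>x. norm x \<ge> \<epsilon> m \<longrightarrow> k x = 0) \<and>
      integrable lborel k \<and> (LBINT x. k x) = 1" for m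
  proof -
    obtain k :: "real^2 \<Rightarrow> real" where k: "smooth k" "\<And>x. 0 \<le> k x" "\<And>x. norm x \<ge> \<epsilon> m \<Longrightarrow> k x = 0"
      "integrable lborel k" "(LBINT x. k x) = 1"
      using bump_exists[OF \<epsilon>] by metis
    then show ?thesis
      using test_fun_translate(1)[OF k(1,3), where x = 0 and U = UNIV] by auto
  qed
  then obtain k :: "nat \<Rightarrow> real^2 \<Rightarrow> real" where k: "\<And>m. test_fun UNIV (k m)" "\<And>m x. 0 \<le> k m x"
    "\<And>m x. norm x \<ge> \<epsilon> m \<Longrightarrow> k m x = 0" "\<And>m. integrable lborel (k m)" "\<And>m. (LBINT x. k m x) = 1"
    by metis
  have km[measurable]: "k m \<in> borel_measurable borel" for m by (rule test_fun_borel[OF k(1)])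
  have "\<exists>K>0. \<forall>x. \<bar>k m x\<bar> \<le> K" for m using test_fun_bounded[OF k(1), of m] by simp
  then obtain K where K: "\<And>m. K m > 0" "\<And>m x. \<bar>k m x\<bar> \<le> K m" by metis
  obtain r1 where r1: "strict_mono r1" and
    conv: "\<And>m x. convergent (\<lambda>n. LBINT y. w (r1 n) y * k m (y - x))"
    by (rule bump_averages_convergent_subsequence[where w = w and k = k and B = B, OF wi w(2) k(1)])
      (rule that)
  \<comment> \<open>\<open>a m n\<close> is the average of the \<open>n\<close>-th function at scale \<open>\<epsilon> m\<close>, and \<open>A m\<close> is its limit in \<open>n\<close>.\<close>
  define a where "a = (\<lambda>m n x. LBINT y. w (r1 n) y * k m (y - x))"
  define A where "A = (\<lambda>m x. lim (\<lambda>n. a m n x))"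
  have lim_a: "(\<lambda>n. a m n x) \<longlonglongrightarrow> A m x" for m x
    using conv[of m x] unfolding a_def A_def by (simp add: convergent_LIMSEQ_iff)
  have am[measurable]: "a m n \<in> borel_measurable borel" for m n
    unfolding a_def by measurable
  have Am[measurable]: "A m \<in> borel_measurable borel" for m
    by (rule borel_measurable_LIMSEQ_real[OF lim_a]) measurable
  have ab: "\<bar>a m n x\<bar> \<le> K m * B" for m n x
  proof -
    have "\<bar>a m n x\<bar> \<le> K m * (LBINT y. \<bar>w (r1 n) y\<bar>)"
      unfolding a_def by (rule abs_integral_mult_le[OF wi]) (use K in auto)
    also have "\<dots> \<le> K m * B" using w(2) K(1)[of m] by (intro mult_left_mono) auto
    finally show ?thesis .
  qed
  have Ab: "\<bar>A m x\<bar> \<le> K m * B" for m x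
    by (rule LIMSEQ_le_const2[OF tendsto_rabs[OF lim_a]]) (use ab in auto)
  have finV: "integrable lborel (indicator V :: real^2 \<Rightarrow> real)" if "bounded V" "V \<in> sets borel" for V
    using that emeasure_bounded_finite[OF that(1)] by (intro integrable_real_indicator) auto
  have iV: "integrable lborel (\<lambda>x. indicator V x * f x)"
    if "bounded V" "V \<in> sets borel" "f \<in> borel_measurable borel" "\<And>x. \<bar>f x\<bar> \<le> c"
    for V and f :: "real^2 \<Rightarrow> real" and c
    by (rule integrable_bounded_mult[OF finV[OF that(1,2)] that(3,4)])
  have a_to_A: "(\<lambda>n. LBINT x. indicator \<Omega> x * \<bar>a m n x - A m x\<bar>) \<longlonglongrightarrow> 0" for m
  proof -
    have "(\<lambda>n. LBINT x. indicator \<Omega> x * \<bar>a m n x - A m x\<bar>) \<longlonglongrightarrow> integral\<^sup>L (lborel :: (real^2) measure) (\<lambda>x. 0)"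
    proof (rule integral_dominated_convergence[where w = "\<lambda>x. indicator \<Omega> x * (2 * (K m * B))"])
      show "integrable lborel (\<lambda>x. indicator \<Omega> x * (2 * (K m * B)))"
        by (rule iV[OF \<Omega>(2), where c = "\<bar>2 * (K m * B)\<bar>"]) auto
      show "AE x in lborel. (\<lambda>n. indicator \<Omega> x * \<bar>a m n x - A m x\<bar>) \<longlonglongrightarrow> 0"
        using lim_a by (intro AE_I2) (auto intro!: tendsto_mult_right_zero tendsto_rabs_zero LIM_zero)
      show "AE x in lborel. norm (indicator \<Omega> x * \<bar>a m n x - A m x\<bar>) \<le> indicator \<Omega> x * (2 * (K m * B))" for n
      proof (intro AE_I2)
        fix x
        have "\<bar>a m n x - A m x\<bar> \<le> 2 * (K m * B)" using ab[of m n x] Ab[of m x] by linarith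
        then show "norm (indicator \<Omega> x * \<bar>a m n x - A m x\<bar>) \<le> indicator \<Omega> x * (2 * (K m * B))"
          by (simp add: indicator_def)
      qed
    qed measurable
    then show ?thesis by simp
  qed
  have ne: "- \<Omega> \<noteq> {}" using \<Omega>(2) by (metis Compl_UNIV_eq double_complement not_bounded_UNIV)
  define d where "d = (\<lambda>x. min 1 (infdist x (- \<Omega>)))"
  have dc: "continuous_on UNIV d" unfolding d_def by (intro continuous_intros)
  have dm[measurable]: "d \<in> borel_measurable borel" using dc by (rule borel_measurable_continuous_onI)
  have d01: "0 \<le> d x" "d x \<le> 1" "\<bar>d x\<bar> \<le> 1" for x by (auto simp: d_def infdist_nonneg)
  have d_pos: "d x > 0" if "x \<in> \<Omega>" for x
    using that \<Omega>(1) ne unfolding d_def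
    by (metis ComplD closed_Compl in_closed_iff_infdist_zero infdist_nonneg less_eq_real_def min_less_iff_conj zero_less_one)
  define s where "s = (\<lambda>n x. w (r1 n) x * d x)"
  have si: "integrable lborel (s n)" for n unfolding s_def by (rule integrable_bounded_mult[OF wi dm d01(3)])
  have cauchy: "\<exists>N. \<forall>i\<ge>N. \<forall>j\<ge>N. (LBINT x. \<bar>s i x - s j x\<bar>) < e" if e: "e > 0" for e
  proof -
    obtain m where m: "\<epsilon> m < e / (2 * (2 * B + 4 * C + 1))"
      unfolding \<epsilon>_def using nat_approx_posE[of "e / (2 * (2 * B + 4 * C + 1))"] e B C
      by (metis add_nonneg_pos divide_pos_pos mult_nonneg_nonneg mult_pos_pos zero_le_numeral zero_less_numeral zero_less_one add_nonneg_nonneg)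
    \<comment> \<open>Where the averages at scale \<open>\<epsilon> m\<close> see only \<open>\<Omega>\<close>; off \<open>V\<close> the weight is at most \<open>\<epsilon> m\<close>.\<close>
    define V where "V = {x. infdist x (- \<Omega>) > \<epsilon> m}"
    have Vo: "open V" unfolding V_def by (intro open_Collect_less continuous_intros)
    have [measurable]: "V \<in> sets borel" using Vo by simp
    have VO: "V \<subseteq> \<Omega>"
    proof
      fix x assume "x \<in> V"
      then have "infdist x (- \<Omega>) \<noteq> 0" using \<epsilon>[of m] by (auto simp: V_def)
      then show "x \<in> \<Omega>" by (metis ComplI infdist_zero)
    qed
    then have Vb: "bounded V" using \<Omega>(2) bounded_subset by blast
    have Vball: "ball x (\<epsilon> m) \<subseteq> \<Omega>" if "x \<in> V" for x
    proof
      fix y assume y: "y \<in> ball x (\<epsilon> m)"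
      show "y \<in> \<Omega>"
      proof (rule ccontr)
        assume "y \<notin> \<Omega>"
        then have "infdist x (- \<Omega>) \<le> dist x y" by (intro infdist_le) auto
        then show False using y that by (simp add: V_def)
      qed
    qed
    have i_wa: "integrable lborel (\<lambda>x. indicator V x * \<bar>w (r1 n) x - a m n x\<bar>)" for n
    proof -
      have "integrable lborel (\<lambda>x. w (r1 n) x * indicator V x)"
        by (rule integrable_bounded_mult[OF wi, where K = 1]) (auto simp: indicator_def)
      moreover have "integrable lborel (\<lambda>x. indicator V x * a m n x)"
        by (rule iV[OF Vb _ am ab]) measurable
      ultimately have "integrable lborel (\<lambda>x. \<bar>w (r1 n) x * indicator V x - indicator V x * a m n x\<bar>)" by simp
      then show ?thesis by (simp add: abs_mult mult.commute[of "w _ _"] flip: right_diff_distrib)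
    qed
    have wa: "(LBINT x. indicator V x * \<bar>w (r1 n) x - a m n x\<bar>) \<le> 2 * C * \<epsilon> m" for n
    proof -
      have "ennreal (LBINT x. indicator V x * \<bar>w (r1 n) x - a m n x\<bar>)
          = (\<integral>\<^sup>+x. ennreal (indicator V x * \<bar>w (r1 n) x - a m n x\<bar>) \<partial>lborel)"
        using i_wa by (intro nn_integral_eq_integral[symmetric]) auto
      also have "\<dots> = (\<integral>\<^sup>+x. indicator V x * ennreal \<bar>w (r1 n) x - (LBINT y. w (r1 n) y * k m (y - x))\<bar> \<partial>lborel)"
        by (intro nn_integral_cong) (auto simp: indicator_def a_def)
      also have "\<dots> \<le> ennreal (2 * C * \<epsilon> m)"
        by (rule kernel_approximation[OF w(1) km k(2) _ k(4,5,3) Vo Vb Vball, where K = "K m"])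
          (use K(2) abs_le_D1 in auto)
      finally show ?thesis using C \<epsilon>[of m] by (subst (asm) ennreal_le_iff) auto
    qed
    let ?\<delta> = "\<lambda>n. LBINT x. indicator \<Omega> x * \<bar>a m n x - A m x\<bar>"
    have i_aA: "integrable lborel (\<lambda>x. indicator \<Omega> x * \<bar>a m n x - A m x\<bar>)" for n
    proof (rule iV[OF \<Omega>(2)])
      show "\<bar>\<bar>a m n x - A m x\<bar>\<bar> \<le> 2 * (K m * B)" for x using ab[of m n x] Ab[of m x] by linarith
    qed measurable
    have ineq: "(LBINT x. \<bar>s i x - s j x\<bar>) \<le> (2 * B + 4 * C) * \<epsilon> m + ?\<delta> i + ?\<delta> j" for i j
    proof -
      let ?T = "\<lambda>n x. indicator V x * \<bar>w (r1 n) x - a m n x\<bar> + indicator \<Omega> x * \<bar>a m n x - A m x\<bar> + \<epsilon> m * \<bar>w (r1 n) x\<bar>"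
      have iT: "integrable lborel (?T n)" for n using i_wa i_aA wi by simp
      have T: "(LBINT x. ?T n x) \<le> 2 * C * \<epsilon> m + ?\<delta> n + \<epsilon> m * B" for n
      proof -
        have "(LBINT x. ?T n x) = (LBINT x. indicator V x * \<bar>w (r1 n) x - a m n x\<bar>) + ?\<delta> n + \<epsilon> m * (LBINT x. \<bar>w (r1 n) x\<bar>)"
          using i_wa i_aA wi by simp
        also have "\<dots> \<le> 2 * C * \<epsilon> m + ?\<delta> n + \<epsilon> m * B"
          using wa[of n] w(2)[of "r1 n"] \<epsilon>[of m] by (intro add_mono mult_left_mono) auto
        finally show ?thesis .
      qed
      have "(LBINT x. \<bar>s i x - s j x\<bar>) \<le> (LBINT x. ?T i x + ?T j x)"
      proof (rule integral_mono)
        fix x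
        have eq: "\<bar>s i x - s j x\<bar> = \<bar>w (r1 i) x - w (r1 j) x\<bar> * d x"
          using d01[of x] by (simp add: s_def abs_mult flip: left_diff_distrib)
        show "\<bar>s i x - s j x\<bar> \<le> ?T i x + ?T j x"
        proof (cases "x \<in> V")
          case True
          then have "x \<in> \<Omega>" using VO by blast
          have "\<bar>s i x - s j x\<bar> \<le> \<bar>w (r1 i) x - w (r1 j) x\<bar>"
            unfolding eq using d01[of x] by (simp add: mult_right_le_one_le)
          also have "\<dots> \<le> \<bar>w (r1 i) x - a m i x\<bar> + \<bar>a m i x - A m x\<bar> + (\<bar>w (r1 j) x - a m j x\<bar> + \<bar>a m j x - A m x\<bar>)"
            by linarith
          also have "\<dots> \<le> ?T i x + ?T j x" using True \<open>x \<in> \<Omega>\<close> \<epsilon>[of m] by simp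
          finally show ?thesis .
        next
          case False
          then have "d x \<le> \<epsilon> m" by (auto simp: V_def d_def)
          then have "\<bar>s i x - s j x\<bar> \<le> \<bar>w (r1 i) x - w (r1 j) x\<bar> * \<epsilon> m"
            unfolding eq by (intro mult_left_mono) auto
          also have "\<dots> \<le> (\<bar>w (r1 i) x\<bar> + \<bar>w (r1 j) x\<bar>) * \<epsilon> m"
            using \<epsilon>[of m] by (intro mult_right_mono) auto
          also have "\<dots> \<le> ?T i x + ?T j x" using False by (simp add: distrib_left mult.commute[of _ "\<epsilon> m"])
          finally show ?thesis .
        qed
      qed (use si iT in auto)
      also have "\<dots> = (LBINT x. ?T i x) + (LBINT x. ?T j x)"
        by (rule Bochner_Integration.integral_add[OF iT iT])
      also have "\<dots> \<le> (2 * C * \<epsilon> m + ?\<delta> i + \<epsilon> m * B) + (2 * C * \<epsilon> m + ?\<delta> j + \<epsilon> m * B)"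
        by (intro add_mono T)
      also have "\<dots> = (2 * B + 4 * C) * \<epsilon> m + ?\<delta> i + ?\<delta> j" by (simp add: algebra_simps)
      finally show ?thesis .
    qed
    have main: "(2 * B + 4 * C) * \<epsilon> m \<le> e / 2"
    proof -
      have "(2 * B + 4 * C) * \<epsilon> m \<le> (2 * B + 4 * C + 1) * (e / (2 * (2 * B + 4 * C + 1)))"
        using m B C \<epsilon>[of m] by (intro mult_mono) auto
      also have "\<dots> = e / 2" using B C by (simp add: field_simps add_nonneg_eq_0_iff)
      finally show ?thesis .
    qed
    have "eventually (\<lambda>n. ?\<delta> n < e / 4) sequentially"
      using order_tendstoD(2)[OF a_to_A[of m], of "e / 4"] e by simp
    then obtain N where N: "\<And>n. n \<ge> N \<Longrightarrow> ?\<delta> n < e / 4" by (auto simp: eventually_sequentially)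
    have "(LBINT x. \<bar>s i x - s j x\<bar>) < e" if "i \<ge> N" "j \<ge> N" for i j
      using ineq[of i j] main N[OF that(1)] N[OF that(2)] by linarith
    then show ?thesis by blast
  qed
  obtain r2 where r2: "strict_mono r2" and ae: "AE x in lborel. Cauchy (\<lambda>i. s (r2 i) x)"
    by (rule cauchy_L1_AE_cauchy_subseq[of lborel s])
      (use si cauchy in \<open>simp_all add: real_norm_def\<close>)
  define u where "u = (\<lambda>x. lim (\<lambda>n. w (r1 (r2 n)) x))"
  have um[measurable]: "u \<in> borel_measurable borel"
    unfolding u_def by (rule borel_measurable_lim_metric) measurable
  have AEw: "AE x in lborel. (\<lambda>n. w (r1 (r2 n)) x) \<longlonglongrightarrow> u x"
    using ae
  proof eventually_elim
    case (elim x)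
    have "convergent (\<lambda>n. w (r1 (r2 n)) x)"
    proof (cases "x \<in> \<Omega>")
      case True
      obtain l where "(\<lambda>i. s (r2 i) x) \<longlonglongrightarrow> l"
        using Cauchy_convergent[OF elim] by (auto simp: convergent_def)
      from tendsto_divide[OF this tendsto_const[of "d x"]] show ?thesis
        using d_pos[OF True] by (auto simp: s_def convergent_def)
    next
      case False
      then show ?thesis by (simp add: w0 convergent_const)
    qed
    then show ?case unfolding u_def by (simp add: convergent_LIMSEQ_iff)
  qed
  have u0: "u x = 0" if "x \<notin> \<Omega>" for x
    using that by (simp add: u_def w0 limI)
  have ui: "integrable lborel u"
    by (rule Fatou_L1(1)[where f = "\<lambda>n. w (r1 (r2 n))", OF wi w(2) _ AEw]) measurable
  let ?s = "\<lambda>n. s (r2 n)" and ?v = "\<lambda>x. u x * d x"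
  have sv: "(\<lambda>n. LBINT x. \<bar>?s n x - ?v x\<bar>) \<longlonglongrightarrow> 0"
  proof (rule L1_Cauchy_AE_limit(2)[OF si])
    show "AE x in lborel. (\<lambda>n. ?s n x) \<longlonglongrightarrow> ?v x"
      using AEw by eventually_elim (auto simp: s_def intro!: tendsto_intros)
    show "\<exists>N. \<forall>i\<ge>N. \<forall>j\<ge>N. (LBINT x. \<bar>?s i x - ?s j x\<bar>) < e" if "e > 0" for e
      using cauchy[OF that] seq_suble[OF r2] by (meson order_trans)
  qed measurable
  have weak: "(\<lambda>n. LBINT x. w (r1 (r2 n)) x * \<psi> x) \<longlonglongrightarrow> (LBINT x. u x * \<psi> x)" if \<psi>: "test_fun \<Omega> \<psi>" for \<psi>
  proof -
    obtain Z where Z: "compact Z" "Z \<subseteq> \<Omega>" "\<And>x. x \<notin> Z \<Longrightarrow> \<psi> x = 0" using test_fun_support[OF \<psi>] by blast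
    obtain P where P: "P > 0" "\<And>x. \<bar>\<psi> x\<bar> \<le> P" using test_fun_bounded[OF \<psi>] by auto
    have "\<exists>c>0. \<forall>x\<in>Z. c \<le> d x"
    proof (cases "Z = {}")
      case False
      obtain x where "x \<in> Z" "\<And>y. y \<in> Z \<Longrightarrow> d x \<le> d y"
        using continuous_attains_inf[OF Z(1) False continuous_on_subset[OF dc]] by auto
      then show ?thesis using d_pos Z(2) by blast
    qed (auto intro: exI[of _ 1])
    then obtain c where c: "c > 0" "\<And>x. x \<in> Z \<Longrightarrow> c \<le> d x" by blast
    have \<psi>d: "\<bar>\<psi> x\<bar> \<le> P / c * d x" for x
    proof (cases "x \<in> Z")
      case True
      have "P * c \<le> P * d x" using c(2)[OF True] P(1) by simp
      then have "P \<le> P / c * d x" using c(1) by (simp add: field_simps)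
      then show ?thesis using P(2)[of x] by linarith
    next
      case False
      then show ?thesis using Z(3) P(1) c(1) d01(1)[of x] by simp
    qed
    note i1 = integrable_mult_test_fun[OF \<psi> wi] and i2 = integrable_mult_test_fun[OF \<psi> ui]
    have vi: "integrable lborel ?v" by (rule integrable_bounded_mult[OF ui dm d01(3)])
    have le: "norm ((LBINT x. w (r1 (r2 n)) x * \<psi> x) - (LBINT x. u x * \<psi> x))
        \<le> P / c * (LBINT x. \<bar>?s n x - ?v x\<bar>)" for n
    proof -
      have "norm ((LBINT x. w (r1 (r2 n)) x * \<psi> x) - (LBINT x. u x * \<psi> x))
          = \<bar>LBINT x. (w (r1 (r2 n)) x - u x) * \<psi> x\<bar>"
        using i1 i2 by (simp add: left_diff_distrib)
      also have "\<dots> \<le> (LBINT x. \<bar>(w (r1 (r2 n)) x - u x) * \<psi> x\<bar>)" by (rule integral_abs_bound)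
      also have "\<dots> \<le> (LBINT x. P / c * \<bar>?s n x - ?v x\<bar>)"
      proof (rule integral_mono)
        show "integrable lborel (\<lambda>x. \<bar>(w (r1 (r2 n)) x - u x) * \<psi> x\<bar>)"
          using i1 i2 by (simp add: left_diff_distrib)
        show "integrable lborel (\<lambda>x. P / c * \<bar>?s n x - ?v x\<bar>)" using si vi by simp
        fix x
        have "\<bar>(w (r1 (r2 n)) x - u x) * \<psi> x\<bar> \<le> \<bar>w (r1 (r2 n)) x - u x\<bar> * (P / c * d x)"
          unfolding abs_mult by (intro mult_left_mono \<psi>d) auto
        also have "\<dots> = P / c * \<bar>?s n x - ?v x\<bar>"
          using d01[of x] by (simp add: s_def abs_mult flip: left_diff_distrib)
        finally show "\<bar>(w (r1 (r2 n)) x - u x) * \<psi> x\<bar> \<le> P / c * \<bar>?s n x - ?v x\<bar>" .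
      qed
      finally show ?thesis by simp
    qed
    have "(\<lambda>n. (LBINT x. w (r1 (r2 n)) x * \<psi> x) - (LBINT x. u x * \<psi> x)) \<longlonglongrightarrow> 0"
      by (rule Lim_null_comparison[OF always_eventually[OF allI[OF le]] tendsto_mult_right_zero[OF sv]])
    then show ?thesis by (rule LIM_zero_cancel)
  qed
  show ?thesis
  proof (intro exI[of _ "r1 \<circ> r2"] exI[of _ u] conjI)
    show "strict_mono (r1 \<circ> r2)" using r1 r2 by (rule strict_mono_o)
  qed (use ui u0 AEw weak in simp_all)
qed

section \<open>Continuity of the integrands\<close>

text \<open>As \<open>inverse x\<close> blows up at \<open>0\<close>, the function is even continuous as a map into the compactified half-line.\<close>

lemma continuous_f_det: "continuous_on UNIV f_det"
proof -
  have "isCont f_det x" for x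
  proof -
    consider "x > 0" | "x < 0" | "x = 0" by linarith
    then show ?thesis
    proof cases
      case 1
      have "continuous_on {0<..} (\<lambda>x. ennreal (inverse x + x))"
        by (intro continuous_on_ennreal continuous_intros) auto
      then have "continuous_on {0<..} f_det"
        by (rule continuous_on_eq) (simp add: f_det_def)
      then show ?thesis using 1 by (simp add: continuous_on_eq_continuous_at)
    next
      case 2
      have "continuous_on {..<0::real} (\<lambda>x. \<infinity> :: ennreal)" by simp
      then have "continuous_on {..<0} f_det"
        by (rule continuous_on_eq) (simp add: f_det_def)
      then show ?thesis using 2 by (simp add: continuous_on_eq_continuous_at)
    next
      case 3
      have "(f_det \<longlongrightarrow> \<infinity>) (at 0)"
      proof (rule order_tendstoI)
        fix a :: ennreal assume "a < \<infinity>"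
        then obtain r where r: "a = ennreal r" "r \<ge> 0" by (cases a) auto
        have "eventually (\<lambda>x::real. \<bar>x\<bar> < 1 / (r + 1)) (at 0)"
          using r by (auto simp: eventually_at dist_real_def intro!: exI[of _ "1 / (r + 1)"])
        then show "eventually (\<lambda>x. a < f_det x) (at 0)"
        proof eventually_elim
          case (elim x)
          show ?case
          proof (cases "x > 0")
            case True
            have "r + 1 < inverse x" using elim True r by (simp add: field_simps)
            then have "ennreal r < ennreal (inverse x + x)" using True r by (intro ennreal_lessI) auto
            then show ?thesis using True r by (simp add: f_det_def del: ennreal_plus)
          next
            case False then show ?thesis using \<open>a < \<infinity>\<close> by (simp add: f_det_def)
          qed
        qed
      qed auto
      then show ?thesis using 3 by (simp add: isCont_def f_det_def)
    qed
  qed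
  then show ?thesis by (simp add: continuous_on_eq_continuous_at)
qed

text \<open>The bounds keep the argument of \<open>arccos\<close> in \<open>dist_SO3\<close> inside \<open>[-1, 1]\<close>. With \<open>t\<close> the trace, the lower
  one follows from \<open>(3 - t) * (1 + t) \<ge> 0\<close>: this product is the squared length of the axial vector of
  \<open>R - transpose R\<close>.\<close>

lemma rotation_trace_bounds:
  assumes "rotation_matrix (R::real^3^3)"
  shows "-1 \<le> (trace R - 1) / 2" "(trace R - 1) / 2 \<le> 1"
proof -
  have o: "R ** transpose R = mat 1" and d: "det R = 1"
    using assms by (simp_all add: rotation_matrix_def orthogonal_matrix_def)
  let ?a = "R$1$1" let ?b = "R$1$2" let ?c = "R$1$3"
  let ?p = "R$2$1" let ?q = "R$2$2" let ?r = "R$2$3"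
  let ?x = "R$3$1" let ?y = "R$3$2" let ?z = "R$3$3"
  have e: "?a*?a+?b*?b+?c*?c=1" "?p*?p+?q*?q+?r*?r=1" "?x*?x+?y*?y+?z*?z=1"
     "?a*?p+?b*?q+?c*?r=0" "?a*?x+?b*?y+?c*?z=0" "?p*?x+?q*?y+?r*?z=0"
    using o by (simp_all add: vec_eq_iff forall_3 matrix_matrix_mult_def transpose_def mat_def sum_3)
  have D: "?a*(?q*?z-?r*?y) - ?b*(?p*?z-?r*?x) + ?c*(?p*?y-?q*?x) = 1"
    using d by (simp add: det_3 algebra_simps)
  \<comment> \<open>Principal minors equal diagonal entries, as the inverse is both the transpose and the adjugate.\<close>
  have m1: "?q*?z-?r*?y = ?a"
  proof -
    have "?a * (?a*(?q*?z-?r*?y) - ?b*(?p*?z-?r*?x) + ?c*(?p*?y-?q*?x))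
        = (?q*?z-?r*?y) * (?a*?a+?b*?b+?c*?c) + (?c*?y-?b*?z) * (?a*?p+?b*?q+?c*?r) + (?b*?r-?c*?q) * (?a*?x+?b*?y+?c*?z)"
      by (simp add: algebra_simps)
    then show ?thesis unfolding D e by simp
  qed
  have m2: "?a*?z-?c*?x = ?q"
  proof -
    have "?q * (?a*(?q*?z-?r*?y) - ?b*(?p*?z-?r*?x) + ?c*(?p*?y-?q*?x))
        = (?r*?x-?p*?z) * (?a*?p+?b*?q+?c*?r) + (?a*?z-?c*?x) * (?p*?p+?q*?q+?r*?r) + (?c*?p-?a*?r) * (?p*?x+?q*?y+?r*?z)"
      by (simp add: algebra_simps)
    then show ?thesis unfolding D e by simp
  qed
  have m3: "?a*?q-?b*?p = ?z"
  proof -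
    have "?z * (?a*(?q*?z-?r*?y) - ?b*(?p*?z-?r*?x) + ?c*(?p*?y-?q*?x))
        = (?p*?y-?q*?x) * (?a*?x+?b*?y+?c*?z) + (?b*?x-?a*?y) * (?p*?x+?q*?y+?r*?z) + (?a*?q-?b*?p) * (?x*?x+?y*?y+?z*?z)"
      by (simp add: algebra_simps)
    then show ?thesis unfolding D e by simp
  qed
  define t where "t = trace R"
  have t: "t = ?a + ?q + ?z" by (simp add: t_def trace_def sum_3)
  have "?a\<^sup>2 \<le> 1" "?q\<^sup>2 \<le> 1" "?z\<^sup>2 \<le> 1"
    using e(1-3) zero_le_square[of ?a] zero_le_square[of ?b] zero_le_square[of ?c] zero_le_square[of ?p] zero_le_square[of ?q]
      zero_le_square[of ?r] zero_le_square[of ?x] zero_le_square[of ?y] zero_le_square[of ?z]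
    unfolding power2_eq_square by linarith+
  then have "?a \<le> 1" "?q \<le> 1" "?z \<le> 1" by (auto intro: power2_le_imp_le[of _ 1, simplified])
  then have t3: "t \<le> 3" unfolding t by linarith
  have "(3 - t) * (1 + t) = (?b-?p)\<^sup>2 + (?c-?x)\<^sup>2 + (?r-?y)\<^sup>2"
  proof -
    have "(3 - t) * (1 + t) - ((?b-?p)\<^sup>2 + (?c-?x)\<^sup>2 + (?r-?y)\<^sup>2)
       = 3 - ((?a*?a+?b*?b+?c*?c) + (?p*?p+?q*?q+?r*?r) + (?x*?x+?y*?y+?z*?z))
         + 2 * t - 2 * ((?a*?q-?b*?p) + (?a*?z-?c*?x) + (?q*?z-?r*?y))"
      unfolding t by (simp add: power2_eq_square algebra_simps)
    also have "\<dots> = 0" unfolding e m1 m2 m3 t by simp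
    finally show ?thesis by simp
  qed
  then have nn: "(3 - t) * (1 + t) \<ge> 0" by simp
  have "t \<ge> -1"
  proof (rule ccontr)
    assume "\<not> ?thesis"
    then have "(3 - t) * (1 + t) < 0" by (intro mult_pos_neg) auto
    then show False using nn by simp
  qed
  then show "-1 \<le> (trace R - 1) / 2" "(trace R - 1) / 2 \<le> 1" using t3 by (simp_all add: t_def)
qed

lemma SO3_simps: "carrier SO3 = {R. rotation_matrix R}" "P \<otimes>\<^bsub>SO3\<^esub> Q = P ** Q" "\<one>\<^bsub>SO3\<^esub> = mat 1"
  by (simp_all add: SO3_def)

lemma rotation_transpose_mult:
  fixes P Q :: "real^'n^'n"
  assumes "rotation_matrix P" "rotation_matrix Q"
  shows "rotation_matrix (transpose P ** Q)"
  using assms by (simp add: rotation_matrix_def orthogonal_matrix_mul orthogonal_matrix_transpose det_mul)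

lemma rotation_mult:
  fixes P Q :: "real^'n^'n"
  assumes "rotation_matrix P" "rotation_matrix Q"
  shows "rotation_matrix (P ** Q)"
  using assms by (simp add: rotation_matrix_def orthogonal_matrix_mul det_mul)

text \<open>Thus small \<open>dist_SO3\<close> means closeness of the matrices, and convergence of classes can be handled
  through representatives, without a triangle inequality for the distance.\<close>

lemma norm_diff_rotation_matrices:
  assumes "rotation_matrix (P::real^3^3)" "rotation_matrix Q"
  shows "(norm (P - Q))\<^sup>2 = 6 - 2 * trace (transpose P ** Q)"
proof -
  have nrm: "R \<bullet> R = 3" if "rotation_matrix R" for R :: "real^3^3"
  proof -
    have "R ** transpose R = mat 1" using that by (simp add: rotation_matrix_def orthogonal_matrix_def)
    then have "R$1 \<bullet> R$1 = 1" "R$2 \<bullet> R$2 = 1" "R$3 \<bullet> R$3 = 1"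
      by (simp_all add: vec_eq_iff forall_3 matrix_matrix_mult_def transpose_def mat_def sum_3 inner_vec_def)
    then show ?thesis by (simp add: inner_vec_def[of R] sum_3)
  qed
  have "trace (transpose P ** Q) = P \<bullet> Q"
    by (simp add: trace_def matrix_matrix_mult_def transpose_def inner_vec_def sum_3)
  then show ?thesis
    using nrm[OF assms(1)] nrm[OF assms(2)]
    by (simp add: power2_norm_eq_inner inner_diff_left inner_diff_right inner_commute)
qed

lemma dist_SO3_nonneg:
  assumes "rotation_matrix P" "rotation_matrix Q"
  shows "0 \<le> dist_SO3 P Q"
  using rotation_trace_bounds[OF rotation_transpose_mult[OF assms]]
  by (simp add: dist_SO3_def arccos_lbound)

lemma dist_SO3_tendsto_0:
  assumes P: "\<And>n. rotation_matrix (P n)" and Q: "rotation_matrix Q"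
    and lim: "(\<lambda>n. dist_SO3 (P n) Q) \<longlonglongrightarrow> 0"
  shows "P \<longlonglongrightarrow> Q"
proof -
  let ?x = "\<lambda>n. (trace (transpose (P n) ** Q) - 1) / 2"
  note b = rotation_trace_bounds[OF rotation_transpose_mult[OF P Q]]
  have "(\<lambda>n. dist_SO3 (P n) Q / sqrt 2) \<longlonglongrightarrow> 0 / sqrt 2" by (intro tendsto_intros lim) simp
  then have "(\<lambda>n. arccos (?x n)) \<longlonglongrightarrow> 0" by (simp add: dist_SO3_def)
  then have "(\<lambda>n. cos (arccos (?x n))) \<longlonglongrightarrow> cos 0" by (rule tendsto_cos)
  then have "?x \<longlonglongrightarrow> 1" using b by simp
  then have "(\<lambda>n. 4 - 4 * ?x n) \<longlonglongrightarrow> 4 - 4 * 1" by (intro tendsto_intros)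
  then have "(\<lambda>n. (norm (P n - Q))\<^sup>2) \<longlonglongrightarrow> 0"
    unfolding norm_diff_rotation_matrices[OF P Q] by (simp add: diff_divide_distrib)
  then have "(\<lambda>n. sqrt ((norm (P n - Q))\<^sup>2)) \<longlonglongrightarrow> sqrt 0" by (rule tendsto_real_sqrt)
  then have "(\<lambda>n. norm (P n - Q)) \<longlonglongrightarrow> 0" by simp
  then show ?thesis using LIM_zero_iff tendsto_norm_zero_iff by blast
qed

lemma tendsto_matrix_mult:
  fixes A :: "'a \<Rightarrow> real^'n^'m" and B :: "'a \<Rightarrow> real^'k^'n"
  assumes "(A \<longlongrightarrow> a) F" "(B \<longlongrightarrow> b) F"
  shows "((\<lambda>x. A x ** B x) \<longlongrightarrow> a ** b) F"
  unfolding matrix_matrix_mult_def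
  by (intro vec_tendstoI) (auto intro!: tendsto_intros assms)

lemma dist_SO3_tendsto:
  assumes P: "\<And>n. rotation_matrix (P n)" "rotation_matrix p" "P \<longlonglongrightarrow> p"
    and Q: "\<And>n. rotation_matrix (Q n)" "rotation_matrix q" "Q \<longlonglongrightarrow> q"
  shows "(\<lambda>n. dist_SO3 (P n) (Q n)) \<longlonglongrightarrow> dist_SO3 p q"
proof -
  have "(\<lambda>n. transpose (P n)) \<longlonglongrightarrow> transpose p"
    unfolding transpose_def by (intro vec_tendstoI) (auto intro!: tendsto_intros P)
  then have "(\<lambda>n. transpose (P n) ** Q n) \<longlonglongrightarrow> transpose p ** q"
    by (rule tendsto_matrix_mult[OF _ Q(3)])
  then have "(\<lambda>n. (trace (transpose (P n) ** Q n) - 1) / 2) \<longlonglongrightarrow> (trace (transpose p ** q) - 1) / 2"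
    unfolding trace_def by (intro tendsto_intros) auto
  then have "(\<lambda>n. arccos ((trace (transpose (P n) ** Q n) - 1) / 2)) \<longlonglongrightarrow> arccos ((trace (transpose p ** q) - 1) / 2)"
    using rotation_trace_bounds[OF rotation_transpose_mult[OF P(1) Q(1)]]
      rotation_trace_bounds[OF rotation_transpose_mult[OF P(2) Q(2)]]
    by (intro continuous_on_tendsto_compose[OF continuous_on_arccos']) auto
  then show ?thesis unfolding dist_SO3_def by (intro tendsto_intros)
qed

lemma tendsto_Min:
  fixes f :: "'i \<Rightarrow> 'a \<Rightarrow> real"
  assumes "finite I" "I \<noteq> {}" "\<And>i. i \<in> I \<Longrightarrow> ((\<lambda>x. f i x) \<longlongrightarrow> l i) F"
  shows "((\<lambda>x. Min ((\<lambda>i. f i x) ` I)) \<longlongrightarrow> Min (l ` I)) F"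
  using assms by (induction I rule: finite_ne_induct) (auto intro!: tendsto_min)

lemma coset_representative:
  assumes S: "subgroup S SO3" and A: "A \<in> lcosets\<^bsub>SO3\<^esub> S" and P: "P \<in> A"
  shows "rotation_matrix P" "A = P <#\<^bsub>SO3\<^esub> S"
proof -
  interpret Group.group SO3 by (rule group_SO3)
  obtain Q where Q: "Q \<in> carrier SO3" "A = Q <#\<^bsub>SO3\<^esub> S" using A by (auto simp: LCOSETS_def)
  then show "A = P <#\<^bsub>SO3\<^esub> S" using l_repr_independence[of P Q S] P S by simp
  have "P \<in> carrier SO3" using subgroup.elemlcos_carrier[OF S group_SO3 Q(1)] P Q(2) by simp
  then show "rotation_matrix P" by (simp add: SO3_simps)
qed

lemma coset_nonempty:
  assumes S: "subgroup S SO3" and A: "A \<in> lcosets\<^bsub>SO3\<^esub> S"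
  shows "A \<noteq> {}"
  using A group.lcos_self[OF group_SO3 _ S] by (auto simp: LCOSETS_def)

lemma dist_class_representatives:
  assumes S: "subgroup S SO3" and A: "A \<in> lcosets\<^bsub>SO3\<^esub> S" "P \<in> A" and B: "B \<in> lcosets\<^bsub>SO3\<^esub> S" "Q \<in> B"
  shows "dist_class A B = Min ((\<lambda>T. dist_SO3 (P ** T) Q) ` S)"
  using dist_class_coset[OF S, of P Q] coset_representative[OF S A] coset_representative[OF S B]
  by (simp add: SO3_simps)

lemma subgroup_SO3D:
  assumes S: "subgroup S SO3"
  shows "T \<in> S \<Longrightarrow> rotation_matrix T" "mat 1 \<in> S"
  using subgroup.mem_carrier[OF S, of T] subgroup.one_closed[OF S] by (auto simp: SO3_simps)

lemma dist_class_self: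
  assumes S: "subgroup S SO3" "finite S" and A: "A \<in> lcosets\<^bsub>SO3\<^esub> S"
  shows "dist_class A A = 0"
proof -
  obtain P where P: "P \<in> A" using coset_nonempty[OF S(1) A] by blast
  have rP: "rotation_matrix P" by (rule coset_representative(1)[OF S(1) A P])
  have "transpose P ** P = mat 1" using rP by (simp add: rotation_matrix_def orthogonal_matrix_def)
  moreover have "trace (mat 1 :: real^3^3) = 3" by (simp add: trace_def mat_def)
  ultimately have "dist_SO3 (P ** mat 1) P = 0" by (simp add: dist_SO3_def)
  moreover have "0 \<le> dist_SO3 (P ** T) P" if "T \<in> S" for T
    by (intro dist_SO3_nonneg rotation_mult rP subgroup_SO3D(1)[OF S(1) that])
  ultimately show ?thesis
    unfolding dist_class_representatives[OF S(1) A P A P]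
    using S(2) subgroup_SO3D(2)[OF S(1)] by (intro Min_eqI) (auto intro!: image_eqI[of _ _ "mat 1"])
qed

text \<open>For fixed \<open>p\<close> in \<open>a\<close>, some element of the finite class \<open>A n\<close> realizes the distance of \<open>A n\<close> to \<open>a\<close> as
  its distance to \<open>p\<close>. These elements converge to \<open>p\<close>.\<close>

lemma converging_representatives:
  assumes S: "subgroup S SO3" "finite S"
    and A: "\<And>n. A n \<in> lcosets\<^bsub>SO3\<^esub> S" "a \<in> lcosets\<^bsub>SO3\<^esub> S"
    and lim: "(\<lambda>n. dist_class (A n) a) \<longlonglongrightarrow> 0"
  obtains P p where "\<And>n. P n \<in> A n" "p \<in> a" "P \<longlonglongrightarrow> p"
proof -
  obtain p where p: "p \<in> a" using coset_nonempty[OF S(1) A(2)] by blast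
  have "\<exists>P\<in>A n. dist_class (A n) a = dist_SO3 P p" for n
  proof -
    obtain P where P: "P \<in> A n" using coset_nonempty[OF S(1) A(1)] by blast
    have "dist_class (A n) a \<in> (\<lambda>T. dist_SO3 (P ** T) p) ` S"
      unfolding dist_class_representatives[OF S(1) A(1) P A(2) p]
      using S(2) subgroup_SO3D(2)[OF S(1)] by (intro Min_in) auto
    then obtain T where T: "T \<in> S" "dist_class (A n) a = dist_SO3 (P ** T) p" by blast
    have "P ** T \<in> P <#\<^bsub>SO3\<^esub> S" using T(1) by (auto simp: l_coset_def SO3_simps)
    then have "P ** T \<in> A n" using coset_representative(2)[OF S(1) A(1) P] by simp
    then show ?thesis using T(2) by blast
  qed
  then obtain P where P: "\<And>n. P n \<in> A n" "\<And>n. dist_class (A n) a = dist_SO3 (P n) p" by metis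
  have "P \<longlonglongrightarrow> p"
  proof (rule dist_SO3_tendsto_0)
    show "rotation_matrix (P n)" for n by (rule coset_representative(1)[OF S(1) A(1) P(1)])
    show "rotation_matrix p" by (rule coset_representative(1)[OF S(1) A(2) p])
  qed (use lim P(2) in simp)
  with P(1) p show ?thesis by (rule that)
qed

lemma dist_class_tendsto:
  assumes S: "subgroup S SO3" "finite S"
    and A: "\<And>n. A n \<in> lcosets\<^bsub>SO3\<^esub> S" "a \<in> lcosets\<^bsub>SO3\<^esub> S" "\<And>n. P n \<in> A n" "p \<in> a" "P \<longlonglongrightarrow> p"
    and B: "\<And>n. B n \<in> lcosets\<^bsub>SO3\<^esub> S" "b \<in> lcosets\<^bsub>SO3\<^esub> S" "\<And>n. Q n \<in> B n" "q \<in> b" "Q \<longlonglongrightarrow> q"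
  shows "(\<lambda>n. dist_class (A n) (B n)) \<longlonglongrightarrow> dist_class a b"
proof -
  note rA = coset_representative(1)[OF S(1) A(1,3)] coset_representative(1)[OF S(1) A(2,4)]
  note rB = coset_representative(1)[OF S(1) B(1,3)] coset_representative(1)[OF S(1) B(2,4)]
  show ?thesis
    unfolding dist_class_representatives[OF S(1) A(1,3) B(1,3)] dist_class_representatives[OF S(1) A(2,4) B(2,4)]
  proof (rule tendsto_Min[OF S(2)])
    show "S \<noteq> {}" using subgroup_SO3D(2)[OF S(1)] by blast
    show "(\<lambda>n. dist_SO3 (P n ** T) (Q n)) \<longlonglongrightarrow> dist_SO3 (p ** T) q" if "T \<in> S" for T
      by (intro dist_SO3_tendsto rotation_mult rA rB subgroup_SO3D(1)[OF S(1) that] tendsto_matrix_mult A(5) B(5) tendsto_const)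
  qed
qed

lemma continuous_class_map_representatives:
  assumes S: "subgroup S SO3" "finite S" and I: "continuous_class_map K S I"
    and x: "\<And>n. x n \<in> K" "y \<in> K" "x \<longlonglongrightarrow> y"
  obtains P p where "\<And>n. P n \<in> I (x n)" "p \<in> I y" "P \<longlonglongrightarrow> p"
proof (rule converging_representatives[OF S])
  have L: "I z \<in> lcosets\<^bsub>SO3\<^esub> S" if "z \<in> K" for z using I that by (simp add: continuous_class_map_def)
  show "I (x n) \<in> lcosets\<^bsub>SO3\<^esub> S" "I y \<in> lcosets\<^bsub>SO3\<^esub> S" for n using L x by auto
  have "continuous (at y within K) (\<lambda>z. dist_class (I z) (I y))"
    using I x(2) dist_class_self[OF S L[OF x(2)]] by (simp add: continuous_class_map_def continuous_within)
  then show "(\<lambda>n. dist_class (I (x n)) (I y)) \<longlonglongrightarrow> 0"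
    using x dist_class_self[OF S L[OF x(2)]] unfolding continuous_within_sequentially by (auto simp: o_def)
qed (rule that)

text \<open>In dimension two the rotation factor of the polar decomposition is explicit: it is the normalized
  conformal part of \<open>A\<close>.\<close>

lemma rotation_part_eq:
  assumes "det (A::real^2^2) > 0"
  defines "n \<equiv> sqrt ((A$1$1 + A$2$2)\<^sup>2 + (A$2$1 - A$1$2)\<^sup>2)"
  defines "c \<equiv> (A$1$1 + A$2$2) / n" and "s \<equiv> (A$2$1 - A$1$2) / n"
  shows "n > 0" "c\<^sup>2 + s\<^sup>2 = 1"
    "rotation_part A = vector [vector [c, -s, 0], vector [s, c, 0], vector [0, 0, 1]]"
proof -
  let ?p = "A$1$1" let ?q = "A$1$2" let ?r = "A$2$1" let ?t = "A$2$2"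
  have d: "?p * ?t - ?q * ?r > 0" using assms(1) by (simp add: det_2)
  have e: "(?p + ?t)^2 + (?r - ?q)^2 = (?p - ?t)^2 + (?r + ?q)^2 + 4 * (?p * ?t - ?q * ?r)"
    by (simp add: power2_eq_square algebra_simps)
  have e0: "(?p + ?t)^2 + (?r - ?q)^2 > 0" unfolding e using d by (simp add: add_nonneg_pos)
  then show n: "n > 0" by (simp add: n_def)
  have n2: "n^2 = (?p + ?t)^2 + (?r - ?q)^2" using e0 by (simp add: n_def)
  show one: "c\<^sup>2 + s\<^sup>2 = 1"
    unfolding c_def s_def power_divide n2 add_divide_distrib[symmetric] by (rule divide_self) (use e0 in linarith)
  let ?Q = "vector [vector [c, -s], vector [s, c]] :: real^2^2"
  have rQ: "rotation_matrix ?Q" unfolding rotation_matrix_2_iff using one by blast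
  have "A = ?Q ** (transpose ?Q ** A)"
    using rQ by (simp add: matrix_mul_assoc rotation_matrix_def orthogonal_matrix_def)
  moreover have "posdef_sym (transpose ?Q ** A)"
  proof -
    have "det (transpose ?Q ** A) > 0" using rQ assms(1) by (simp add: det_mul rotation_matrix_def)
    moreover have "c * (?p + ?t) + s * (?r - ?q) = n\<^sup>2 / n"
      unfolding c_def s_def n2 by (simp add: power2_eq_square add_divide_distrib distrib_right)
    then have "c * (?p + ?t) + s * (?r - ?q) > 0" using n by simp
    moreover have "c * (?r - ?q) = s * (?p + ?t)" by (simp add: c_def s_def)
    ultimately show ?thesis
      by (simp add: posdef_sym_iff) (simp add: matrix_matrix_mult_def transpose_def sum_2 algebra_simps)
  qed
  ultimately have "polar_rotation A = ?Q"
    unfolding polar_rotation_def by (intro the1_equality[OF polar_decomposition_unique[OF assms(1)]]) (use rQ in blast)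
  then show "rotation_part A = vector [vector [c, -s, 0], vector [s, c, 0], vector [0, 0, 1]]"
    by (simp add: rotation_part_def)
qed

lemma rotation_part_rotation:
  assumes "det (A::real^2^2) > 0"
  shows "rotation_matrix (rotation_part A)"
proof -
  have "rotation_matrix (vector [vector [c, -s, 0], vector [s, c, 0], vector [0, 0, 1]] :: real^3^3)"
    if "c\<^sup>2 + s\<^sup>2 = 1" for c s :: real
    using that by (simp add: rotation_matrix_def orthogonal_matrix vec_eq_iff forall_3
      matrix_matrix_mult_def transpose_def mat_def sum_3 det_3 power2_eq_square algebra_simps)
  then show ?thesis unfolding rotation_part_eq(3)[OF assms] using rotation_part_eq(2)[OF assms] by blast
qed

lemma rotation_part_tendsto:
  fixes A :: "nat \<Rightarrow> real^2^2"
  assumes A: "\<And>n. det (A n) > 0" and a: "det a > 0" and lim: "A \<longlonglongrightarrow> a"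
  shows "(\<lambda>n. rotation_part (A n)) \<longlonglongrightarrow> rotation_part a"
proof -
  have c: "(\<lambda>n. A n $ i $ j) \<longlonglongrightarrow> a $ i $ j" for i j by (intro tendsto_vec_nth lim)
  let ?n = "\<lambda>A :: real^2^2. sqrt ((A$1$1 + A$2$2)\<^sup>2 + (A$2$1 - A$1$2)\<^sup>2)"
  have n0: "?n a \<noteq> 0" by (rule less_imp_neq[OF rotation_part_eq(1)[OF a], symmetric])
  have "(\<lambda>n. (A n$1$1 + A n$2$2) / ?n (A n)) \<longlonglongrightarrow> (a$1$1 + a$2$2) / ?n a"
    "(\<lambda>n. (A n$2$1 - A n$1$2) / ?n (A n)) \<longlonglongrightarrow> (a$2$1 - a$1$2) / ?n a"
    by (intro tendsto_divide tendsto_real_sqrt tendsto_add tendsto_power tendsto_diff c n0)+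
  moreover have "(\<lambda>n. vector [vector [c n, - s n, 0], vector [s n, c n, 0], vector [0, 0, 1]] :: real^3^3)
      \<longlonglongrightarrow> vector [vector [c0, - s0, 0], vector [s0, c0, 0], vector [0, 0, 1]]"
    if "c \<longlonglongrightarrow> c0" "s \<longlonglongrightarrow> s0" for c s c0 s0
  proof (intro vec_tendstoI)
    fix i j :: 3
    show "(\<lambda>n. (vector [vector [c n, - s n, 0], vector [s n, c n, 0], vector [0, 0, 1]] :: real^3^3) $ i $ j)
      \<longlonglongrightarrow> (vector [vector [c0, - s0, 0], vector [s0, c0, 0], vector [0, 0, 1]] :: real^3^3) $ i $ j"
      using exhaust_3[of i] exhaust_3[of j] that by (auto intro!: tendsto_minus)
  qed
  ultimately show ?thesis
    unfolding rotation_part_eq(3)[OF A] rotation_part_eq(3)[OF a] by blast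
qed

lemma dist_class_rotated_continuous:
  assumes S: "subgroup S SO3" "finite S"
    and I1: "continuous_class_map K1 S I1" and I2: "continuous_class_map K2 S I2"
  shows "continuous_on ({A. det A > 0} \<times> K1 \<times> K2)
    (\<lambda>(A, x, y). dist_class (rotation_part A <#\<^bsub>SO3\<^esub> I1 x) (I2 y))"
proof (rule continuous_on_sequentiallyI, clarify)
  interpret Group.group SO3 by (rule group_SO3)
  fix u :: "nat \<Rightarrow> (real^2^2) \<times> (real^2) \<times> (real^2)" and A :: "real^2^2" and x y :: "real^2"
  assume u: "\<forall>n. u n \<in> {A. det A > 0} \<times> K1 \<times> K2" and A: "0 < det A" and xy: "x \<in> K1" "y \<in> K2"
    and lim: "u \<longlonglongrightarrow> (A, x, y)"
  define An xn yn where "An = (\<lambda>n. fst (u n))" and "xn = (\<lambda>n. fst (snd (u n)))" and "yn = (\<lambda>n. snd (snd (u n)))"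
  have lims: "An \<longlonglongrightarrow> A" "xn \<longlonglongrightarrow> x" "yn \<longlonglongrightarrow> y"
    using tendsto_fst[OF lim] tendsto_fst[OF tendsto_snd[OF lim]] tendsto_snd[OF tendsto_snd[OF lim]]
    by (simp_all add: An_def xn_def yn_def)
  have mem: "det (An n) > 0" "xn n \<in> K1" "yn n \<in> K2" for n
    using u by (auto simp: An_def xn_def yn_def mem_Times_iff)
  obtain P p where P: "\<And>n. P n \<in> I1 (xn n)" "p \<in> I1 x" "P \<longlonglongrightarrow> p"
    using continuous_class_map_representatives[OF S I1 mem(2) xy(1) lims(2)] by blast
  obtain Q q where Q: "\<And>n. Q n \<in> I2 (yn n)" "q \<in> I2 y" "Q \<longlonglongrightarrow> q"
    using continuous_class_map_representatives[OF S I2 mem(3) xy(2) lims(3)] by blast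
  have L1: "I1 z \<in> lcosets\<^bsub>SO3\<^esub> S" if "z \<in> K1" for z using I1 that by (simp add: continuous_class_map_def)
  have L2: "I2 z \<in> lcosets\<^bsub>SO3\<^esub> S" if "z \<in> K2" for z using I2 that by (simp add: continuous_class_map_def)
  have act: "R <#\<^bsub>SO3\<^esub> C \<in> lcosets\<^bsub>SO3\<^esub> S" if R: "rotation_matrix R" and C: "C \<in> lcosets\<^bsub>SO3\<^esub> S" for R C
  proof -
    obtain T where T: "T \<in> carrier SO3" "C = T <#\<^bsub>SO3\<^esub> S" using C by (auto simp: LCOSETS_def)
    have R: "R \<in> carrier SO3" using R by (simp add: SO3_simps)
    have "R <#\<^bsub>SO3\<^esub> C = (R \<otimes>\<^bsub>SO3\<^esub> T) <#\<^bsub>SO3\<^esub> S"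
      unfolding T(2) by (rule lcos_m_assoc[OF subgroup.subset[OF S(1)] R T(1)])
    then show ?thesis using R T(1) by (auto simp: LCOSETS_def)
  qed
  have mem_act: "R ** T \<in> R <#\<^bsub>SO3\<^esub> C" if "T \<in> C" for R T C
    using that by (auto simp: l_coset_def SO3_simps)
  have "(\<lambda>n. dist_class (rotation_part (An n) <#\<^bsub>SO3\<^esub> I1 (xn n)) (I2 (yn n)))
      \<longlonglongrightarrow> dist_class (rotation_part A <#\<^bsub>SO3\<^esub> I1 x) (I2 y)"
  proof (rule dist_class_tendsto[OF S])
    show "(\<lambda>n. rotation_part (An n) ** P n) \<longlonglongrightarrow> rotation_part A ** p"
      by (intro tendsto_matrix_mult rotation_part_tendsto mem A lims P)
    show "\<And>n. rotation_part (An n) <#\<^bsub>SO3\<^esub> I1 (xn n) \<in> lcosets\<^bsub>SO3\<^esub> S"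
      "rotation_part A <#\<^bsub>SO3\<^esub> I1 x \<in> lcosets\<^bsub>SO3\<^esub> S"
      by (intro act rotation_part_rotation mem A L1 xy)+
    show "\<And>n. rotation_part (An n) ** P n \<in> rotation_part (An n) <#\<^bsub>SO3\<^esub> I1 (xn n)"
      "rotation_part A ** p \<in> rotation_part A <#\<^bsub>SO3\<^esub> I1 x"
      by (intro mem_act P)+
    show "\<And>n. I2 (yn n) \<in> lcosets\<^bsub>SO3\<^esub> S" "I2 y \<in> lcosets\<^bsub>SO3\<^esub> S" by (intro L2 mem xy)+
  qed (rule Q)+
  then show "(\<lambda>n. case u n of (A, x, y) \<Rightarrow> dist_class (rotation_part A <#\<^bsub>SO3\<^esub> I1 x) (I2 y))
      \<longlonglongrightarrow> dist_class (rotation_part A <#\<^bsub>SO3\<^esub> I1 x) (I2 y)"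
    by (simp add: An_def xn_def yn_def case_prod_beta)
qed

section \<open>Weak Jacobians and the total variation\<close>

lemma AE_lebesgue_on_iff:
  assumes "open (\<Omega> :: (real^2) set)"
  shows "(AE x in lebesgue_on \<Omega>. P x) \<longleftrightarrow> (AE x in lborel. x \<in> \<Omega> \<longrightarrow> P x)"
  using assms by (subst AE_restrict_space_iff) (auto simp: AE_completion_iff)

lemma
  fixes g :: "real^2 \<Rightarrow> real"
  assumes \<Omega>: "open \<Omega>" and g: "g \<in> borel_measurable borel" "\<And>x. x \<notin> \<Omega> \<Longrightarrow> g x = 0"
  shows integrable_lebesgue_on_iff_lborel: "integrable (lebesgue_on \<Omega>) g \<longleftrightarrow> integrable lborel g"
    and integral_lebesgue_on_eq_lborel: "(LINT x|lebesgue_on \<Omega>. g x) = (LBINT x. g x)"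
proof -
  have eq: "(\<lambda>x. indicator \<Omega> x *\<^sub>R g x) = g" using g(2) by (auto simp: fun_eq_iff indicator_def)
  have S: "\<Omega> \<inter> space lebesgue \<in> sets lebesgue" using \<Omega> by auto
  show "integrable (lebesgue_on \<Omega>) g \<longleftrightarrow> integrable lborel g"
    unfolding integrable_restrict_space[OF S] eq using g(1) by (intro integrable_completion) simp
  show "(LINT x|lebesgue_on \<Omega>. g x) = (LBINT x. g x)"
    unfolding integral_restrict_space[OF S] eq using g(1) by (intro integral_completion) simp
qed

text \<open>Integrals over \<open>\<Omega>\<close> refer to completed measures; a Borel function on the whole plane stands in for the
  integrand wherever Tonelli's theorem or translations are needed.\<close>

definition represents :: "(real^2) set \<Rightarrow> (real^2 \<Rightarrow> real) \<Rightarrow> (real^2 \<Rightarrow> real) \<Rightarrow> bool" where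
  "represents \<Omega> g f \<longleftrightarrow> integrable lborel g \<and> (\<forall>x. x \<notin> \<Omega> \<longrightarrow> g x = 0) \<and> (AE x in lebesgue_on \<Omega>. g x = f x)"

lemma ex_represents:
  assumes \<Omega>: "open \<Omega>" and f: "integrable (lebesgue_on \<Omega>) f"
  shows "\<exists>g. represents \<Omega> g f"
proof -
  have S: "\<Omega> \<inter> space lebesgue \<in> sets lebesgue" using \<Omega> by auto
  have [measurable]: "\<Omega> \<in> sets borel" using \<Omega> by simp
  have F: "integrable lebesgue (\<lambda>x. indicator \<Omega> x *\<^sub>R f x)"
    using f unfolding integrable_restrict_space[OF S] .
  then obtain g where g: "g \<in> borel_measurable lborel" "AE x in lborel. indicator \<Omega> x *\<^sub>R f x = g x"
    using completion_ex_borel_measurable_real[of "\<lambda>x. indicator \<Omega> x *\<^sub>R f x" lborel] by auto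
  then have [measurable]: "g \<in> borel_measurable borel" by simp
  let ?g = "\<lambda>x. indicator \<Omega> x * g x"
  have "AE x in lebesgue. indicator \<Omega> x *\<^sub>R f x = ?g x"
    using AE_completion[OF g(2)] by eventually_elim (auto simp: indicator_def)
  then have "integrable lebesgue ?g"
    using F by (subst integrable_cong_AE[where g = "\<lambda>x. indicator \<Omega> x *\<^sub>R f x"])
      (auto intro!: measurable_completion)
  moreover have "?g \<in> borel_measurable lborel" by measurable
  ultimately have "integrable lborel ?g" by (simp add: integrable_completion)
  moreover have "AE x in lebesgue_on \<Omega>. ?g x = f x"
    unfolding AE_lebesgue_on_iff[OF \<Omega>] using g(2) by eventually_elim auto
  ultimately show ?thesis by (auto simp: represents_def intro!: exI[of _ ?g])
qed

lemma represents_integral: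
  assumes \<Omega>: "open \<Omega>" and r: "represents \<Omega> g f" and f: "integrable (lebesgue_on \<Omega>) f"
    and \<psi>: "test_fun U \<psi>"
  shows "(LINT x|lebesgue_on \<Omega>. f x * \<psi> x) = (LBINT x. g x * \<psi> x)"
    "integrable (lebesgue_on \<Omega>) (\<lambda>x. f x * \<psi> x)"
proof -
  have gi: "integrable lborel g" and g0: "\<And>x. x \<notin> \<Omega> \<Longrightarrow> g x = 0" and ae: "AE x in lebesgue_on \<Omega>. g x = f x"
    using r by (auto simp: represents_def)
  have [measurable]: "g \<in> borel_measurable borel" using gi by auto
  have \<psi>m[measurable]: "\<psi> \<in> borel_measurable borel" by (rule test_fun_borel[OF \<psi>])
  have "\<psi> \<in> borel_measurable lebesgue" by (rule measurable_completion) simp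
  then have [measurable]: "\<psi> \<in> borel_measurable (lebesgue_on \<Omega>)" by (rule measurable_restrict_space1)
  have [measurable]: "f \<in> borel_measurable (lebesgue_on \<Omega>)" using f by auto
  have gp: "(\<lambda>x. g x * \<psi> x) \<in> borel_measurable borel" "\<And>x. x \<notin> \<Omega> \<Longrightarrow> g x * \<psi> x = 0"
    using g0 by auto
  have i: "integrable (lebesgue_on \<Omega>) (\<lambda>x. g x * \<psi> x)"
    using integrable_mult_test_fun[OF \<psi> gi] by (simp add: integrable_lebesgue_on_iff_lborel[OF \<Omega> gp])
  have ae': "AE x in lebesgue_on \<Omega>. f x * \<psi> x = g x * \<psi> x" using ae by eventually_elim simp
  have m: "(\<lambda>x. f x * \<psi> x) \<in> borel_measurable (lebesgue_on \<Omega>)" by measurable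
  have "(LINT x|lebesgue_on \<Omega>. f x * \<psi> x) = (LINT x|lebesgue_on \<Omega>. g x * \<psi> x)"
    by (rule integral_cong_AE[OF m borel_measurable_integrable[OF i] ae'])
  then show "(LINT x|lebesgue_on \<Omega>. f x * \<psi> x) = (LBINT x. g x * \<psi> x)"
    by (simp add: integral_lebesgue_on_eq_lborel[OF \<Omega> gp])
  show "integrable (lebesgue_on \<Omega>) (\<lambda>x. f x * \<psi> x)"
    using integrable_cong_AE[OF m borel_measurable_integrable[OF i] ae'] i by simp
qed

lemma represents_self:
  assumes "open \<Omega>" "integrable lborel g" "\<And>x. x \<notin> \<Omega> \<Longrightarrow> g x = 0"
  shows "represents \<Omega> g g" "integrable (lebesgue_on \<Omega>) g"
  using assms integrable_lebesgue_on_iff_lborel[OF assms(1) _ assms(3)] by (auto simp: represents_def)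

lemma finite_measure_bounded_domain: "open \<Omega> \<Longrightarrow> bounded \<Omega> \<Longrightarrow> finite_measure (lebesgue_on \<Omega>)"
  by (intro finite_measure_lebesgue_on lmeasurable_open)

lemma integrable_const_domain:
  "open \<Omega> \<Longrightarrow> bounded \<Omega> \<Longrightarrow> integrable (lebesgue_on \<Omega>) (\<lambda>x. c :: 'b::{banach, second_countable_topology})"
  by (intro finite_measure.integrable_const finite_measure_bounded_domain)

lemma integral_const_mult_partial:
  fixes \<psi> :: "real^2 \<Rightarrow> real"
  assumes \<Omega>: "open \<Omega>" "bounded \<Omega>" and \<psi>: "test_fun \<Omega> \<psi>"
  shows "(LINT x|lebesgue_on \<Omega>. c * partial k \<psi> x) = 0"
proof -
  note t = test_fun_partial[OF \<psi>]
  have "(LINT x|lebesgue_on \<Omega>. partial k \<psi> x) = (LBINT x. partial k \<psi> x)"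
    by (rule integral_lebesgue_on_eq_lborel[OF \<Omega>(1)]) (auto intro: test_fun_borel[OF t] test_fun_eq_0[OF t])
  also have "\<dots> = 0" by (rule integral_partial_test_fun[OF \<psi>])
  finally show ?thesis by simp
qed

lemma integrable_vec_nth: "integrable M (\<lambda>x. f x :: 'b::euclidean_space^'n) \<Longrightarrow> integrable M (\<lambda>x. f x $ i)"
  by (rule integrable_bounded_linear[OF bounded_linear_vec_nth])

lemma integrable_vec_lambda:
  fixes f :: "'n::finite \<Rightarrow> 'a \<Rightarrow> 'b::euclidean_space"
  assumes "\<And>i. integrable M (f i)"
  shows "integrable M (\<lambda>x. \<chi> i. f i x)"
proof -
  have lin: "bounded_linear (axis i :: 'b \<Rightarrow> 'b^'n)" for i :: 'n
    by (intro linear_conv_bounded_linear[THEN iffD1] linearI) (auto simp: vec_eq_iff axis_def)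
  have "integrable M (\<lambda>x. \<Sum>i\<in>UNIV. axis i (f i x) :: 'b^'n)"
    using assms by (intro Bochner_Integration.integrable_sum integrable_bounded_linear[OF lin])
  also have "(\<lambda>x. \<Sum>i\<in>UNIV. axis i (f i x) :: 'b^'n) = (\<lambda>x. \<chi> i. f i x)"
    by (auto simp: fun_eq_iff vec_eq_iff axis_def if_distrib[of "\<lambda>x. x $ _"] cong: if_cong)
  finally show ?thesis .
qed

lemma is_weak_jacobianD:
  assumes "is_weak_jacobian \<Omega> \<phi> G"
  shows "integrable (lebesgue_on \<Omega>) G" "integrable (lebesgue_on \<Omega>) (\<lambda>x. G x $ i $ j)"
    "test_fun \<Omega> \<psi> \<Longrightarrow> (LINT x|lebesgue_on \<Omega>. \<phi> x $ i * partial j \<psi> x) = - (LINT x|lebesgue_on \<Omega>. G x $ i $ j * \<psi> x)"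
  using assms by (auto simp: is_weak_jacobian_def intro: integrable_vec_nth[OF integrable_vec_nth])

lemma weak_jacobian_unique:
  assumes \<Omega>: "open \<Omega>" "bounded \<Omega>" and G: "is_weak_jacobian \<Omega> \<phi> G" and H: "is_weak_jacobian \<Omega> \<phi> H"
  shows "AE x in lebesgue_on \<Omega>. G x = H x"
proof -
  have [measurable]: "\<Omega> \<in> sets borel" using \<Omega>(1) by simp
  have "AE x in lebesgue_on \<Omega>. G x $ i $ j = H x $ i $ j" for i j
  proof -
    obtain g where g: "represents \<Omega> g (\<lambda>x. G x $ i $ j)"
      using ex_represents[OF \<Omega>(1) is_weak_jacobianD(2)[OF G]] by blast
    obtain h where h: "represents \<Omega> h (\<lambda>x. H x $ i $ j)"
      using ex_represents[OF \<Omega>(1) is_weak_jacobianD(2)[OF H]] by blast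
    have gi: "integrable lborel g" and hi: "integrable lborel h" using g h by (auto simp: represents_def)
    then have w: "integrable lborel (\<lambda>x. g x - h x)" by simp
    have [measurable]: "g \<in> borel_measurable borel" "h \<in> borel_measurable borel" using gi hi by auto
    have le: "(LBINT x. indicator \<Omega> x * \<bar>g x - h x\<bar>) \<le> 0"
    proof (rule L1_norm_le_by_test_functions[OF \<Omega> w])
      fix \<psi> assume \<psi>: "test_fun \<Omega> \<psi>" "\<And>x. \<bar>\<psi> x\<bar> \<le> (1::real)"
      have "(LBINT x. (g x - h x) * \<psi> x) = (LBINT x. g x * \<psi> x) - (LBINT x. h x * \<psi> x)"
        using integrable_mult_test_fun[OF \<psi>(1) gi] integrable_mult_test_fun[OF \<psi>(1) hi]
        by (simp add: left_diff_distrib)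
      also have "\<dots> = 0"
        using represents_integral(1)[OF \<Omega>(1) g is_weak_jacobianD(2)[OF G] \<psi>(1)]
          represents_integral(1)[OF \<Omega>(1) h is_weak_jacobianD(2)[OF H] \<psi>(1)]
          is_weak_jacobianD(3)[OF G \<psi>(1), of i j] is_weak_jacobianD(3)[OF H \<psi>(1), of i j] by simp
      finally show "(LBINT x. (g x - h x) * \<psi> x) \<le> 0" by simp
    qed
    have i: "integrable lborel (\<lambda>x. indicator \<Omega> x * \<bar>g x - h x\<bar>)"
      using integrable_real_mult_indicator[of \<Omega> lborel "\<lambda>x. \<bar>g x - h x\<bar>"] w by (simp add: mult.commute)
    have "(LBINT x. indicator \<Omega> x * \<bar>g x - h x\<bar>) \<ge> 0"
      by (intro Bochner_Integration.integral_nonneg) simp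
    then have eq: "(LBINT x. indicator \<Omega> x * \<bar>g x - h x\<bar>) = 0" using le by linarith
    have nn: "AE x in lborel. 0 \<le> indicator \<Omega> x * \<bar>g x - h x\<bar>" by simp
    have "AE x in lborel. indicator \<Omega> x * \<bar>g x - h x\<bar> = 0"
      using integral_nonneg_eq_0_iff_AE[OF i nn] eq by blast
    then have "AE x in lebesgue_on \<Omega>. g x = h x"
      unfolding AE_lebesgue_on_iff[OF \<Omega>(1)] by eventually_elim auto
    moreover have "AE x in lebesgue_on \<Omega>. g x = G x $ i $ j" "AE x in lebesgue_on \<Omega>. h x = H x $ i $ j"
      using g h by (auto simp: represents_def)
    ultimately show ?thesis by eventually_elim simp
  qed
  then have "AE x in lebesgue_on \<Omega>. \<forall>p\<in>UNIV. G x $ fst p $ snd p = H x $ fst p $ snd p"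
    by (intro AE_finite_allI) auto
  then show ?thesis by eventually_elim (auto simp: vec_eq_iff)
qed

lemma is_weak_jacobian_weak_jacobian: "\<phi> \<in> W11 \<Omega> K \<Longrightarrow> is_weak_jacobian \<Omega> \<phi> (weak_jacobian \<Omega> \<phi>)"
  unfolding W11_def weak_jacobian_def using someI_ex[of "is_weak_jacobian \<Omega> \<phi>"] by blast

lemma test_fun_component:
  assumes "test_fun \<Omega> (p :: real^2 \<Rightarrow> real^2^2^2)"
  shows "test_fun \<Omega> (\<lambda>x. p x $ i $ j $ k)"
    "partial l (\<lambda>x. p x $ i $ j $ k) = (\<lambda>x. partial l p x $ i $ j $ k)"
proof -
  have lin: "bounded_linear (\<lambda>t :: real^2^2^2. t $ i $ j $ k)"
    by (intro bounded_linear_compose[OF bounded_linear_vec_nth] bounded_linear_vec_nth)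
  show "test_fun \<Omega> (\<lambda>x. p x $ i $ j $ k)" by (rule test_fun_linear_compose[OF lin assms])
  show "partial l (\<lambda>x. p x $ i $ j $ k) = (\<lambda>x. partial l p x $ i $ j $ k)"
    by (rule test_fun_partial_linear_compose[OF lin assms])
qed

text \<open>The constant drops out because partial derivatives of test functions have integral zero.\<close>

lemma TV_integrand:
  assumes \<Omega>: "open \<Omega>" "bounded \<Omega>" and G: "integrable (lebesgue_on \<Omega>) (G :: real^2 \<Rightarrow> real^2^2)"
    and p: "test_fun \<Omega> p"
  shows "(LINT x|lebesgue_on \<Omega>. (\<Sum>i\<in>UNIV. \<Sum>j\<in>UNIV. \<Sum>k\<in>UNIV. (G x - c) $ i $ j * partial k p x $ i $ j $ k))
    = (\<Sum>i\<in>UNIV. \<Sum>j\<in>UNIV. \<Sum>k\<in>UNIV. LINT x|lebesgue_on \<Omega>. G x $ i $ j * partial k (\<lambda>x. p x $ i $ j $ k) x)"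
proof -
  note t = test_fun_component[OF p]
  have iG: "integrable (lebesgue_on \<Omega>) (\<lambda>x. G x $ i $ j)" for i j by (intro integrable_vec_nth G)
  have i1: "integrable (lebesgue_on \<Omega>) (\<lambda>x. G x $ i $ j * partial k p x $ i $ j $ k)" for i j k
    using ex_represents[OF \<Omega>(1) iG[of i j]] represents_integral(2)[OF \<Omega>(1) _ iG[of i j] test_fun_partial[OF t(1)[of i j k], of k]]
    by (auto simp: t(2))
  have i2: "integrable (lebesgue_on \<Omega>) (\<lambda>x. c $ i $ j * partial k p x $ i $ j $ k)" for i j k
    using ex_represents[OF \<Omega>(1) integrable_const_domain[OF \<Omega>]]
      represents_integral(2)[OF \<Omega>(1) _ integrable_const_domain[OF \<Omega>] test_fun_partial[OF t(1)[of i j k], of k]]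
    by (auto simp: t(2))
  have z: "(LINT x|lebesgue_on \<Omega>. c $ i $ j * partial k p x $ i $ j $ k) = 0" for i j k
    using integral_const_mult_partial[OF \<Omega> t(1)[of i j k], of "c $ i $ j" k] by (simp add: t(2))
  have i3: "integrable (lebesgue_on \<Omega>) (\<lambda>x. (G x - c) $ i $ j * partial k p x $ i $ j $ k)" for i j k
    using i1 i2 by (simp add: left_diff_distrib)
  have "(LINT x|lebesgue_on \<Omega>. (\<Sum>i\<in>UNIV. \<Sum>j\<in>UNIV. \<Sum>k\<in>UNIV. (G x - c) $ i $ j * partial k p x $ i $ j $ k))
      = (\<Sum>i\<in>UNIV. \<Sum>j\<in>UNIV. \<Sum>k\<in>UNIV. LINT x|lebesgue_on \<Omega>. (G x - c) $ i $ j * partial k p x $ i $ j $ k)"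
    using i3 by (simp only: Bochner_Integration.integral_sum Bochner_Integration.integrable_sum)
  also have "\<dots> = (\<Sum>i\<in>UNIV. \<Sum>j\<in>UNIV. \<Sum>k\<in>UNIV. LINT x|lebesgue_on \<Omega>. G x $ i $ j * partial k p x $ i $ j $ k)"
    using i1 i2 z by (intro sum.cong) (simp_all add: left_diff_distrib)
  finally show ?thesis by (simp only: t(2))
qed

lemma TV_eq:
  assumes \<Omega>: "open \<Omega>" "bounded \<Omega>" and G: "integrable (lebesgue_on \<Omega>) (G :: real^2 \<Rightarrow> real^2^2)"
  shows "TV \<Omega> (\<lambda>x. G x - c) = (SUP p \<in> {p :: real^2 \<Rightarrow> real^2^2^2. test_fun \<Omega> p \<and> (\<forall>x. norm (p x) \<le> 1)}.
    ennreal (\<Sum>i\<in>UNIV. \<Sum>j\<in>UNIV. \<Sum>k\<in>UNIV. LINT x|lebesgue_on \<Omega>. G x $ i $ j * partial k (\<lambda>x. p x $ i $ j $ k) x))"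
  unfolding TV_def by (intro SUP_cong refl) (simp only: mem_Collect_eq TV_integrand[OF \<Omega> G])

lemma TV_diff_const:
  assumes \<Omega>: "open \<Omega>" "bounded \<Omega>" and G: "integrable (lebesgue_on \<Omega>) (G :: real^2 \<Rightarrow> real^2^2)"
  shows "TV \<Omega> (\<lambda>x. G x - c) = TV \<Omega> G"
  using TV_eq[OF assms, of c] TV_eq[OF assms, of 0] by simp

text \<open>Test the matrix field with a tensor that has \<open>\<psi>\<close> as its only nonzero entry.\<close>

lemma TV_component_bound:
  assumes \<Omega>: "open \<Omega>" "bounded \<Omega>" and G: "integrable (lebesgue_on \<Omega>) (G :: real^2 \<Rightarrow> real^2^2)"
    and TV: "TV \<Omega> G \<le> ennreal c" "c \<ge> 0" and \<psi>: "test_fun \<Omega> \<psi>" "\<And>x. \<bar>\<psi> x\<bar> \<le> 1"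
  shows "(LINT x|lebesgue_on \<Omega>. G x $ i $ j * partial k \<psi> x) \<le> c"
proof -
  let ?E = "axis i (axis j (axis k 1)) :: real^2^2^2"
  let ?p = "\<lambda>x. \<psi> x *\<^sub>R ?E"
  have lin: "bounded_linear (\<lambda>t. t *\<^sub>R ?E)" by (rule bounded_linear_scaleR_left)
  have p: "test_fun \<Omega> ?p" by (rule test_fun_linear_compose[OF lin \<psi>(1)])
  have n: "norm ?E = 1" by (simp add: norm_eq_1 inner_axis')
  have c: "(\<lambda>x. ?p x $ i' $ j' $ k') = (\<lambda>x. if i' = i \<and> j' = j \<and> k' = k then \<psi> x else 0)" for i' j' k'
    by (auto simp: fun_eq_iff axis_def)
  have z: "partial k' (\<lambda>x. 0::real) x = 0" for k' and x :: "real^2"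
    by (auto intro!: partial_eqI derivative_eq_intros)
  let ?I = "\<lambda>i' j' k'. LINT x|lebesgue_on \<Omega>. G x $ i' $ j' * partial k' (\<lambda>x. ?p x $ i' $ j' $ k') x"
  have I: "?I i' j' k' = (if k' = k then if j' = j then if i' = i then LINT x|lebesgue_on \<Omega>. G x $ i $ j * partial k \<psi> x else 0 else 0 else 0)" for i' j' k'
    unfolding c by (auto simp: z)
  have "(LINT x|lebesgue_on \<Omega>. G x $ i $ j * partial k \<psi> x) = (\<Sum>i\<in>UNIV. \<Sum>j\<in>UNIV. \<Sum>k\<in>UNIV. ?I i j k)"
    unfolding I by simp
  also have "ennreal \<dots> \<le> TV \<Omega> (\<lambda>x. G x - 0)"
    unfolding TV_eq[OF \<Omega> G, of 0] using p n \<psi>(2) by (intro SUP_upper) simp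
  also have "\<dots> \<le> ennreal c" using TV(1) by simp
  finally show ?thesis using ennreal_le_iff[OF TV(2)] by blast
qed

text \<open>A supremum of functionals that are continuous under the convergence assumed.\<close>

lemma TV_lower_semicontinuous:
  assumes \<Omega>: "open \<Omega>" "bounded \<Omega>"
    and G: "\<And>n. integrable (lebesgue_on \<Omega>) (G n :: real^2 \<Rightarrow> real^2^2)" "integrable (lebesgue_on \<Omega>) H"
    and conv: "\<And>i j \<psi>. test_fun \<Omega> \<psi> \<Longrightarrow>
      (\<lambda>n. LINT x|lebesgue_on \<Omega>. G n x $ i $ j * \<psi> x) \<longlonglongrightarrow> (LINT x|lebesgue_on \<Omega>. H x $ i $ j * \<psi> x)"
    and t: "(\<lambda>n. TV \<Omega> (\<lambda>x. G n x - c)) \<longlonglongrightarrow> t"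
  shows "TV \<Omega> (\<lambda>x. H x - c) \<le> t"
  unfolding TV_eq[OF \<Omega> G(2)]
proof (rule SUP_least)
  fix p :: "real^2 \<Rightarrow> real^2^2^2" assume p: "p \<in> {p. test_fun \<Omega> p \<and> (\<forall>x. norm (p x) \<le> 1)}"
  let ?I = "\<lambda>G. \<Sum>i\<in>UNIV. \<Sum>j\<in>UNIV. \<Sum>k\<in>UNIV. LINT x|lebesgue_on \<Omega>. G x $ i $ j * partial k (\<lambda>x. p x $ i $ j $ k) x"
  have "(\<lambda>n. ?I (G n)) \<longlonglongrightarrow> ?I H"
    using p by (intro tendsto_sum conv test_fun_partial test_fun_component(1)) auto
  then have "(\<lambda>n. ennreal (?I (G n))) \<longlonglongrightarrow> ennreal (?I H)" by (rule tendsto_ennrealI)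
  moreover have "ennreal (?I (G n)) \<le> TV \<Omega> (\<lambda>x. G n x - c)" for n
    unfolding TV_eq[OF \<Omega> G(1)] using p by (intro SUP_upper)
  ultimately show "ennreal (?I H) \<le> t"
    using t by (intro LIMSEQ_le) auto
qed

section \<open>Limits of maps with bounded second variation\<close>

text \<open>The two components of \<open>\<phi>\<close> (index \<open>None\<close>) and the four entries of \<open>G\<close> (index \<open>Some j\<close>) form one finite
  family, so that a single subsequence can be extracted for all of them.\<close>

definition component :: "(real^2 \<Rightarrow> real^2) \<Rightarrow> (real^2 \<Rightarrow> real^2^2) \<Rightarrow> 2 \<times> 2 option \<Rightarrow> real^2 \<Rightarrow> real" where
  "component \<phi> G q x = (case snd q of None \<Rightarrow> \<phi> x $ fst q | Some j \<Rightarrow> G x $ fst q $ j)"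

lemma component_simps [simp]:
  "component \<phi> G (i, None) x = \<phi> x $ i" "component \<phi> G (i, Some j) x = G x $ i $ j"
  by (simp_all add: component_def)

lemma tv_bounded_mono: "tv_bounded \<Omega> C w \<Longrightarrow> C \<le> D \<Longrightarrow> tv_bounded \<Omega> D w"
  unfolding tv_bounded_def by (meson order_trans)

text \<open>The entries of the Jacobian have variation at most \<open>c\<close> and are weak derivatives of bounded functions,
  so the Lipschitz domain bounds their norms by some \<open>B0\<close>. Then \<open>B0\<close> also bounds the variation of the
  components of \<open>\<phi>\<close>.\<close>

lemma BV2_uniform_bounds:
  assumes \<Omega>: "bounded_lipschitz_domain \<Omega>" and K: "bounded K" and c: "c \<ge> 0"
  shows "\<exists>C B. \<forall>\<phi>\<in>BV2 \<Omega> K. TV \<Omega> (weak_jacobian \<Omega> \<phi>) \<le> ennreal c \<longrightarrow>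
    (\<forall>q. \<exists>w. represents \<Omega> w (component \<phi> (weak_jacobian \<Omega> \<phi>) q) \<and> tv_bounded \<Omega> C w \<and>
      (LBINT x. \<bar>w x\<bar>) \<le> B)"
proof -
  have op: "open \<Omega>" and bd: "bounded \<Omega>" using \<Omega> by (auto simp: bounded_lipschitz_domain_def)
  have [measurable]: "\<Omega> \<in> sets borel" using op by simp
  obtain M where M: "M > 0" "\<And>y. y \<in> K \<Longrightarrow> norm y \<le> M" using K bounded_pos by metis
  obtain B0 where B0: "\<And>w. gradient_component \<Omega> c M w \<Longrightarrow> (LBINT x. \<bar>w x\<bar>) \<le> B0"
    using lipschitz_domain_L1_bound[OF \<Omega>, of M c] M(1) by auto
  define C where "C = max c B0"
  define B where "B = max B0 (M * measure lborel \<Omega>)"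
  show ?thesis
  proof (rule exI[of _ C], rule exI[of _ B], intro ballI impI allI)
    fix \<phi> assume \<phi>: "\<phi> \<in> BV2 \<Omega> K" and TV: "TV \<Omega> (weak_jacobian \<Omega> \<phi>) \<le> ennreal c"
    let ?G = "weak_jacobian \<Omega> \<phi>"
    have W: "\<phi> \<in> W11 \<Omega> K" using \<phi> by (simp add: BV2_def)
    note J = is_weak_jacobianD[OF is_weak_jacobian_weak_jacobian[OF W]]
    have \<phi>i: "integrable (lebesgue_on \<Omega>) (\<lambda>x. \<phi> x $ i)" for i
      using W by (intro integrable_vec_nth) (simp add: W11_def)
    have "AE x in lebesgue_on \<Omega>. \<phi> x \<in> K" using W by (simp add: W11_def)
    then have \<phi>M: "AE x in lebesgue_on \<Omega>. \<bar>\<phi> x $ i\<bar> \<le> M" for i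
      by eventually_elim (metis M(2) component_le_norm_cart order_trans)
    have f_bound: "AE x in lborel. \<bar>f x\<bar> \<le> M * indicator \<Omega> x" if f: "represents \<Omega> f (\<lambda>x. \<phi> x $ i)" for f i
    proof -
      have fe: "AE x in lebesgue_on \<Omega>. f x = \<phi> x $ i" and f0: "\<And>x. x \<notin> \<Omega> \<Longrightarrow> f x = 0"
        using f by (auto simp: represents_def)
      have "AE x in lebesgue_on \<Omega>. \<bar>f x\<bar> \<le> M" using fe \<phi>M[of i] by eventually_elim simp
      then have "AE x in lborel. x \<in> \<Omega> \<longrightarrow> \<bar>f x\<bar> \<le> M" by (simp add: AE_lebesgue_on_iff[OF op])
      then show ?thesis by eventually_elim (use f0 in \<open>auto simp: indicator_def\<close>)
    qed
    have grad: "gradient_component \<Omega> c M g" if g: "represents \<Omega> g (\<lambda>x. ?G x $ i $ j)" for g i j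
      unfolding gradient_component_def
    proof (intro conjI exI[of _ j] allI impI)
      have gi: "integrable lborel g" "\<And>x. x \<notin> \<Omega> \<Longrightarrow> g x = 0" using g by (auto simp: represents_def)
      show "tv_bounded \<Omega> c g"
        unfolding tv_bounded_def
      proof (intro conjI allI impI gi)
        fix k \<psi> assume \<psi>: "test_fun \<Omega> \<psi>" "\<forall>x. \<bar>\<psi> x\<bar> \<le> (1::real)"
        have "(LBINT x. g x * partial k \<psi> x) = (LINT x|lebesgue_on \<Omega>. ?G x $ i $ j * partial k \<psi> x)"
          using represents_integral(1)[OF op g J(2) test_fun_partial[OF \<psi>(1)]] by simp
        also have "\<dots> \<le> c" using TV_component_bound[OF op bd J(1) TV c \<psi>(1)] \<psi>(2) by blast
        finally show "(LBINT x. g x * partial k \<psi> x) \<le> c" .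
      qed
      fix \<psi> :: "real^2 \<Rightarrow> real" assume \<psi>: "test_fun \<Omega> \<psi>"
      obtain f where f: "represents \<Omega> f (\<lambda>x. \<phi> x $ i)" using ex_represents[OF op \<phi>i] by blast
      have fi: "integrable lborel f" using f by (simp add: represents_def)
      note t = test_fun_partial[OF \<psi>]
      have "(LBINT x. g x * \<psi> x) = - (LINT x|lebesgue_on \<Omega>. \<phi> x $ i * partial j \<psi> x)"
        using represents_integral(1)[OF op g J(2) \<psi>] J(3)[OF \<psi>, of i j] by simp
      also have "(LINT x|lebesgue_on \<Omega>. \<phi> x $ i * partial j \<psi> x) = (LBINT x. f x * partial j \<psi> x)"
        by (rule represents_integral(1)[OF op f \<phi>i t])
      also have "\<bar>- \<dots>\<bar> \<le> (LBINT x. \<bar>f x * partial j \<psi> x\<bar>)" by simp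
      also have "\<dots> \<le> (LBINT x. M * \<bar>partial j \<psi> x\<bar>)"
      proof (rule integral_mono_AE)
        show "AE x in lborel. \<bar>f x * partial j \<psi> x\<bar> \<le> M * \<bar>partial j \<psi> x\<bar>"
          using f_bound[OF f]
        proof eventually_elim
          case (elim x)
          have "M * indicator \<Omega> x \<le> M" using M(1) by (simp add: indicator_def)
          with elim show ?case unfolding abs_mult by (intro mult_right_mono) auto
        qed
      qed (use integrable_mult_test_fun[OF t fi] test_fun_integrable[OF t] in \<open>auto simp del: abs_mult\<close>)
      finally show "\<bar>LBINT x. g x * \<psi> x\<bar> \<le> M * (LBINT x. \<bar>partial j \<psi> x\<bar>)" by simp
    qed
    fix q :: "2 \<times> 2 option"
    obtain i o' where q: "q = (i, o')" by (cases q)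
    show "\<exists>w. represents \<Omega> w (component \<phi> ?G q) \<and> tv_bounded \<Omega> C w \<and> (LBINT x. \<bar>w x\<bar>) \<le> B"
    proof (cases o')
      case (Some j)
      obtain g where g: "represents \<Omega> g (\<lambda>x. ?G x $ i $ j)" using ex_represents[OF op J(2)] by blast
      note gg = grad[OF g]
      have "tv_bounded \<Omega> C g" using gg tv_bounded_mono by (auto simp: gradient_component_def C_def)
      moreover have "(LBINT x. \<bar>g x\<bar>) \<le> B" using B0[OF gg] by (simp add: B_def)
      moreover have "component \<phi> ?G q = (\<lambda>x. ?G x $ i $ j)" by (simp add: q Some fun_eq_iff)
      ultimately show ?thesis using g by auto
    next
      case None
      obtain f where f: "represents \<Omega> f (\<lambda>x. \<phi> x $ i)" using ex_represents[OF op \<phi>i] by blast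
      have fi: "integrable lborel f" "\<And>x. x \<notin> \<Omega> \<Longrightarrow> f x = 0" using f by (auto simp: represents_def)
      have "tv_bounded \<Omega> C f"
        unfolding tv_bounded_def
      proof (intro conjI allI impI fi)
        fix k \<psi> assume \<psi>: "test_fun \<Omega> \<psi>" "\<forall>x. \<bar>\<psi> x\<bar> \<le> (1::real)"
        obtain g where g: "represents \<Omega> g (\<lambda>x. ?G x $ i $ k)" using ex_represents[OF op J(2)] by blast
        have gi: "integrable lborel g" using g by (simp add: represents_def)
        have "(LBINT x. f x * partial k \<psi> x) = (LINT x|lebesgue_on \<Omega>. \<phi> x $ i * partial k \<psi> x)"
          using represents_integral(1)[OF op f \<phi>i test_fun_partial[OF \<psi>(1)]] by simp
        also have "\<dots> = - (LBINT x. g x * \<psi> x)"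
          using represents_integral(1)[OF op g J(2) \<psi>(1)] J(3)[OF \<psi>(1), of i k] by simp
        also have "\<dots> \<le> \<bar>LBINT x. g x * \<psi> x\<bar>" by simp
        also have "\<dots> \<le> 1 * (LBINT x. \<bar>g x\<bar>)"
          by (rule abs_integral_mult_le[OF gi test_fun_borel[OF \<psi>(1)]]) (use \<psi>(2) in blast)
        also have "\<dots> \<le> C" using B0[OF grad[OF g]] by (simp add: C_def)
        finally show "(LBINT x. f x * partial k \<psi> x) \<le> C" .
      qed
      moreover have "(LBINT x. \<bar>f x\<bar>) \<le> B"
      proof -
        have fin: "emeasure lborel \<Omega> < \<infinity>" by (rule emeasure_bounded_finite[OF bd])
        then have ii: "integrable lborel (\<lambda>x. M * indicator \<Omega> x)"
          by (intro integrable_mult_right integrable_real_indicator) auto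
        have "(LBINT x. \<bar>f x\<bar>) \<le> (LBINT x. M * indicator \<Omega> x)"
          by (rule integral_mono_AE[OF integrable_abs[OF fi(1)] ii f_bound[OF f]])
        also have "\<dots> = M * measure lborel \<Omega>" by simp
        also have "\<dots> \<le> B" by (simp add: B_def)
        finally show ?thesis .
      qed
      moreover have "component \<phi> ?G q = (\<lambda>x. \<phi> x $ i)" by (simp add: q None fun_eq_iff)
      ultimately show ?thesis using f by auto
    qed
  qed
qed

lemma tv_bounded_compactness_family:
  fixes W :: "nat \<Rightarrow> 'q::finite \<Rightarrow> real^2 \<Rightarrow> real"
  assumes \<Omega>: "open \<Omega>" "bounded \<Omega>"
    and W: "\<And>n q. tv_bounded \<Omega> C (W n q)" "\<And>n q. (LBINT x. \<bar>W n q x\<bar>) \<le> B"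
  obtains r u where "strict_mono (r::nat\<Rightarrow>nat)" "\<And>q. integrable lborel (u q)" "\<And>q x. x \<notin> \<Omega> \<Longrightarrow> u q x = 0"
    "\<And>q. AE x in lborel. (\<lambda>n. W (r n) q x) \<longlonglongrightarrow> u q x"
    "\<And>q \<psi>. test_fun \<Omega> \<psi> \<Longrightarrow> (\<lambda>n. LBINT x. W (r n) q x * \<psi> x) \<longlonglongrightarrow> (LBINT x. u q x * \<psi> x)"
proof -
  define P where "P = (\<lambda>(r::nat\<Rightarrow>nat) q u. integrable lborel u \<and> (\<forall>x. x \<notin> \<Omega> \<longrightarrow> u x = 0) \<and>
    (AE x in lborel. (\<lambda>n. W (r n) q x) \<longlonglongrightarrow> u x) \<and>
    (\<forall>\<psi>. test_fun \<Omega> \<psi> \<longrightarrow> (\<lambda>n. LBINT x. W (r n) q x * \<psi> x) \<longlonglongrightarrow> (LBINT x. u x * \<psi> x)))"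
  have sub: "P (r \<circ> s) q u" if "P r q u" and s: "strict_mono s" for r s q u
  proof -
    have "AE x in lborel. (\<lambda>n. W (r n) q x) \<longlonglongrightarrow> u x" using \<open>P r q u\<close> by (simp add: P_def)
    then have "AE x in lborel. (\<lambda>n. W ((r \<circ> s) n) q x) \<longlonglongrightarrow> u x"
    proof eventually_elim
      case (elim x)
      from LIMSEQ_subseq_LIMSEQ[OF elim s] show ?case by (simp add: o_def)
    qed
    moreover have "(\<lambda>n. LBINT x. W ((r \<circ> s) n) q x * \<psi> x) \<longlonglongrightarrow> (LBINT x. u x * \<psi> x)" if "test_fun \<Omega> \<psi>" for \<psi>
    proof -
      have "(\<lambda>n. LBINT x. W (r n) q x * \<psi> x) \<longlonglongrightarrow> (LBINT x. u x * \<psi> x)"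
        using \<open>P r q u\<close> that by (simp add: P_def)
      from LIMSEQ_subseq_LIMSEQ[OF this s] show ?thesis by (simp add: o_def)
    qed
    ultimately show ?thesis using \<open>P r q u\<close> by (simp add: P_def)
  qed
  have "\<exists>r. strict_mono r \<and> (\<forall>q\<in>Q. \<exists>u. P r q u)" if "finite Q" for Q :: "'q set"
    using that
  proof (induction Q rule: finite_induct)
    case empty
    show ?case by (intro exI[of _ "\<lambda>n. n"]) (simp add: strict_mono_def)
  next
    case (insert q Q)
    then obtain r where r: "strict_mono r" "\<forall>q\<in>Q. \<exists>u. P r q u" by blast
    obtain s u where s: "strict_mono s" "P (r \<circ> s) q u"
      using tv_bounded_compactness[OF \<Omega>, of C "\<lambda>n. W (r n) q" B] W by (auto simp: P_def)
    have "strict_mono (r \<circ> s)" using r(1) s(1) by (rule strict_mono_o)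
    moreover have "\<forall>q\<in>insert q Q. \<exists>u. P (r \<circ> s) q u" using r(2) s sub by blast
    ultimately show ?case by blast
  qed
  from this[of UNIV] obtain r where r: "strict_mono r" "\<forall>q. \<exists>u. P r q u" by auto
  then obtain u where u: "P r q (u q)" for q by metis
  show ?thesis
    by (rule that[OF r(1), of u]) (use u in \<open>simp_all add: P_def\<close>)
qed

text \<open>The limits of the components inherit the defining identity of a weak Jacobian from the convergence
  against test functions; \<open>weak_jacobian \<Omega> \<phi>0\<close> agrees with the limit of the Jacobians almost everywhere.\<close>

lemma weak_jacobian_limit:
  assumes \<Omega>: "bounded_lipschitz_domain \<Omega>" and K: "bounded K" "closed K" and c: "c \<ge> 0"
    and \<phi>: "\<And>n. \<phi> n \<in> BV2 \<Omega> K" "\<And>n. TV \<Omega> (weak_jacobian \<Omega> (\<phi> n)) \<le> ennreal c"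
  shows "\<exists>r \<phi>0. strict_mono (r::nat\<Rightarrow>nat) \<and> \<phi>0 \<in> W11 \<Omega> K \<and>
    (AE x in lebesgue_on \<Omega>. (\<lambda>n. \<phi> (r n) x) \<longlonglongrightarrow> \<phi>0 x) \<and>
    (AE x in lebesgue_on \<Omega>. (\<lambda>n. weak_jacobian \<Omega> (\<phi> (r n)) x) \<longlonglongrightarrow> weak_jacobian \<Omega> \<phi>0 x) \<and>
    (\<forall>i j \<psi>. test_fun \<Omega> \<psi> \<longrightarrow>
      (\<lambda>n. LINT x|lebesgue_on \<Omega>. weak_jacobian \<Omega> (\<phi> (r n)) x $ i $ j * \<psi> x)
        \<longlonglongrightarrow> (LINT x|lebesgue_on \<Omega>. weak_jacobian \<Omega> \<phi>0 x $ i $ j * \<psi> x))"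
proof -
  have op: "open \<Omega>" and bd: "bounded \<Omega>" using \<Omega> by (auto simp: bounded_lipschitz_domain_def)
  let ?G = "\<lambda>n. weak_jacobian \<Omega> (\<phi> n)"
  have W11: "\<phi> n \<in> W11 \<Omega> K" for n using \<phi>(1) by (simp add: BV2_def)
  note J = is_weak_jacobianD[OF is_weak_jacobian_weak_jacobian[OF W11]]
  have \<phi>i: "integrable (lebesgue_on \<Omega>) (\<lambda>x. \<phi> n x $ i)" for n i
    using W11[of n] by (intro integrable_vec_nth) (simp add: W11_def)
  have comp_i: "integrable (lebesgue_on \<Omega>) (component (\<phi> n) (?G n) q)" for n q
  proof -
    obtain i o' where q: "q = (i, o')" by (cases q)
    show ?thesis
      using \<phi>i[of n i] J(2)[of n i] by (cases o') (simp_all add: q component_def[abs_def])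
  qed
  obtain C B where "\<forall>\<phi>\<in>BV2 \<Omega> K. TV \<Omega> (weak_jacobian \<Omega> \<phi>) \<le> ennreal c \<longrightarrow>
    (\<forall>q. \<exists>w. represents \<Omega> w (component \<phi> (weak_jacobian \<Omega> \<phi>) q) \<and> tv_bounded \<Omega> C w \<and>
      (LBINT x. \<bar>w x\<bar>) \<le> B)"
    using BV2_uniform_bounds[OF \<Omega> K(1) c] by blast
  then have ex: "\<exists>w. represents \<Omega> w (component (\<phi> n) (?G n) q) \<and> tv_bounded \<Omega> C w \<and>
      (LBINT x. \<bar>w x\<bar>) \<le> B" for n q using \<phi> by blast
  define W where "W = (\<lambda>n q. SOME w. represents \<Omega> w (component (\<phi> n) (?G n) q) \<and> tv_bounded \<Omega> C w \<and>
      (LBINT x. \<bar>w x\<bar>) \<le> B)"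
  have W: "represents \<Omega> (W n q) (component (\<phi> n) (?G n) q)" "tv_bounded \<Omega> C (W n q)"
    "(LBINT x. \<bar>W n q x\<bar>) \<le> B" for n q
    using someI_ex[OF ex[of n q]] unfolding W_def by blast+
  obtain r u where r: "strict_mono (r::nat\<Rightarrow>nat)" and u: "\<And>q. integrable lborel (u q)" "\<And>q x. x \<notin> \<Omega> \<Longrightarrow> u q x = 0"
    "\<And>q. AE x in lborel. (\<lambda>n. W (r n) q x) \<longlonglongrightarrow> u q x"
    "\<And>q \<psi>. test_fun \<Omega> \<psi> \<Longrightarrow> (\<lambda>n. LBINT x. W (r n) q x * \<psi> x) \<longlonglongrightarrow> (LBINT x. u q x * \<psi> x)"
    by (rule tv_bounded_compactness_family[where W = W and C = C and B = B, OF op bd W(2,3)]) (rule that; assumption)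
  have ru: "represents \<Omega> (u q) (u q)" "integrable (lebesgue_on \<Omega>) (u q)" for q
    by (rule represents_self[OF op u(1)], erule u(2))+
  have weak: "(\<lambda>n. LINT x|lebesgue_on \<Omega>. component (\<phi> (r n)) (?G (r n)) q x * \<psi> x)
      \<longlonglongrightarrow> (LINT x|lebesgue_on \<Omega>. u q x * \<psi> x)" if \<psi>: "test_fun \<Omega> \<psi>" for q \<psi>
    using u(4)[OF \<psi>, of q] represents_integral(1)[OF op W(1) comp_i \<psi>]
      represents_integral(1)[OF op ru(1) ru(2) \<psi>] by simp
  have ae: "AE x in lebesgue_on \<Omega>. \<forall>q\<in>UNIV. (\<lambda>n. component (\<phi> (r n)) (?G (r n)) q x) \<longlonglongrightarrow> u q x"
  proof (rule AE_finite_allI)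
    fix q
    have "AE x in lebesgue_on \<Omega>. \<forall>n. W n q x = component (\<phi> n) (?G n) q x"
      using W(1) by (simp add: AE_all_countable represents_def)
    moreover have "AE x in lebesgue_on \<Omega>. (\<lambda>n. W (r n) q x) \<longlonglongrightarrow> u q x"
      unfolding AE_lebesgue_on_iff[OF op] using u(3)[of q] by eventually_elim simp
    ultimately show "AE x in lebesgue_on \<Omega>. (\<lambda>n. component (\<phi> (r n)) (?G (r n)) q x) \<longlonglongrightarrow> u q x"
      by eventually_elim simp
  qed simp
  define \<phi>0 where "\<phi>0 = (\<lambda>x. (\<chi> i. u (i, None) x) :: real^2)"
  define G0 where "G0 = (\<lambda>x. (\<chi> i j. u (i, Some j) x) :: real^2^2)"
  have ae\<phi>: "AE x in lebesgue_on \<Omega>. (\<lambda>n. \<phi> (r n) x) \<longlonglongrightarrow> \<phi>0 x"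
    using ae
  proof eventually_elim
    case (elim x)
    show ?case
    proof (rule vec_tendstoI)
      fix i from elim have "(\<lambda>n. component (\<phi> (r n)) (?G (r n)) (i, None) x) \<longlonglongrightarrow> u (i, None) x" by blast
      then show "(\<lambda>n. \<phi> (r n) x $ i) \<longlonglongrightarrow> \<phi>0 x $ i" by (simp add: \<phi>0_def)
    qed
  qed
  have aeG: "AE x in lebesgue_on \<Omega>. (\<lambda>n. ?G (r n) x) \<longlonglongrightarrow> G0 x"
    using ae
  proof eventually_elim
    case (elim x)
    show ?case
    proof (intro vec_tendstoI)
      fix i j from elim have "(\<lambda>n. component (\<phi> (r n)) (?G (r n)) (i, Some j) x) \<longlonglongrightarrow> u (i, Some j) x" by blast
      then show "(\<lambda>n. ?G (r n) x $ i $ j) \<longlonglongrightarrow> G0 x $ i $ j" by (simp add: G0_def)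
    qed
  qed
  have JG0: "is_weak_jacobian \<Omega> \<phi>0 G0"
    unfolding is_weak_jacobian_def
  proof (intro conjI allI impI)
    show "integrable (lebesgue_on \<Omega>) G0" unfolding G0_def by (intro integrable_vec_lambda ru(2))
    fix \<psi> :: "real^2 \<Rightarrow> real" and i j assume \<psi>: "test_fun \<Omega> \<psi>"
    have "(\<lambda>n. LINT x|lebesgue_on \<Omega>. \<phi> (r n) x $ i * partial j \<psi> x) \<longlonglongrightarrow> (LINT x|lebesgue_on \<Omega>. \<phi>0 x $ i * partial j \<psi> x)"
      using weak[OF test_fun_partial[OF \<psi>], of "(i, None)"] by (simp add: \<phi>0_def)
    moreover have "(\<lambda>n. - (LINT x|lebesgue_on \<Omega>. ?G (r n) x $ i $ j * \<psi> x)) \<longlonglongrightarrow> - (LINT x|lebesgue_on \<Omega>. G0 x $ i $ j * \<psi> x)"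
      using tendsto_minus[OF weak[OF \<psi>, of "(i, Some j)"]] by (simp add: G0_def)
    ultimately show "(LINT x|lebesgue_on \<Omega>. \<phi>0 x $ i * partial j \<psi> x) = - (LINT x|lebesgue_on \<Omega>. G0 x $ i $ j * \<psi> x)"
      unfolding J(3)[OF \<psi>] by (rule LIMSEQ_unique)
  qed
  have "AE x in lebesgue_on \<Omega>. \<forall>n. \<phi> n x \<in> K"
    using W11 by (simp add: AE_all_countable W11_def)
  then have "AE x in lebesgue_on \<Omega>. \<phi>0 x \<in> K"
    using ae\<phi>
  proof eventually_elim
    case (elim x)
    then show ?case
      using closed_sequentially[OF K(2), of "\<lambda>n. \<phi> (r n) x" "\<phi>0 x"] by simp
  qed
  moreover have "integrable (lebesgue_on \<Omega>) \<phi>0" unfolding \<phi>0_def by (intro integrable_vec_lambda ru(2))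
  ultimately have W0: "\<phi>0 \<in> W11 \<Omega> K" using JG0 by (auto simp: W11_def)
  note J0 = is_weak_jacobian_weak_jacobian[OF W0]
  have aeq: "AE x in lebesgue_on \<Omega>. weak_jacobian \<Omega> \<phi>0 x = G0 x"
    by (rule weak_jacobian_unique[OF op bd J0 JG0])
  have "AE x in lebesgue_on \<Omega>. (\<lambda>n. ?G (r n) x) \<longlonglongrightarrow> weak_jacobian \<Omega> \<phi>0 x"
    using aeG aeq by eventually_elim simp
  moreover have "(\<lambda>n. LINT x|lebesgue_on \<Omega>. ?G (r n) x $ i $ j * \<psi> x)
        \<longlonglongrightarrow> (LINT x|lebesgue_on \<Omega>. weak_jacobian \<Omega> \<phi>0 x $ i $ j * \<psi> x)" if \<psi>: "test_fun \<Omega> \<psi>" for i j \<psi>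
  proof -
    have "(LINT x|lebesgue_on \<Omega>. weak_jacobian \<Omega> \<phi>0 x $ i $ j * \<psi> x) = (LINT x|lebesgue_on \<Omega>. G0 x $ i $ j * \<psi> x)"
      using is_weak_jacobianD(3)[OF J0 \<psi>, of i j] is_weak_jacobianD(3)[OF JG0 \<psi>, of i j] by simp
    then show ?thesis using weak[OF \<psi>, of "(i, Some j)"] by (simp add: G0_def)
  qed
  ultimately show ?thesis using r W0 ae\<phi> by blast
qed

lemma nn_integral_le_limit:
  fixes f :: "nat \<Rightarrow> 'a \<Rightarrow> ennreal"
  assumes f: "\<And>n. f n \<in> borel_measurable M" and lim: "AE x in M. (\<lambda>n. f n x) \<longlonglongrightarrow> g x"
    and t: "(\<lambda>n. \<integral>\<^sup>+x. f n x \<partial>M) \<longlonglongrightarrow> t"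
  shows "(\<integral>\<^sup>+x. g x \<partial>M) \<le> t"
proof -
  have "(\<integral>\<^sup>+x. g x \<partial>M) = (\<integral>\<^sup>+x. liminf (\<lambda>n. f n x) \<partial>M)"
    by (rule nn_integral_cong_AE, use lim in eventually_elim)
      (metis lim_imp_Liminf trivial_limit_sequentially)
  also have "\<dots> \<le> liminf (\<lambda>n. \<integral>\<^sup>+x. f n x \<partial>M)" by (rule nn_integral_liminf[OF f])
  also have "\<dots> = t" using lim_imp_Liminf[OF _ t] by simp
  finally show ?thesis .
qed

lemma constant_in_BV2:
  assumes \<Omega>: "open \<Omega>" "bounded \<Omega>" and y: "y \<in> K"
  shows "(\<lambda>x. y) \<in> BV2 \<Omega> K"
proof -
  have J: "is_weak_jacobian \<Omega> (\<lambda>x. y) (\<lambda>x. 0)"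
    using integral_const_mult_partial[OF \<Omega>] integrable_const_domain[OF \<Omega>] by (simp add: is_weak_jacobian_def)
  have W: "(\<lambda>x. y) \<in> W11 \<Omega> K" using J y integrable_const_domain[OF \<Omega>] by (auto simp: W11_def)
  let ?G = "weak_jacobian \<Omega> (\<lambda>x. y)"
  note JG = is_weak_jacobian_weak_jacobian[OF W]
  have "(LINT x|lebesgue_on \<Omega>. ?G x $ i $ j * \<psi> x) = 0" if "test_fun \<Omega> \<psi>" for i j \<psi>
    using is_weak_jacobianD(3)[OF JG that, of i j] is_weak_jacobianD(3)[OF J that, of i j] by simp
  then have z: "(LINT x|lebesgue_on \<Omega>. ?G x $ i $ j * partial k (\<lambda>x. p x $ i $ j $ k) x) = 0"
    if "test_fun \<Omega> p" for i j k p
    using test_fun_partial[OF test_fun_component(1)[OF that]] by blast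
  have "TV \<Omega> (\<lambda>x. ?G x - 0) \<le> 0"
    unfolding TV_eq[OF \<Omega> is_weak_jacobianD(1)[OF JG]] by (intro SUP_least) (simp add: z)
  then show ?thesis using W is_weak_jacobianD(1)[OF JG] by (simp add: BV2_def BV_def)
qed

section \<open>Existence of a minimizer\<close>

lemma tendsto_det_2:
  fixes A :: "'a \<Rightarrow> real^2^2"
  assumes "(A \<longlongrightarrow> a) F" shows "((\<lambda>x. det (A x)) \<longlongrightarrow> det a) F"
  unfolding det_2 by (intro tendsto_intros assms)

lemma borel_measurable_f_det:
  assumes "integrable M (G :: 'a \<Rightarrow> real^2^2)"
  shows "(\<lambda>x. f_det (det (G x))) \<in> borel_measurable M"
proof -
  have [measurable]: "(\<lambda>x. G x $ i $ j) \<in> borel_measurable M" for i j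
    by (intro borel_measurable_integrable integrable_vec_nth assms)
  have [measurable]: "f_det \<in> borel_measurable borel"
    by (rule borel_measurable_continuous_onI[OF continuous_f_det])
  show ?thesis unfolding det_2 by measurable
qed

lemma f_det_term_limit:
  assumes G: "\<And>n. integrable M (G n :: 'a \<Rightarrow> real^2^2)" and lim: "AE x in M. (\<lambda>n. G n x) \<longlonglongrightarrow> H x"
    and t: "(\<lambda>n. \<integral>\<^sup>+x. f_det (det (G n x)) \<partial>M) \<longlonglongrightarrow> t"
  shows "(\<integral>\<^sup>+x. f_det (det (H x)) \<partial>M) \<le> t"
proof (rule nn_integral_le_limit[OF borel_measurable_f_det[OF G] _ t])
  show "AE x in M. (\<lambda>n. f_det (det (G n x))) \<longlonglongrightarrow> f_det (det (H x))"
    using lim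
  proof eventually_elim
    case (elim x)
    show ?case by (rule continuous_on_tendsto_compose[OF continuous_f_det tendsto_det_2[OF elim]]) auto
  qed
qed

lemma det_pos_AE:
  assumes G: "integrable M (G :: 'a \<Rightarrow> real^2^2)" and fin: "(\<integral>\<^sup>+x. f_det (det (G x)) \<partial>M) < \<infinity>"
  shows "AE x in M. det (G x) > 0"
proof -
  have "AE x in M. f_det (det (G x)) \<noteq> \<infinity>"
    using fin by (intro nn_integral_PInf_AE[OF borel_measurable_f_det[OF G]]) auto
  then show ?thesis by eventually_elim (auto simp: f_det_def split: if_splits)
qed

text \<open>The integrand is known to be continuous, hence measurable, only on the set of triples \<open>(A, x, y)\<close> with
  \<open>det A > 0\<close>, \<open>x\<close> in the closure of \<open>\<Omega>\<close> and \<open>y\<close> in \<open>K\<close>; cut off by the indicator of this set it becomes Borel measurable without changing the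
  integrals.\<close>

lemma dist_term_limit:
  assumes \<Omega>: "open \<Omega>" and S: "subgroup S SO3" "finite S"
    and I1: "continuous_class_map (closure \<Omega>) S I1" and I2: "continuous_class_map K S I2" and K: "closed K"
    and G: "\<And>n. integrable (lebesgue_on \<Omega>) (G n :: real^2 \<Rightarrow> real^2^2)" "\<And>n. AE x in lebesgue_on \<Omega>. det (G n x) > 0"
      "AE x in lebesgue_on \<Omega>. det (H x) > 0" "AE x in lebesgue_on \<Omega>. (\<lambda>n. G n x) \<longlonglongrightarrow> H x"
    and \<phi>: "\<And>n. \<phi> n \<in> W11 \<Omega> K" "\<phi>0 \<in> W11 \<Omega> K" "AE x in lebesgue_on \<Omega>. (\<lambda>n. \<phi> n x) \<longlonglongrightarrow> \<phi>0 x"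
    and t: "(\<lambda>n. \<integral>\<^sup>+x. ennreal (dist_class (rotation_part (G n x) <#\<^bsub>SO3\<^esub> I1 x) (I2 (\<phi> n x))) \<partial>lebesgue_on \<Omega>) \<longlonglongrightarrow> t"
  shows "(\<integral>\<^sup>+x. ennreal (dist_class (rotation_part (H x) <#\<^bsub>SO3\<^esub> I1 x) (I2 (\<phi>0 x))) \<partial>lebesgue_on \<Omega>) \<le> t"
proof -
  let ?D = "{A :: real^2^2. det A > 0} \<times> closure \<Omega> \<times> K"
  let ?d = "\<lambda>(A, x, y). dist_class (rotation_part A <#\<^bsub>SO3\<^esub> I1 x) (I2 y)"
  have dc: "continuous_on ?D ?d" by (rule dist_class_rotated_continuous[OF S I1 I2])
  have "open {A :: real^2^2. det A > 0}"
    unfolding det_2 by (intro open_Collect_less continuous_intros)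
  then have D: "?D \<in> sets borel" using K by (intro borel_Times) auto
  have e[measurable]: "(\<lambda>z. indicator ?D z *\<^sub>R ?d z) \<in> borel_measurable borel"
    by (rule borel_measurable_continuous_on_indicator[OF D dc])
  define f where "f = (\<lambda>n x. ennreal (indicator ?D (G n x, x, \<phi> n x) *\<^sub>R ?d (G n x, x, \<phi> n x)))"
  have \<phi>m: "\<phi> n \<in> borel_measurable (lebesgue_on \<Omega>)" for n using \<phi>(1)[of n] by (auto simp: W11_def)
  have Gm: "G n \<in> borel_measurable (lebesgue_on \<Omega>)" for n using G(1)[of n] by auto
  have id: "(\<lambda>x. x) \<in> borel_measurable (lebesgue_on \<Omega>)"
    by (intro measurable_restrict_space1 measurable_completion) simp
  have fm: "f n \<in> borel_measurable (lebesgue_on \<Omega>)" for n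
  proof -
    have "(\<lambda>x. (G n x, x, \<phi> n x)) \<in> borel_measurable (lebesgue_on \<Omega>)"
      by (intro borel_measurable_Pair Gm id \<phi>m)
    from measurable_compose[OF this e] show ?thesis unfolding f_def by (intro measurable_compose[OF _ measurable_ennreal])
  qed
  have mem: "AE x in lebesgue_on \<Omega>. \<forall>n. (G n x, x, \<phi> n x) \<in> ?D"
    unfolding AE_all_countable
  proof
    fix n
    have "AE x in lebesgue_on \<Omega>. \<phi> n x \<in> K" using \<phi>(1)[of n] by (simp add: W11_def)
    with G(2)[of n] AE_space show "AE x in lebesgue_on \<Omega>. (G n x, x, \<phi> n x) \<in> ?D"
      by eventually_elim (use closure_subset in auto)
  qed
  have mem0: "AE x in lebesgue_on \<Omega>. (H x, x, \<phi>0 x) \<in> ?D"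
  proof -
    have "AE x in lebesgue_on \<Omega>. \<phi>0 x \<in> K" using \<phi>(2) by (simp add: W11_def)
    with G(3) AE_space show ?thesis by eventually_elim (use closure_subset in auto)
  qed
  have "AE x in lebesgue_on \<Omega>. (\<lambda>n. f n x) \<longlonglongrightarrow> ennreal (?d (H x, x, \<phi>0 x))"
    using mem mem0 G(4) \<phi>(3)
  proof eventually_elim
    case (elim x)
    have "(\<lambda>n. (G n x, x, \<phi> n x)) \<longlonglongrightarrow> (H x, x, \<phi>0 x)" by (intro tendsto_intros elim)
    then have "(\<lambda>n. ?d (G n x, x, \<phi> n x)) \<longlonglongrightarrow> ?d (H x, x, \<phi>0 x)"
      by (rule continuous_on_tendsto_compose[OF dc _ elim(2)]) (use elim(1) in auto)
    moreover have "f n x = ennreal (?d (G n x, x, \<phi> n x))" for n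
      using elim(1) by (simp add: f_def)
    ultimately show ?case by (simp only: tendsto_ennrealI)
  qed
  moreover have "(\<lambda>n. \<integral>\<^sup>+x. f n x \<partial>lebesgue_on \<Omega>) \<longlonglongrightarrow> t"
  proof -
    have "(\<integral>\<^sup>+x. f n x \<partial>lebesgue_on \<Omega>) = (\<integral>\<^sup>+x. ennreal (?d (G n x, x, \<phi> n x)) \<partial>lebesgue_on \<Omega>)" for n
      by (rule nn_integral_cong_AE, use mem in eventually_elim) (simp add: f_def)
    then show ?thesis using t by simp
  qed
  ultimately have "(\<integral>\<^sup>+x. ennreal (?d (H x, x, \<phi>0 x)) \<partial>lebesgue_on \<Omega>) \<le> t"
    by (rule nn_integral_le_limit[OF fm])
  then show ?thesis by simp
qed

lemma ennreal_mult_le_imp_le: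
  assumes "a > 0" "c \<ge> 0" "ennreal a * x \<le> ennreal c"
  shows "x \<le> ennreal (c / a)"
proof -
  have "x = ennreal (1 / a) * (ennreal a * x)"
    using assms(1) by (simp add: ennreal_mult[symmetric] mult.assoc[symmetric] del: ennreal_1) simp
  also have "\<dots> \<le> ennreal (1 / a) * ennreal c" by (rule mult_left_mono[OF assms(3)]) simp
  also have "\<dots> = ennreal (c / a)" using assms(1,2) by (simp add: ennreal_mult[symmetric])
  finally show ?thesis .
qed

theorem theorem3p5:
  fixes \<Omega> \<Omega>1 :: "(real^2) set"
    and S :: "(real^3^3) set"
    and I1 I2 :: "real^2 \<Rightarrow> (real^3^3) set"
    and \<alpha> \<beta> :: real
  assumes "bounded_lipschitz_domain \<Omega>"
    and "bounded_lipschitz_domain \<Omega>1"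
    and "subgroup S SO3"
    and "finite S"
    and "continuous_class_map (closure \<Omega>) S I1"
    and "continuous_class_map (closure \<Omega>1) S I2"
    and "\<alpha> > 0"
    and "\<beta> > 0"
  shows "\<exists>\<phi>\<in>BV2 \<Omega> (closure \<Omega>1). \<forall>\<psi>\<in>BV2 \<Omega> (closure \<Omega>1).
           objective \<Omega> I1 I2 \<alpha> \<beta> \<phi> \<le> objective \<Omega> I1 I2 \<alpha> \<beta> \<psi>"
proof -
  note \<Omega> = assms(1) and S = assms(3,4) and I1 = assms(5) and I2 = assms(6)
  have op: "open \<Omega>" and bd: "bounded \<Omega>" using \<Omega> by (auto simp: bounded_lipschitz_domain_def)
  define K where "K = closure \<Omega>1"
  have K: "bounded K" "closed K" using assms(2) by (auto simp: K_def bounded_lipschitz_domain_def)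
  let ?F = "objective \<Omega> I1 I2 \<alpha> \<beta>" and ?X = "BV2 \<Omega> K"
  define m where "m = (INF \<phi>\<in>?X. ?F \<phi>)"
  obtain y where "y \<in> K" using assms(2) closure_subset by (auto simp: K_def bounded_lipschitz_domain_def)
  then have const: "(\<lambda>x. y) \<in> ?X" by (rule constant_in_BV2[OF op bd])
  have m_le: "m \<le> ?F \<psi>" if "\<psi> \<in> ?X" for \<psi> unfolding m_def using that by (rule INF_lower)
  have "\<exists>\<phi>\<in>?X. ?F \<phi> \<le> m"
  proof (cases "m = \<infinity>")
    case True
    then show ?thesis using const by auto
  next
    case False
    then obtain c where c: "m < ennreal c" "c \<ge> 0"
      by (cases m) (auto intro!: that[of "enn2real m + 1"] ennreal_lessI)
    obtain U where U: "\<And>n. U n \<in> ?F ` ?X" "U \<longlonglongrightarrow> m"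
      using Inf_as_limit[of "?F ` ?X"] const unfolding m_def by blast
    \<comment> \<open>From the index \<open>N\<close> on, the objective is bounded by \<open>c\<close>.\<close>
    obtain N where N: "\<And>n. n \<ge> N \<Longrightarrow> U n < ennreal c"
      using order_tendstoD(2)[OF U(2) c(1)] by (auto simp: eventually_sequentially)
    have "\<forall>n. \<exists>\<phi>. \<phi> \<in> ?X \<and> ?F \<phi> = U (n + N)" using U(1) by (metis imageE)
    then obtain \<phi> where \<phi>: "\<And>n. \<phi> n \<in> ?X" "\<And>n. ?F (\<phi> n) = U (n + N)" by metis
    have lim_F: "(\<lambda>n. ?F (\<phi> n)) \<longlonglongrightarrow> m" unfolding \<phi>(2) by (rule LIMSEQ_ignore_initial_segment[OF U(2)])
    let ?G = "weak_jacobian \<Omega>"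
    define T1 where "T1 = (\<lambda>\<phi>. \<integral>\<^sup>+x. ennreal (dist_class (rotation_part (?G \<phi> x) <#\<^bsub>SO3\<^esub> I1 x) (I2 (\<phi> x))) \<partial>lebesgue_on \<Omega>)"
    define T2 where "T2 = (\<lambda>\<phi>. TV \<Omega> (\<lambda>x. ?G \<phi> x - mat 1))"
    define T3 where "T3 = (\<lambda>\<phi>. \<integral>\<^sup>+x. f_det (det (?G \<phi> x)) \<partial>lebesgue_on \<Omega>)"
    have F: "?F \<phi> = T1 \<phi> + ennreal \<alpha> * T2 \<phi> + ennreal \<beta> * T3 \<phi>" for \<phi>
      by (simp add: objective_def T1_def T2_def T3_def)
    have bounds: "T2 (\<phi> n) \<le> ennreal (c / \<alpha>)" "T3 (\<phi> n) \<le> ennreal (c / \<beta>)" for n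
    proof -
      have le: "T1 (\<phi> n) + ennreal \<alpha> * T2 (\<phi> n) + ennreal \<beta> * T3 (\<phi> n) \<le> ennreal c"
        using N[of "n + N"] F[of "\<phi> n"] \<phi>(2)[of n] by simp
      have "ennreal \<alpha> * T2 (\<phi> n) \<le> ennreal c"
        by (rule order_trans[OF _ le]) (simp add: add.commute add.left_commute add_increasing)
      then show "T2 (\<phi> n) \<le> ennreal (c / \<alpha>)" by (rule ennreal_mult_le_imp_le[OF assms(7) c(2)])
      have "ennreal \<beta> * T3 (\<phi> n) \<le> ennreal c"
        by (rule order_trans[OF _ le]) simp
      then show "T3 (\<phi> n) \<le> ennreal (c / \<beta>)" by (rule ennreal_mult_le_imp_le[OF assms(8) c(2)])
    qed
    \<comment> \<open>In the compact space \<open>[0, \<infinity>]\<close> the three terms may be assumed to converge separately.\<close>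
    obtain t1 s1 where s1: "strict_mono s1" "((\<lambda>n. T1 (\<phi> n)) \<circ> s1) \<longlonglongrightarrow> t1"
      using compact_complete_linorder by metis
    obtain t2 s2 where s2: "strict_mono s2" "((\<lambda>n. T2 (\<phi> (s1 n))) \<circ> s2) \<longlonglongrightarrow> t2"
      using compact_complete_linorder by metis
    obtain t3 s3 where s3: "strict_mono s3" "((\<lambda>n. T3 (\<phi> (s1 (s2 n)))) \<circ> s3) \<longlonglongrightarrow> t3"
      using compact_complete_linorder by metis
    define s where "s = s1 \<circ> s2 \<circ> s3"
    have s: "strict_mono s" unfolding s_def by (intro strict_mono_o s1 s2 s3)
    have \<phi>s: "\<phi> (s n) \<in> ?X" "TV \<Omega> (?G (\<phi> (s n))) \<le> ennreal (c / \<alpha>)" for n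
    proof -
      show X: "\<phi> (s n) \<in> ?X" by (rule \<phi>(1))
      then have "integrable (lebesgue_on \<Omega>) (?G (\<phi> (s n)))" by (simp add: BV2_def BV_def)
      from TV_diff_const[OF op bd this, of "mat 1"] bounds(1)[of "s n"]
      show "TV \<Omega> (?G (\<phi> (s n))) \<le> ennreal (c / \<alpha>)" by (simp add: T2_def)
    qed
    have "c / \<alpha> \<ge> 0" using c(2) assms(7) by simp
    from weak_jacobian_limit[where \<phi> = "\<lambda>n. \<phi> (s n)", OF \<Omega> K this \<phi>s]
    obtain r \<phi>0 where r: "strict_mono (r::nat\<Rightarrow>nat)" and \<phi>0: "\<phi>0 \<in> W11 \<Omega> K"
      and ae: "AE x in lebesgue_on \<Omega>. (\<lambda>n. \<phi> (s (r n)) x) \<longlonglongrightarrow> \<phi>0 x"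
      "AE x in lebesgue_on \<Omega>. (\<lambda>n. ?G (\<phi> (s (r n))) x) \<longlonglongrightarrow> ?G \<phi>0 x"
      and weak: "\<And>i j \<psi>. test_fun \<Omega> \<psi> \<Longrightarrow>
        (\<lambda>n. LINT x|lebesgue_on \<Omega>. ?G (\<phi> (s (r n))) x $ i $ j * \<psi> x)
          \<longlonglongrightarrow> (LINT x|lebesgue_on \<Omega>. ?G \<phi>0 x $ i $ j * \<psi> x)"
      by auto
    let ?\<phi> = "\<lambda>n. \<phi> (s (r n))"
    have lims: "(\<lambda>n. T1 (?\<phi> n)) \<longlonglongrightarrow> t1" "(\<lambda>n. T2 (?\<phi> n)) \<longlonglongrightarrow> t2" "(\<lambda>n. T3 (?\<phi> n)) \<longlonglongrightarrow> t3"
      using LIMSEQ_subseq_LIMSEQ[OF s1(2) strict_mono_o[OF s2(1) strict_mono_o[OF s3(1) r]]]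
        LIMSEQ_subseq_LIMSEQ[OF s2(2) strict_mono_o[OF s3(1) r]] LIMSEQ_subseq_LIMSEQ[OF s3(2) r]
      by (simp_all add: s_def o_def)
    have Wn: "?\<phi> n \<in> W11 \<Omega> K" and Gn: "integrable (lebesgue_on \<Omega>) (?G (?\<phi> n))" for n
      using \<phi>(1) by (auto simp: BV2_def BV_def)
    have G0: "integrable (lebesgue_on \<Omega>) (?G \<phi>0)"
      by (rule is_weak_jacobianD(1)[OF is_weak_jacobian_weak_jacobian[OF \<phi>0]])
    have t3: "T3 \<phi>0 \<le> t3"
      unfolding T3_def by (rule f_det_term_limit[OF Gn ae(2) lims(3)[unfolded T3_def]])
    have t2: "T2 \<phi>0 \<le> t2"
      unfolding T2_def by (rule TV_lower_semicontinuous[OF op bd Gn G0 weak lims(2)[unfolded T2_def]])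
    have fin: "t2 \<le> ennreal (c / \<alpha>)" "t3 \<le> ennreal (c / \<beta>)"
      using lims(2,3) bounds by (auto intro: LIMSEQ_le_const2)
    have posn: "AE x in lebesgue_on \<Omega>. det (?G (?\<phi> n) x) > 0" for n
      using bounds(2)[of "s (r n)"] by (intro det_pos_AE[OF Gn]) (auto simp: T3_def intro: le_less_trans)
    have pos0: "AE x in lebesgue_on \<Omega>. det (?G \<phi>0 x) > 0"
      using order_trans[OF t3 fin(2)] by (intro det_pos_AE[OF G0]) (auto simp: T3_def intro: le_less_trans)
    have t1: "T1 \<phi>0 \<le> t1"
      unfolding T1_def
      by (rule dist_term_limit[OF op S I1 I2[folded K_def] K(2) Gn posn pos0 ae(2) Wn \<phi>0 ae(1) lims(1)[unfolded T1_def]])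
    have "TV \<Omega> (?G \<phi>0) \<le> ennreal (c / \<alpha>)"
      using TV_diff_const[OF op bd G0, of "mat 1"] order_trans[OF t2 fin(1)] by (simp add: T2_def)
    then have X0: "\<phi>0 \<in> ?X" using \<phi>0 G0 by (auto simp: BV2_def BV_def intro: le_less_trans)
    have "(\<lambda>n. T1 (?\<phi> n) + ennreal \<alpha> * T2 (?\<phi> n) + ennreal \<beta> * T3 (?\<phi> n)) \<longlonglongrightarrow> t1 + ennreal \<alpha> * t2 + ennreal \<beta> * t3"
      by (intro tendsto_add ennreal_tendsto_cmult lims) auto
    moreover have "(\<lambda>n. ?F (?\<phi> n)) \<longlonglongrightarrow> m"
      using LIMSEQ_subseq_LIMSEQ[OF lim_F strict_mono_o[OF s r]] by (simp add: o_def)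
    ultimately have "m = t1 + ennreal \<alpha> * t2 + ennreal \<beta> * t3"
      unfolding F by (rule LIMSEQ_unique[rotated])
    moreover have "?F \<phi>0 \<le> t1 + ennreal \<alpha> * t2 + ennreal \<beta> * t3"
      unfolding F by (intro add_mono mult_left_mono t1 t2 t3) auto
    ultimately show ?thesis using X0 by auto
  qed
  then show ?thesis using m_le unfolding K_def by (meson order_trans)
qed

end
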